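(* Let $K$ be an unconstrained Sierpinski carpet and let $\mu$ be the $d_H$-dimensional normalized Hausdorff measure on $K$. There is a strongly local, regular, irreducible, $D_4$-symmetric, self-similar Dirichlet form $(\mathcal{E},\mathcal{F})$ on $L^2(K,\mu)$. In addition, $\mathcal{F}=\bar{\mathcal{F}}$ and there are constants $C,C'>0$ such that $$C\cdot\bar{\mathcal{E}}(f)\le\mathcal{E}(f)\le C'\cdot\bar{\mathcal{E}}(f)\quad\text{for every } f\in\mathcal{F},$$ where $(\bar{\mathcal{E}},\bar{\mathcal{F}})$ is the limit form described in the context.
   Context: Unconstrained Sierpinski carpets. Let $\square=[0,1]^2\subset\mathbb{R}^2$ with vertices $q_1=(0,0),q_2=(1,0),q_3=(1,1),q_4=(0,1)$, let $\overline{x,y}$ denote the line segment between $x,y$, and let $\mathscr{G}$ be the group of the eight self-isometries of $\square$. Let $k\ge 3$ and $4(k-1)\le N\le k^2-1$ be integers, and let $\{\Psi_i\}_{1\le i\le N}$ be similarities $\Psi_i(x)=\frac{x}{k}+c_i$, $c_i\in\mathbb{R}^2$, such that: (Non-overlapping) for $i\ne j$, $\Psi_i(\square)\cap\Psi_j(\square)$ is a line segment, a point, or empty; (Connectivity) $\bigcup_{i=1}^N\Psi_i(\square)$ is connected; (Symmetry) $\Gamma(\bigcup_{i=1}^N\Psi_i(\square))=\bigcup_{i=1}^N\Psi_i(\square)$ for all $\Gamma\in\mathscr{G}$; (Boundary included) $\overline{q_1,q_2}\subset\bigcup_{i=1}^N\Psi_i(\square)\subset\square$. The unique nonempty compact $K\subset\square$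 with $K=\bigcup_{i=1}^N\Psi_i(K)$ is called an unconstrained Sierpinski carpet. Measure. $\mu$ is the $d_H$-dimensional Hausdorff measure on $K$ normalized to a probability measure, $d_H=\frac{\log N}{\log k}$. Terminology. Write $\mathcal{E}(f)=\mathcal{E}(f,f)$. $(\mathcal{E},\mathcal{F})$ is $D_4$-symmetric if $f\circ\Gamma\in\mathcal{F}$ and $\mathcal{E}(f\circ\Gamma)=\mathcal{E}(f)$ for all $f\in\mathcal{F}$, $\Gamma\in\mathscr{G}$. A regular Dirichlet form $(\mathcal{E},\mathcal{F})$ on $L^2(K,\mu)$ is self-similar if $\mathcal{F}\cap C(K)=\{f\in C(K): f\circ\Psi_i\in\mathcal{F}\text{ for every }1\le i\le N\}$ and there is a constant $\rho>0$ (the renormalization factor) such that $\mathcal{E}(f)=\sum_{i=1}^N\rho^{-1}\mathcal{E}(f\circ\Psi_i)$ for every $f\in\mathcal{F}$. Discrete energies. Let $W_n=\{1,\dots,N\}^n$, $\Psi_w=\Psi_{w_1}\circ\cdots\circ\Psi_{w_n}$ for $w=w_1\cdots w_n\in W_n$, and for $w\ne w'$ in $W_n$ write $w\stackrel{n}{\sim}w'$ if $\Psi_wK\cap\Psi_{w'}K\ne\emptyset$. For $f:W_n\to\mathbb{R}$ let $\mathcal{D}_n(f)=\sum_{w\stackrel{n}{\sim}w'}(f(w)-f(w'))^2$ (sum over unordered pairs) and $[f]_{W_n}=N^{-n}\sum_{w\in W_n}f(w)$. For $f\in L^1(K,\mu)$ let $(P_nf)(w)=N^n\int_{\Psi_wK}f\,d\mu$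 and $\mathcal{D}_n(f)=\mathcal{D}_n(P_nf)$. Let $\lambda_n=\sup\{\sum_{w\in W_n}(f(w)-[f]_{W_n})^2: f:W_n\to\mathbb{R},\ \mathcal{D}_n(f)=1\}$. There is a unique $r>0$ such that $N^{-n}\lambda_n\asymp r^{-n}$ (ratio bounded above and below by positive constants independent of $n$), and $r\le N/k^2<1$. Limit form. $\bar{\mathcal{F}}=\{f\in L^2(K,\mu):\sup_{n\ge1}r^{-n}\mathcal{D}_n(f)<\infty\}$, and $(\bar{\mathcal{E}},\bar{\mathcal{F}})$ is a fixed $D_4$-symmetric regular Dirichlet form on $L^2(K,\mu)$, arising as a $\Gamma$-limit on $L^2(K,\mu)$ of a subsequence of $r^{-n}\mathcal{D}_n$, for which there are $C_1,C_2>0$ with $C_1\sup_{n\ge1}r^{-n}\mathcal{D}_n(f)\le\bar{\mathcal{E}}(f)\le C_2\liminf_{n\to\infty}r^{-n}\mathcal{D}_n(f)$ for every $f\in\bar{\mathcal{F}}$. *)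

theory Defs
  imports "HOL-Analysis.Analysis"
begin

section \<open>Hausdorff measure\<close>

text \<open>
  Covering sets are required to be bounded because \<^const>\<open>diameter\<close> of an unbounded set is \<open>0\<close>.
  The definition is meant for \<open>s > 0\<close> only, since \<open>0 powr 0 = 0\<close>.
\<close>

definition hausdorff_pre :: "real \<Rightarrow> real \<Rightarrow> 'a::metric_space set \<Rightarrow> ennreal" where
  "hausdorff_pre s \<delta> A =
     (INF C \<in> {C :: nat \<Rightarrow> 'a set. A \<subseteq> (\<Union>n. C n) \<and> (\<forall>n. bounded (C n) \<and> diameter (C n) \<le> \<delta>)}.
        (\<Sum>n. ennreal (diameter (C n) powr s)))"

definition hausdorff_outer :: "real \<Rightarrow> 'a::metric_space set \<Rightarrow> ennreal" where
  "hausdorff_outer s A = (SUP \<delta> \<in> {0<..}. hausdorff_pre s \<delta> A)"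

definition normalized_hausdorff :: "real \<Rightarrow> 'a::metric_space set \<Rightarrow> 'a measure" where
  "normalized_hausdorff s K =
     measure_of K (sets (restrict_space borel K)) (\<lambda>A. hausdorff_outer s A / hausdorff_outer s K)"


section \<open>Dirichlet forms\<close>

text \<open>
  Elements of \<open>L\<^sup>2\<close> are represented by square integrable functions; values outside \<^term>\<open>space M\<close>
  play no role. A subset of \<open>L\<^sup>2\<close> is represented by the set of all representatives of its members.
\<close>

definition L2 :: "'a measure \<Rightarrow> ('a \<Rightarrow> real) set" where
  "L2 M = {f \<in> borel_measurable M. integrable M (\<lambda>x. (f x)\<^sup>2)}"

definition L2_tendsto :: "'a measure \<Rightarrow> (nat \<Rightarrow> 'a \<Rightarrow> real) \<Rightarrow> ('a \<Rightarrow> real) \<Rightarrow> bool" where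
  "L2_tendsto M u f \<longleftrightarrow> (\<lambda>n. \<integral>x. (u n x - f x)\<^sup>2 \<partial>M) \<longlonglongrightarrow> 0"

text \<open>The squared norm usually written \<open>\<E>\<^sub>1(f)\<close>.\<close>

definition form_norm2 ::
  "'a measure \<Rightarrow> (('a \<Rightarrow> real) \<Rightarrow> ('a \<Rightarrow> real) \<Rightarrow> real) \<Rightarrow> ('a \<Rightarrow> real) \<Rightarrow> real" where
  "form_norm2 M E f = E f f + (\<integral>x. (f x)\<^sup>2 \<partial>M)"

locale dirichlet_form =
  fixes M :: "'a measure"
    and E :: "('a \<Rightarrow> real) \<Rightarrow> ('a \<Rightarrow> real) \<Rightarrow> real"
    and F :: "('a \<Rightarrow> real) set"
  assumes domain: "F \<subseteq> L2 M"
    and domain_AE: "\<And>f g. f \<in> F \<Longrightarrow> g \<in> borel_measurable M \<Longrightarrow> AE x in M. f x = g x \<Longrightarrow> g \<in> F"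
    and form_AE: "\<And>f g h. f \<in> F \<Longrightarrow> g \<in> F \<Longrightarrow> h \<in> F \<Longrightarrow> AE x in M. f x = g x \<Longrightarrow> E f h = E g h"
    and zero: "(\<lambda>x. 0) \<in> F"
    and add: "\<And>f g. f \<in> F \<Longrightarrow> g \<in> F \<Longrightarrow> (\<lambda>x. f x + g x) \<in> F"
    and scale: "\<And>a f. f \<in> F \<Longrightarrow> (\<lambda>x. a * f x) \<in> F"
    and form_add: "\<And>f g h. f \<in> F \<Longrightarrow> g \<in> F \<Longrightarrow> h \<in> F \<Longrightarrow> E (\<lambda>x. f x + g x) h = E f h + E g h"
    and form_scale: "\<And>a f h. f \<in> F \<Longrightarrow> h \<in> F \<Longrightarrow> E (\<lambda>x. a * f x) h = a * E f h"
    and form_sym: "\<And>f g. f \<in> F \<Longrightarrow> g \<in> F \<Longrightarrow> E f g = E g f"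
    and form_nonneg: "\<And>f. f \<in> F \<Longrightarrow> 0 \<le> E f f"
    and dense: "\<And>f \<epsilon>. f \<in> L2 M \<Longrightarrow> 0 < \<epsilon> \<Longrightarrow> \<exists>g\<in>F. (\<integral>x. (f x - g x)\<^sup>2 \<partial>M) < \<epsilon>"
    and closed: "\<And>u. (\<And>n. u n \<in> F) \<Longrightarrow>
        (\<forall>\<epsilon>>0. \<exists>n0. \<forall>m\<ge>n0. \<forall>n\<ge>n0. form_norm2 M E (\<lambda>x. u m x - u n x) < \<epsilon>) \<Longrightarrow>
        \<exists>f\<in>F. (\<lambda>n. form_norm2 M E (\<lambda>x. u n x - f x)) \<longlonglongrightarrow> 0"
    and markov_domain: "\<And>f. f \<in> F \<Longrightarrow> (\<lambda>x. min (max (f x) 0) 1) \<in> F"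
    and markov: "\<And>f. f \<in> F \<Longrightarrow>
        E (\<lambda>x. min (max (f x) 0) 1) (\<lambda>x. min (max (f x) 0) 1) \<le> E f f"

definition compactly_supported_continuous :: "'a::topological_space set \<Rightarrow> ('a \<Rightarrow> real) set" where
  "compactly_supported_continuous X =
     {f. continuous_on X f \<and> (\<exists>L. compact L \<and> L \<subseteq> X \<and> (\<forall>x\<in>X - L. f x = 0))}"

definition regular_form ::
  "'a::topological_space measure \<Rightarrow> (('a \<Rightarrow> real) \<Rightarrow> ('a \<Rightarrow> real) \<Rightarrow> real) \<Rightarrow> ('a \<Rightarrow> real) set \<Rightarrow> bool" where
  "regular_form M E F \<longleftrightarrow>
     (\<forall>f \<in> compactly_supported_continuous (space M). \<forall>\<epsilon>>0.
        \<exists>g \<in> F \<inter> compactly_supported_continuous (space M). \<forall>x\<in>space M. \<bar>f x - g x\<bar> < \<epsilon>) \<and>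
     (\<forall>f\<in>F. \<forall>\<epsilon>>0.
        \<exists>g \<in> F \<inter> compactly_supported_continuous (space M). form_norm2 M E (\<lambda>x. f x - g x) < \<epsilon>)"

text \<open>The support of the measure with density \<^term>\<open>\<bar>f\<bar>\<close>; it depends only on the class of \<open>f\<close>.\<close>

definition ae_support :: "'a::topological_space measure \<Rightarrow> ('a \<Rightarrow> real) \<Rightarrow> 'a set" where
  "ae_support M f = {x \<in> space M. \<forall>U. open U \<and> x \<in> U \<longrightarrow> \<not> (AE y in M. y \<in> U \<longrightarrow> f y = 0)}"

definition strongly_local ::
  "'a::topological_space measure \<Rightarrow> (('a \<Rightarrow> real) \<Rightarrow> ('a \<Rightarrow> real) \<Rightarrow> real) \<Rightarrow> ('a \<Rightarrow> real) set \<Rightarrow> bool" where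
  "strongly_local M E F \<longleftrightarrow>
     (\<forall>f\<in>F. \<forall>g\<in>F. compact (ae_support M f) \<and> compact (ae_support M g) \<and>
        (\<exists>U a. open U \<and> ae_support M f \<subseteq> U \<and> (AE x in M. x \<in> U \<longrightarrow> g x = a)) \<longrightarrow> E f g = 0)"

text \<open>A set is invariant if the form splits orthogonally along it and its complement.\<close>

definition invariant_set ::
  "'a measure \<Rightarrow> (('a \<Rightarrow> real) \<Rightarrow> ('a \<Rightarrow> real) \<Rightarrow> real) \<Rightarrow> ('a \<Rightarrow> real) set \<Rightarrow> 'a set \<Rightarrow> bool" where
  "invariant_set M E F A \<longleftrightarrow> A \<in> sets M \<and>
     (\<forall>f\<in>F. (\<lambda>x. indicator A x * f x) \<in> F \<and> (\<lambda>x. indicator (- A) x * f x) \<in> F \<and>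
        E f f = E (\<lambda>x. indicator A x * f x) (\<lambda>x. indicator A x * f x)
              + E (\<lambda>x. indicator (- A) x * f x) (\<lambda>x. indicator (- A) x * f x))"

definition irreducible_form ::
  "'a measure \<Rightarrow> (('a \<Rightarrow> real) \<Rightarrow> ('a \<Rightarrow> real) \<Rightarrow> real) \<Rightarrow> ('a \<Rightarrow> real) set \<Rightarrow> bool" where
  "irreducible_form M E F \<longleftrightarrow>
     (\<forall>A. invariant_set M E F A \<longrightarrow> emeasure M A = 0 \<or> emeasure M (space M - A) = 0)"

text \<open>\<open>\<Gamma>\<close>-convergence with respect to the strong topology of \<open>L\<^sup>2\<close>.\<close>

definition gamma_converges ::
  "'a measure \<Rightarrow> (nat \<Rightarrow> ('a \<Rightarrow> real) \<Rightarrow> ereal) \<Rightarrow> (('a \<Rightarrow> real) \<Rightarrow> ereal) \<Rightarrow> bool" where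
  "gamma_converges M \<Phi> \<Phi>' \<longleftrightarrow>
     (\<forall>f\<in>L2 M. \<forall>u. (\<forall>n. u n \<in> L2 M) \<and> L2_tendsto M u f \<longrightarrow> \<Phi>' f \<le> liminf (\<lambda>n. \<Phi> n (u n))) \<and>
     (\<forall>f\<in>L2 M. \<exists>u. (\<forall>n. u n \<in> L2 M) \<and> L2_tendsto M u f \<and> limsup (\<lambda>n. \<Phi> n (u n)) \<le> \<Phi>' f)"


section \<open>Unconstrained Sierpinski carpets\<close>

definition unit_square :: "(real \<times> real) set" where
  "unit_square = cbox (0, 0) (1, 1)"

text \<open>
  Each self-isometry of the square is the restriction of exactly one isometry of the plane,
  so this set has eight elements.
\<close>

definition square_isometries :: "(real \<times> real \<Rightarrow> real \<times> real) set" where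
  "square_isometries = {\<Gamma>. (\<forall>x y. dist (\<Gamma> x) (\<Gamma> y) = dist x y) \<and> \<Gamma> ` unit_square = unit_square}"

definition Psi :: "nat \<Rightarrow> (nat \<Rightarrow> real \<times> real) \<Rightarrow> nat \<Rightarrow> real \<times> real \<Rightarrow> real \<times> real" where
  "Psi k c i x = x /\<^sub>R real k + c i"

locale unconstrained_carpet =
  fixes k N :: nat
    and c :: "nat \<Rightarrow> real \<times> real"
    and K :: "(real \<times> real) set"
  assumes k_ge: "3 \<le> k"
    and N_ge: "4 * (k - 1) \<le> N"
    and N_le: "N \<le> k\<^sup>2 - 1"
    and non_overlapping: "\<And>i j. i \<in> {1..N} \<Longrightarrow> j \<in> {1..N} \<Longrightarrow> i \<noteq> j \<Longrightarrow>
        (\<exists>x y. Psi k c i ` unit_square \<inter> Psi k c j ` unit_square = closed_segment x y) \<or>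
        (\<exists>x. Psi k c i ` unit_square \<inter> Psi k c j ` unit_square = {x}) \<or>
        Psi k c i ` unit_square \<inter> Psi k c j ` unit_square = {}"
    and connectivity: "connected (\<Union>i\<in>{1..N}. Psi k c i ` unit_square)"
    and symmetry: "\<And>\<Gamma>. \<Gamma> \<in> square_isometries \<Longrightarrow>
        \<Gamma> ` (\<Union>i\<in>{1..N}. Psi k c i ` unit_square) = (\<Union>i\<in>{1..N}. Psi k c i ` unit_square)"
    and boundary_included:
        "closed_segment (0, 0) (1, 0) \<subseteq> (\<Union>i\<in>{1..N}. Psi k c i ` unit_square)"
        "(\<Union>i\<in>{1..N}. Psi k c i ` unit_square) \<subseteq> unit_square"
    and K_compact: "compact K"
    and K_nonempty: "K \<noteq> {}"
    and K_subset: "K \<subseteq> unit_square"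
    and K_self_similar: "K = (\<Union>i\<in>{1..N}. Psi k c i ` K)"

definition carpet_measure :: "nat \<Rightarrow> nat \<Rightarrow> (real \<times> real) set \<Rightarrow> (real \<times> real) measure" where
  "carpet_measure k N K = normalized_hausdorff (ln (real N) / ln (real k)) K"

definition D4_symmetric ::
  "((real \<times> real \<Rightarrow> real) \<Rightarrow> (real \<times> real \<Rightarrow> real) \<Rightarrow> real) \<Rightarrow> (real \<times> real \<Rightarrow> real) set \<Rightarrow> bool" where
  "D4_symmetric E F \<longleftrightarrow>
     (\<forall>f\<in>F. \<forall>\<Gamma>\<in>square_isometries. f \<circ> \<Gamma> \<in> F \<and> E (f \<circ> \<Gamma>) (f \<circ> \<Gamma>) = E f f)"

text \<open>
  The requirement \<^term>\<open>f \<circ> Psi k c i \<in> F\<close> for all \<^term>\<open>f \<in> F\<close> is implicit in the scaling identity,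
  whose right-hand side is only meaningful on the domain of the form.
\<close>

definition self_similar_form ::
  "nat \<Rightarrow> nat \<Rightarrow> (nat \<Rightarrow> real \<times> real) \<Rightarrow> (real \<times> real) set \<Rightarrow>
   ((real \<times> real \<Rightarrow> real) \<Rightarrow> (real \<times> real \<Rightarrow> real) \<Rightarrow> real) \<Rightarrow> (real \<times> real \<Rightarrow> real) set \<Rightarrow> bool" where
  "self_similar_form k N c K E F \<longleftrightarrow>
     {f \<in> F. continuous_on K f} = {f. continuous_on K f \<and> (\<forall>i\<in>{1..N}. f \<circ> Psi k c i \<in> F)} \<and>
     (\<exists>\<rho>>0. \<forall>f\<in>F. (\<forall>i\<in>{1..N}. f \<circ> Psi k c i \<in> F) \<and>
        E f f = (\<Sum>i\<in>{1..N}. inverse \<rho> * E (f \<circ> Psi k c i) (f \<circ> Psi k c i)))"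


section \<open>Discrete energies\<close>

definition words :: "nat \<Rightarrow> nat \<Rightarrow> nat list set" where
  "words N n = {w. length w = n \<and> set w \<subseteq> {1..N}}"

text \<open>\<^term>\<open>Psi_word k c [i, j]\<close> is \<^term>\<open>Psi k c i \<circ> Psi k c j\<close>.\<close>

definition Psi_word :: "nat \<Rightarrow> (nat \<Rightarrow> real \<times> real) \<Rightarrow> nat list \<Rightarrow> real \<times> real \<Rightarrow> real \<times> real" where
  "Psi_word k c w x = foldr (Psi k c) w x"

definition neighbours ::
  "nat \<Rightarrow> nat \<Rightarrow> (nat \<Rightarrow> real \<times> real) \<Rightarrow> (real \<times> real) set \<Rightarrow> nat \<Rightarrow> (nat list \<times> nat list) set" where
  "neighbours k N c K n =
     {(w, w'). w \<in> words N n \<and> w' \<in> words N n \<and> w \<noteq> w' \<and>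
        Psi_word k c w ` K \<inter> Psi_word k c w' ` K \<noteq> {}}"

text \<open>The factor \<open>1/2\<close> turns the sum over ordered pairs into the sum over unordered pairs.\<close>

definition graph_energy ::
  "nat \<Rightarrow> nat \<Rightarrow> (nat \<Rightarrow> real \<times> real) \<Rightarrow> (real \<times> real) set \<Rightarrow> nat \<Rightarrow> (nat list \<Rightarrow> real) \<Rightarrow> real" where
  "graph_energy k N c K n f = (\<Sum>(w, w')\<in>neighbours k N c K n. (f w - f w')\<^sup>2) / 2"

definition word_mean :: "nat \<Rightarrow> nat \<Rightarrow> (nat list \<Rightarrow> real) \<Rightarrow> real" where
  "word_mean N n f = (\<Sum>w\<in>words N n. f w) / real N ^ n"

definition cell_mean ::
  "nat \<Rightarrow> nat \<Rightarrow> (nat \<Rightarrow> real \<times> real) \<Rightarrow> (real \<times> real) set \<Rightarrow> nat \<Rightarrow>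
   (real \<times> real \<Rightarrow> real) \<Rightarrow> nat list \<Rightarrow> real" where
  "cell_mean k N c K n f w = real N ^ n * (LINT x:Psi_word k c w ` K|carpet_measure k N K. f x)"

definition cell_energy ::
  "nat \<Rightarrow> nat \<Rightarrow> (nat \<Rightarrow> real \<times> real) \<Rightarrow> (real \<times> real) set \<Rightarrow> nat \<Rightarrow> (real \<times> real \<Rightarrow> real) \<Rightarrow> real" where
  "cell_energy k N c K n f = graph_energy k N c K n (cell_mean k N c K n f)"

text \<open>
  The constant \<open>\<lambda>\<^sub>n\<close>, extended-real valued so that the supremum needs no boundedness. It is only of
  interest for \<open>n \<ge> 1\<close>: for \<open>n = 0\<close> the energy vanishes identically and the set below is empty.
\<close>

definition poincare_const ::
  "nat \<Rightarrow> nat \<Rightarrow> (nat \<Rightarrow> real \<times> real) \<Rightarrow> (real \<times> real) set \<Rightarrow> nat \<Rightarrow> ereal" where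
  "poincare_const k N c K n =
     (SUP f \<in> {f. graph_energy k N c K n f = 1}. ereal (\<Sum>w\<in>words N n. (f w - word_mean N n f)\<^sup>2))"

definition is_energy_scaling ::
  "nat \<Rightarrow> nat \<Rightarrow> (nat \<Rightarrow> real \<times> real) \<Rightarrow> (real \<times> real) set \<Rightarrow> real \<Rightarrow> bool" where
  "is_energy_scaling k N c K r \<longleftrightarrow> 0 < r \<and>
     (\<exists>a>0. \<exists>b>0. \<forall>n\<ge>1.
        ereal (a * inverse r ^ n) \<le> ereal (inverse (real N) ^ n) * poincare_const k N c K n \<and>
        ereal (inverse (real N) ^ n) * poincare_const k N c K n \<le> ereal (b * inverse r ^ n))"


section \<open>The limit form\<close>

definition scaled_energy ::
  "nat \<Rightarrow> nat \<Rightarrow> (nat \<Rightarrow> real \<times> real) \<Rightarrow> (real \<times> real) set \<Rightarrow> real \<Rightarrow> nat \<Rightarrow>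
   (real \<times> real \<Rightarrow> real) \<Rightarrow> ereal" where
  "scaled_energy k N c K r n f = ereal (inverse r ^ n * cell_energy k N c K n f)"

definition limit_domain ::
  "nat \<Rightarrow> nat \<Rightarrow> (nat \<Rightarrow> real \<times> real) \<Rightarrow> (real \<times> real) set \<Rightarrow> real \<Rightarrow> (real \<times> real \<Rightarrow> real) set" where
  "limit_domain k N c K r =
     {f \<in> L2 (carpet_measure k N K). (SUP n\<in>{1..}. scaled_energy k N c K r n f) < \<infinity>}"

definition is_limit_form ::
  "nat \<Rightarrow> nat \<Rightarrow> (nat \<Rightarrow> real \<times> real) \<Rightarrow> (real \<times> real) set \<Rightarrow> real \<Rightarrow>
   ((real \<times> real \<Rightarrow> real) \<Rightarrow> (real \<times> real \<Rightarrow> real) \<Rightarrow> real) \<Rightarrow> bool" where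
  "is_limit_form k N c K r E \<longleftrightarrow>
     dirichlet_form (carpet_measure k N K) E (limit_domain k N c K r) \<and>
     regular_form (carpet_measure k N K) E (limit_domain k N c K r) \<and>
     D4_symmetric E (limit_domain k N c K r) \<and>
     (\<exists>s. strict_mono s \<and>
        gamma_converges (carpet_measure k N K) (\<lambda>n. scaled_energy k N c K r (s n))
          (\<lambda>f. if f \<in> limit_domain k N c K r then ereal (E f f) else \<infinity>)) \<and>
     (\<exists>C\<^sub>1>0. \<exists>C\<^sub>2>0. \<forall>f\<in>limit_domain k N c K r.
        ereal C\<^sub>1 * (SUP n\<in>{1..}. scaled_energy k N c K r n f) \<le> ereal (E f f) \<and>
        ereal (E f f) \<le> ereal C\<^sub>2 * liminf (\<lambda>n. scaled_energy k N c K r n f))"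

end

theory Submission
  imports Defs
begin

text \<open>
  Composing \<open>f\<close> with the cell maps and summing defines the rescaled forms
  \<open>\<E>\<^sub>n(f) = r\<^sup>-\<^sup>n (\<Sum>w\<in>W\<^sub>n. Ebar (f \<circ> \<Psi>\<^sub>w))\<close>, and a cluster point of their Cesaro means (in the compact
  product topology on functions of pairs) is self-similar with renormalization factor \<open>r\<close>. Everything
  rests on \<open>\<E>\<^sub>n\<close> being comparable to \<open>Ebar\<close> uniformly in \<open>n\<close>. The upper bound is the superadditivity of
  the discrete energies. For the lower bound, testing the Poincare inequality with a coordinate
  function gives \<open>r < 1\<close>; telescoping cell averages then bounds the oscillation of a continuous \<open>f\<close> by
  its energy, so that energy differences across touching cells are controlled by the energies inside
  the cells. Since a cell touches boundedly many others, summing over all cells loses only a constant.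
\<close>

section \<open>Hausdorff measure under similarities\<close>

text \<open>The rescaled forms need not converge or be monotone in the level; they are only bounded.
  Raising the level by one is exactly the operation whose fixed points are the self-similar forms,
  and Cesaro means change under it by \<open>O(1/n)\<close>. The pairs of functions form an
  uncountable index set, so compactness supplies a filter finer than \<open>sequentially\<close> in
  place of a subsequence. Algebraic identities and the Markov inequality survive a pointwise limit;
  closedness and regularity do not by themselves, and are inherited from \<open>Ebar\<close> through
  the two-sided comparison. Strong locality comes from self-similarity, since the energy splits over
  arbitrarily small cells, and irreducibility from the oscillation bound. That bound speaks of
  values at points, whereas elements of the domain are determined only up to null sets; regularity
  of \<open>Ebar\<close> closes the gap by providing continuous representatives.\<close>

lemma hausdorff_pre_similarity_le:
  fixes g :: "'a::metric_space \<Rightarrow> 'b::metric_space"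
  assumes t: "0 < t" and g: "\<And>x y. dist (g x) (g y) = t * dist x y"
  shows "hausdorff_pre s (t * \<delta>) (g ` A) \<le> ennreal (t powr s) * hausdorff_pre s \<delta> A"
proof -
  have diam: "bounded (g ` C)" "diameter (g ` C) = t * diameter C" if C: "bounded C" for C :: "'a set"
  proof -
    show "bounded (g ` C)"
    proof -
      obtain x e where e: "\<forall>y\<in>C. dist x y \<le> e" using C unfolding bounded_def by blast
      show ?thesis unfolding bounded_def
        by (rule exI[of _ "g x"], rule exI[of _ "t * e"]) (use e t in \<open>auto simp: g mult_left_mono\<close>)
    qed
    show "diameter (g ` C) = t * diameter C"
    proof (cases "C = {}")
      case False
      have b1: "dist x y \<le> diameter C" if "x \<in> C" "y \<in> C" for x y
        using diameter_bounded_bound[OF C] that by auto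
      have b2: "dist x y \<le> diameter (g ` C)" if "x \<in> g ` C" "y \<in> g ` C" for x y
        using diameter_bounded_bound[OF \<open>bounded (g ` C)\<close>] that by auto
      have "diameter (g ` C) \<le> t * diameter C"
        unfolding diameter_def[of "g ` C"] using False b1 t
        by (auto intro!: cSUP_least simp: g mult_left_mono)
      moreover have "diameter C \<le> diameter (g ` C) / t"
      proof -
        have "dist x y \<le> diameter (g ` C) / t" if "x \<in> C" "y \<in> C" for x y
          using b2[of "g x" "g y"] that t by (simp add: g pos_le_divide_eq mult.commute)
        then show ?thesis
          unfolding diameter_def[of C] using False by (auto intro!: cSUP_least)
      qed
      ultimately show ?thesis using t by (simp add: pos_le_divide_eq mult.commute)
    qed simp
  qed
  \<comment> \<open>The factor is divided out on the left so that the right-hand side is a bare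
    infimum, bounded below one cover at a time.\<close>
  have "hausdorff_pre s (t * \<delta>) (g ` A) / ennreal (t powr s) \<le> hausdorff_pre s \<delta> A"
    unfolding hausdorff_pre_def[of s \<delta> A]
  proof (rule INF_greatest)
    fix C assume "C \<in> {C :: nat \<Rightarrow> 'a set. A \<subseteq> (\<Union>n. C n) \<and> (\<forall>n. bounded (C n) \<and> diameter (C n) \<le> \<delta>)}"
    then have C: "A \<subseteq> (\<Union>n. C n)" "\<And>n. bounded (C n)" "\<And>n. diameter (C n) \<le> \<delta>" by auto
    have "hausdorff_pre s (t * \<delta>) (g ` A) \<le> (\<Sum>n. ennreal (diameter (g ` C n) powr s))"
      unfolding hausdorff_pre_def
      by (rule INF_lower2[of "\<lambda>n. g ` C n"]) (use C t in \<open>auto simp: diam image_UN[symmetric] intro!: image_mono\<close>)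
    also have "\<dots> = (\<Sum>n. ennreal (t powr s) * ennreal (diameter (C n) powr s))"
      using C t by (simp add: diam powr_mult diameter_ge_0 ennreal_mult)
    also have "\<dots> = ennreal (t powr s) * (\<Sum>n. ennreal (diameter (C n) powr s))"
      by simp
    finally show "hausdorff_pre s (t * \<delta>) (g ` A) / ennreal (t powr s)
        \<le> (\<Sum>n. ennreal (diameter (C n) powr s))"
      using t by (intro divide_le_posI_ennreal) auto
  qed
  then show ?thesis
    using t by (metis divide_le_posI_ennreal ennreal_mult_divide_eq ennreal_mult_le_mult_iff
        ennreal_neq_top ennreal_times_divide mult.commute mult_left_mono powr_eq_0_iff ennreal_eq_0_iff
        less_le_not_le powr_ge_zero order_antisym zero_le)
qed

lemma hausdorff_outer_similarity_le:
  fixes g :: "'a::metric_space \<Rightarrow> 'b::metric_space"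
  assumes t: "0 < t" and g: "\<And>x y. dist (g x) (g y) = t * dist x y"
  shows "hausdorff_outer s (g ` A) \<le> ennreal (t powr s) * hausdorff_outer s A"
  unfolding hausdorff_outer_def[of s "g ` A"]
proof (rule SUP_least)
  fix \<delta> :: real assume \<delta>: "\<delta> \<in> {0<..}"
  have "hausdorff_pre s \<delta> (g ` A) \<le> ennreal (t powr s) * hausdorff_pre s (\<delta> / t) A"
    using hausdorff_pre_similarity_le[OF t g, of s "\<delta> / t" A] t by simp
  also have "\<dots> \<le> ennreal (t powr s) * hausdorff_outer s A"
    unfolding hausdorff_outer_def using \<delta> t by (intro mult_left_mono SUP_upper) auto
  finally show "hausdorff_pre s \<delta> (g ` A) \<le> ennreal (t powr s) * hausdorff_outer s A" .
qed

text \<open>The left inverse \<open>h\<close> is a similarity of ratio \<open>1 / t\<close>, so the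
  one-sided estimate applied to it gives the reverse inequality.\<close>

lemma hausdorff_outer_similarity:
  fixes g :: "'a::metric_space \<Rightarrow> 'b::metric_space" and h :: "'b \<Rightarrow> 'a"
  assumes t: "0 < t" and g: "\<And>x y. dist (g x) (g y) = t * dist x y"
    and h: "\<And>x y. dist (h x) (h y) = dist x y / t" and hg: "\<And>x. h (g x) = x"
  shows "hausdorff_outer s (g ` A) = ennreal (t powr s) * hausdorff_outer s A"
proof (rule antisym)
  have "hausdorff_outer s (h ` (g ` A)) \<le> ennreal ((1 / t) powr s) * hausdorff_outer s (g ` A)"
    using t by (intro hausdorff_outer_similarity_le) (auto simp: h)
  moreover have "h ` (g ` A) = A" by (auto simp: hg image_image)
  ultimately have "ennreal (t powr s) * hausdorff_outer s A
      \<le> ennreal (t powr s) * (ennreal ((1 / t) powr s) * hausdorff_outer s (g ` A))"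
    by (auto intro: mult_left_mono)
  also have "\<dots> = hausdorff_outer s (g ` A)"
    using t by (simp add: mult.assoc[symmetric] powr_mult[symmetric] flip: ennreal_mult)
  finally show "ennreal (t powr s) * hausdorff_outer s A \<le> hausdorff_outer s (g ` A)" .
qed (rule hausdorff_outer_similarity_le[OF t g])

lemma space_normalized_hausdorff [simp]: "space (normalized_hausdorff s K) = K"
  unfolding normalized_hausdorff_def
  by (subst space_measure_of) (auto simp: sets_restrict_space)

lemma sets_normalized_hausdorff [measurable_cong, simp]:
  "sets (normalized_hausdorff s K) = sets (restrict_space borel K)"
  unfolding normalized_hausdorff_def
  by (metis Int_UNIV_right sets.sets_measure_of_eq space_borel space_restrict_space Int_commute)

text \<open>\<open>measure_of\<close> yields the zero measure unless the given set function is a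
  measure. One nonzero value is therefore enough to recover the defining formula, with no separate
  proof of countable additivity.\<close>

lemma emeasure_normalized_hausdorff:
  assumes "emeasure (normalized_hausdorff s K) B \<noteq> 0" "A \<in> sets (restrict_space borel K)"
  shows "emeasure (normalized_hausdorff s K) A = hausdorff_outer s A / hausdorff_outer s K"
  using assms unfolding normalized_hausdorff_def
  by (auto simp: emeasure_measure_of_conv sets.sigma_sets_eq[of "restrict_space borel K", simplified space_restrict_space space_borel Int_UNIV_right] split: if_splits)

section \<open>Cells and their measure\<close>

lemma finite_words [simp]: "finite (words N n)"
proof -
  have "words N n = {w. set w \<subseteq> {1..N} \<and> length w = n}" by (auto simp: words_def)
  then show ?thesis by (simp add: finite_lists_length_eq)
qed

lemma words_0 [simp]: "words N 0 = {[]}"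
  by (auto simp: words_def)

lemma words_Suc: "words N (Suc n) = (\<lambda>(i, w). i # w) ` ({1..N} \<times> words N n)"
  by (auto simp: words_def length_Suc_conv image_iff)

lemma Cons_in_words [simp]: "i # w \<in> words N (Suc n) \<longleftrightarrow> i \<in> {1..N} \<and> w \<in> words N n"
  by (auto simp: words_def)

lemma sum_words_Suc:
  fixes f :: "nat list \<Rightarrow> 'a::comm_monoid_add"
  shows "(\<Sum>w\<in>words N (Suc n). f w) = (\<Sum>i\<in>{1..N}. \<Sum>w\<in>words N n. f (i # w))"
proof -
  have "inj_on (\<lambda>(i, w). i # w) ({1..N} \<times> words N n)" by (auto simp: inj_on_def)
  then show ?thesis
    by (simp add: words_Suc sum.reindex sum.cartesian_product case_prod_unfold)
qed

lemma sum_words_add: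
  fixes f :: "nat list \<Rightarrow> 'a::comm_monoid_add"
  shows "(\<Sum>w\<in>words N (m + n). f w) = (\<Sum>v\<in>words N m. \<Sum>w\<in>words N n. f (v @ w))"
  by (induction m arbitrary: f) (simp_all add: sum_words_Suc)

lemma card_words: "card (words N n) = N ^ n"
proof -
  have "(\<Sum>w\<in>words N n. 1::nat) = N ^ n"
    by (induction n) (simp_all only: words_0 sum_words_Suc, simp_all)
  then show ?thesis by simp
qed

lemma Psi_word_Nil [simp]: "Psi_word k c [] x = x"
  by (simp add: Psi_word_def)

lemma Psi_word_Cons [simp]: "Psi_word k c (i # w) x = Psi k c i (Psi_word k c w x)"
  by (simp add: Psi_word_def)

lemma Psi_word_append: "Psi_word k c (v @ w) x = Psi_word k c v (Psi_word k c w x)"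
  by (simp add: Psi_word_def)

lemma comp_Psi_word_Nil [simp]: "f \<circ> Psi_word k c [] = f"
  by auto

lemma comp_Psi_word_Cons: "f \<circ> Psi_word k c (i # w) = (f \<circ> Psi k c i) \<circ> Psi_word k c w"
  by auto

lemma comp_Psi_word_append: "f \<circ> Psi_word k c (v @ w) = (f \<circ> Psi_word k c v) \<circ> Psi_word k c w"
  by (auto simp: Psi_word_append)

context unconstrained_carpet
begin

abbreviation "M \<equiv> carpet_measure k N K"

lemma k_pos [simp]: "0 < k" and N_pos [simp]: "0 < N"
  using k_ge N_ge by auto

lemma k_nonzero [simp]: "k \<noteq> 0" and N_nonzero [simp]: "N \<noteq> 0"
  using k_pos N_pos by (auto simp del: k_pos N_pos)

text \<open>The contraction ratio raised to the dimension \<open>d_H\<close>; this is where a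
  level-one cell acquires mass \<open>1 / N\<close>.\<close>

lemma ln_N_over_ln_k: "(1 / real k) powr (ln (real N) / ln (real k)) = 1 / real N"
  using k_ge by (simp add: powr_def ln_div exp_minus inverse_eq_divide)

lemma dist_Psi: "dist (Psi k c i x) (Psi k c i y) = dist x y / real k"
proof -
  have "Psi k c i x - Psi k c i y = (1 / real k) *\<^sub>R (x - y)"
    by (simp add: Psi_def scaleR_diff_right divide_inverse)
  then show ?thesis by (simp add: dist_norm)
qed

lemma dist_Psi_word: "dist (Psi_word k c w x) (Psi_word k c w y) = dist x y / real k ^ length w"
  by (induction w) (auto simp: dist_Psi)

lemma Psi_inverse: "real k *\<^sub>R (Psi k c i x - c i) = x"
  by (simp add: Psi_def)

lemma Psi_inverse': "Psi k c i (real k *\<^sub>R (x - c i)) = x"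
  by (simp add: Psi_def)

lemma inj_Psi: "inj (Psi k c i)"
  by (metis Psi_inverse injI)

lemma dist_Psi_inverse: "dist (real k *\<^sub>R (x - c i)) (real k *\<^sub>R (y - c i)) = dist x y / (1 / real k)"
proof -
  have "real k *\<^sub>R (x - c i) - real k *\<^sub>R (y - c i) = real k *\<^sub>R (x - y)"
    by (simp add: scaleR_diff_right)
  then show ?thesis by (simp add: dist_norm)
qed

lemma continuous_Psi [continuous_intros]: "continuous_on S (Psi k c i)"
  unfolding Psi_def[abs_def] by (intro continuous_intros)

lemma continuous_Psi_word [continuous_intros]: "continuous_on S (Psi_word k c w)"
proof (induction w)
  case Nil
  have "Psi_word k c [] = (\<lambda>x. x)" by auto
  then show ?case by simp
next
  case (Cons i w)
  have "Psi_word k c (i # w) = Psi k c i \<circ> Psi_word k c w" by auto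
  then show ?case using Cons continuous_Psi continuous_on_compose by metis
qed

lemma Psi_K: "i \<in> {1..N} \<Longrightarrow> x \<in> K \<Longrightarrow> Psi k c i x \<in> K"
  using K_self_similar by blast

lemma Psi_word_K: "w \<in> words N n \<Longrightarrow> x \<in> K \<Longrightarrow> Psi_word k c w x \<in> K"
proof (induction w arbitrary: n)
  case (Cons i w)
  then show ?case by (cases n) (auto simp: words_def intro!: Psi_K)
qed simp

lemma K_eq_cells: "K = (\<Union>w\<in>words N n. Psi_word k c w ` K)"
proof (induction n)
  case (Suc n)
  have "(\<Union>w\<in>words N (Suc n). Psi_word k c w ` K) =
      (\<Union>i\<in>{1..N}. Psi k c i ` (\<Union>w\<in>words N n. Psi_word k c w ` K))"
    by (auto simp: words_Suc image_iff) (metis atLeastAtMost_iff One_nat_def)+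
  then show ?case using Suc K_self_similar by simp
qed simp

lemma K_borel [measurable]: "K \<in> sets borel"
  using K_compact by (simp add: borel_compact)

lemma space_M [simp]: "space M = K"
  by (simp add: carpet_measure_def)

lemma sets_M [measurable_cong]: "sets M = sets (restrict_space borel K)"
  by (simp add: carpet_measure_def)

lemma sets_M_iff: "A \<in> sets M \<longleftrightarrow> A \<subseteq> K \<and> A \<in> sets borel"
  by (auto simp: sets_M sets_restrict_space_iff)

lemma continuous_measurable_M: "continuous_on K f \<Longrightarrow> f \<in> borel_measurable M"
  for f :: "real \<times> real \<Rightarrow> 'b::topological_space"
  by (subst measurable_cong_sets[OF sets_M refl]) (rule borel_measurable_continuous_on_restrict)

lemma Psi_measurable [measurable]: "i \<in> {1..N} \<Longrightarrow> Psi k c i \<in> measurable M M"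
  by (subst measurable_cong_sets[OF refl sets_M], rule measurable_restrict_space2)
     (auto intro!: Psi_K continuous_measurable_M continuous_Psi)

lemma Psi_image_sets:
  assumes "i \<in> {1..N}" "A \<in> sets M"
  shows "Psi k c i ` A \<in> sets M"
proof -
  \<comment> \<open>The image is rewritten as a preimage under the continuous inverse, for which
    Borel measurability is immediate.\<close>
  have "Psi k c i ` A = (\<lambda>x. real k *\<^sub>R (x - c i)) -` A"
  proof (intro equalityI subsetI)
    fix x assume "x \<in> (\<lambda>x. real k *\<^sub>R (x - c i)) -` A"
    then show "x \<in> Psi k c i ` A" by (metis Psi_inverse' imageI vimageE)
  qed (auto simp: Psi_inverse simp del: scaleR_Pair)
  moreover have "(\<lambda>x. real k *\<^sub>R (x - c i)) -` A \<in> sets borel"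
    using assms by (intro measurable_sets_borel[where M = borel] borel_measurable_continuous_onI continuous_intros)
      (auto simp: sets_M_iff)
  moreover have "Psi k c i ` A \<subseteq> K"
    using assms Psi_K by (auto simp: sets_M_iff)
  ultimately show ?thesis
    by (simp add: sets_M_iff)
qed

end

locale nondegenerate_carpet = unconstrained_carpet +
  assumes nondegenerate: "emeasure (carpet_measure k N K) K \<noteq> 0"
begin

lemma emeasure_M: "A \<in> sets M \<Longrightarrow> emeasure M A =
    hausdorff_outer (ln (real N) / ln (real k)) A / hausdorff_outer (ln (real N) / ln (real k)) K"
  using nondegenerate unfolding carpet_measure_def sets_normalized_hausdorff
  by (rule emeasure_normalized_hausdorff)

lemma emeasure_K [simp]: "emeasure M K = 1"
proof -
  have "K \<in> sets M" by (simp add: sets_M_iff)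
  then have eq: "emeasure M K = hausdorff_outer (ln (real N) / ln (real k)) K / hausdorff_outer (ln (real N) / ln (real k)) K"
    by (rule emeasure_M)
  \<comment> \<open>Both \<open>0 / 0\<close> and \<open>top / top\<close> equal \<open>0\<close> in
    \<open>ennreal\<close>, so a nonzero quotient excludes both degenerate cases.\<close>
  then have "hausdorff_outer (ln (real N) / ln (real k)) K \<noteq> 0"
      "hausdorff_outer (ln (real N) / ln (real k)) K \<noteq> top"
    using nondegenerate by (auto simp: divide_ennreal_def)
  then show ?thesis unfolding eq by (simp add: ennreal_divide_self less_top zero_less_iff_neq_zero)
qed

sublocale finite_measure M
  by standard simp

lemma measure_K [simp]: "measure M K = 1"
  by (simp add: measure_def)

lemma emeasure_Psi:
  assumes i: "i \<in> {1..N}" and A: "A \<in> sets M"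
  shows "emeasure M A = real N * emeasure M (Psi k c i ` A)"
proof -
  have "hausdorff_outer (ln (real N) / ln (real k)) (Psi k c i ` A) =
      ennreal ((1 / real k) powr (ln (real N) / ln (real k))) * hausdorff_outer (ln (real N) / ln (real k)) A"
    by (rule hausdorff_outer_similarity[where h = "\<lambda>x. real k *\<^sub>R (x - c i)"])
       (simp_all add: dist_Psi Psi_inverse dist_Psi_inverse)
  then have *: "hausdorff_outer (ln (real N) / ln (real k)) (Psi k c i ` A) =
      ennreal (1 / real N) * hausdorff_outer (ln (real N) / ln (real k)) A"
    by (simp only: ln_N_over_ln_k)
  have "ennreal (real N) * ennreal (1 / real N) = 1"
    by (subst ennreal_mult[symmetric]) auto
  then show ?thesis
    unfolding emeasure_M[OF A] emeasure_M[OF Psi_image_sets[OF i A]] *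
    by (simp add: ennreal_times_divide mult.assoc[symmetric])
qed

lemma measure_Psi:
  assumes "i \<in> {1..N}" "A \<in> sets M"
  shows "measure M (Psi k c i ` A) = measure M A / real N"
  using emeasure_Psi[OF assms] by (simp add: emeasure_eq_measure flip: ennreal_mult)

text \<open>Scaling of the measure on cells, put as an identity of measures so that integrals,
  integrability and almost-everywhere statements all transfer to cells through \<open>distr\<close>
  and \<open>density\<close>.\<close>

lemma distr_Psi:
  assumes i: "i \<in> {1..N}"
  shows "distr M M (Psi k c i) = density M (\<lambda>x. ennreal (real N * indicator (Psi k c i ` K) x))"
proof (rule measure_eqI)
  fix A assume "A \<in> sets (distr M M (Psi k c i))"
  then have A: "A \<in> sets M" by simp
  have S: "Psi k c i ` K \<in> sets M" by (rule Psi_image_sets[OF i]) (simp add: sets_M_iff)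
  have pre: "Psi k c i -` A \<inter> space M \<in> sets M"
    using Psi_measurable[OF i] A by (rule measurable_sets)
  have "emeasure (distr M M (Psi k c i)) A = emeasure M (Psi k c i -` A \<inter> space M)"
    using Psi_measurable[OF i] A by (rule emeasure_distr)
  also have "\<dots> = real N * emeasure M (Psi k c i ` (Psi k c i -` A \<inter> space M))"
    by (rule emeasure_Psi[OF i pre])
  also have "Psi k c i ` (Psi k c i -` A \<inter> space M) = A \<inter> Psi k c i ` K"
    by auto
  also have "real N * emeasure M (A \<inter> Psi k c i ` K) =
      (\<integral>\<^sup>+x. ennreal (real N) * indicator (A \<inter> Psi k c i ` K) x \<partial>M)"
    using A S by (subst nn_integral_cmult_indicator) auto
  also have "\<dots> = (\<integral>\<^sup>+x. ennreal (real N * indicator (Psi k c i ` K) x) * indicator A x \<partial>M)"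
    by (intro nn_integral_cong) (auto split: split_indicator)
  also have "\<dots> = emeasure (density M (\<lambda>x. ennreal (real N * indicator (Psi k c i ` K) x))) A"
    using A S by (subst emeasure_density) auto
  finally show "emeasure (distr M M (Psi k c i)) A =
    emeasure (density M (\<lambda>x. ennreal (real N * indicator (Psi k c i ` K) x))) A" .
qed simp

lemma Psi_image_K_sets [simp]: "i \<in> {1..N} \<Longrightarrow> Psi k c i ` K \<in> sets M"
  by (rule Psi_image_sets) (simp_all add: sets_M_iff)

lemma Psi_density_measurable [simp]:
  assumes "i \<in> {1..N}"
  shows "(\<lambda>x. real N * indicator (Psi k c i ` K) x) \<in> borel_measurable M"
  using Psi_image_K_sets[OF assms] by measurable

lemma integral_Psi:
  fixes f :: "real \<times> real \<Rightarrow> real"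
  assumes i: "i \<in> {1..N}" and f: "f \<in> borel_measurable M"
  shows "(\<integral>x. f (Psi k c i x) \<partial>M) = real N * (\<integral>x. indicator (Psi k c i ` K) x * f x \<partial>M)"
proof -
  have "(\<integral>x. f (Psi k c i x) \<partial>M) = (\<integral>x. f x \<partial>(distr M M (Psi k c i)))"
    by (rule integral_distr[symmetric]) (use i f in auto)
  also have "\<dots> = (\<integral>x. (real N * indicator (Psi k c i ` K) x) *\<^sub>R f x \<partial>M)"
    unfolding distr_Psi[OF i]
    using i f by (intro integral_density) auto
  finally show ?thesis by (simp add: mult.assoc)
qed

lemma integrable_Psi:
  fixes f :: "real \<times> real \<Rightarrow> real"
  assumes i: "i \<in> {1..N}" and f: "integrable M f"
  shows "integrable M (\<lambda>x. f (Psi k c i x))"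
proof -
  have fm[measurable]: "f \<in> borel_measurable M" using f by auto
  have "integrable (distr M M (Psi k c i)) f"
    unfolding distr_Psi[OF i]
  proof (subst integrable_density)
    have "integrable M (\<lambda>x. indicator (Psi k c i ` K) x *\<^sub>R f x)"
      using i f by (intro integrable_mult_indicator) auto
    then have "integrable M (\<lambda>x. real N *\<^sub>R (indicator (Psi k c i ` K) x *\<^sub>R f x))"
      by (rule integrable_scaleR_right)
    then show "integrable M (\<lambda>x. (real N * indicator (Psi k c i ` K) x) *\<^sub>R f x)"
      by (simp add: mult.assoc)
  qed (use i in auto)
  then show ?thesis
    using i fm by (subst (asm) integrable_distr_eq) auto
qed

lemma AE_Psi:
  assumes i: "i \<in> {1..N}" and P: "AE x in M. P x"
  shows "AE x in M. P (Psi k c i x)"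
proof -
  have "AE x in distr M M (Psi k c i). P x"
    unfolding distr_Psi[OF i] using P i by (subst AE_density) auto
  then show ?thesis
    using i AE_distrD[of "Psi k c i" M M P] by auto
qed

lemma L2_Psi:
  assumes i: "i \<in> {1..N}" and f: "f \<in> L2 M"
  shows "f \<circ> Psi k c i \<in> L2 M"
  using f i integrable_Psi[OF i, of "\<lambda>x. (f x)\<^sup>2"]
  by (auto simp: L2_def comp_def intro: measurable_compose)

lemma AE_Psi_word:
  assumes w: "w \<in> words N n" and P: "AE x in M. P x"
  shows "AE x in M. P (Psi_word k c w x)"
  using w P
proof (induction w arbitrary: n P)
  case (Cons i w)
  then have "i \<in> {1..N}" "w \<in> words N (length w)" by (auto simp: words_def)
  then show ?case using Cons.IH[of "length w" "\<lambda>x. P (Psi k c i x)"] Cons.prems AE_Psi[of i P] by simp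
qed simp

lemma L2_integrable: "f \<in> L2 M \<Longrightarrow> integrable M f"
  by (rule square_integrable_imp_integrable) (auto simp: L2_def)

lemma Psi_word_image_sets: "w \<in> words N n \<Longrightarrow> Psi_word k c w ` K \<in> sets M"
proof (induction w arbitrary: n)
  case (Cons i w)
  then have "i \<in> {1..N}" "w \<in> words N (length w)" by (auto simp: words_def)
  then have "Psi k c i ` (Psi_word k c w ` K) \<in> sets M"
    using Cons.IH by (intro Psi_image_sets) auto
  then show ?case by (simp add: image_image)
qed (simp add: sets_M_iff)

lemma integral_Psi_word:
  fixes f :: "real \<times> real \<Rightarrow> real"
  assumes w: "w \<in> words N n" and f: "f \<in> borel_measurable M"
  shows "(\<integral>x. f (Psi_word k c w x) \<partial>M) = real N ^ n * (\<integral>x. indicator (Psi_word k c w ` K) x * f x \<partial>M)"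
  using w f
proof (induction w arbitrary: n f)
  case Nil
  then have "n = 0" by (auto simp: words_def)
  moreover have "(\<integral>x. f x \<partial>M) = (\<integral>x. indicator K x * f x \<partial>M)"
    by (rule Bochner_Integration.integral_cong) auto
  ultimately show ?case by (simp add: image_def)
next
  case (Cons i w)
  then obtain m where n: "n = Suc m" and i: "i \<in> {1..N}" and w: "w \<in> words N m"
    by (cases n) (auto simp: words_def)
  have fi: "(\<lambda>x. f (Psi k c i x)) \<in> borel_measurable M"
    using Psi_measurable[OF i] Cons.prems(2) by (rule measurable_compose)
  have fw: "(\<lambda>x. indicator (Psi_word k c (i # w) ` K) x * f x) \<in> borel_measurable M"
    using Psi_word_image_sets[OF Cons.prems(1)] Cons.prems(2) by auto
  have "(\<integral>x. f (Psi_word k c (i # w) x) \<partial>M) = real N ^ m * (\<integral>x. indicator (Psi_word k c w ` K) x * f (Psi k c i x) \<partial>M)"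
    using Cons.IH[OF w fi] by simp
  also have "(\<integral>x. indicator (Psi_word k c w ` K) x * f (Psi k c i x) \<partial>M) =
      (\<integral>x. indicator (Psi_word k c (i # w) ` K) (Psi k c i x) * f (Psi k c i x) \<partial>M)"
    by (intro Bochner_Integration.integral_cong)
       (auto simp: indicator_def dest: injD[OF inj_Psi])
  also have "\<dots> = real N * (\<integral>x. indicator (Psi k c i ` K) x * (indicator (Psi_word k c (i # w) ` K) x * f x) \<partial>M)"
    by (rule integral_Psi[OF i fw])
  also have "(\<integral>x. indicator (Psi k c i ` K) x * (indicator (Psi_word k c (i # w) ` K) x * f x) \<partial>M) =
      (\<integral>x. indicator (Psi_word k c (i # w) ` K) x * f x \<partial>M)"
    using Psi_word_K[OF w] by (intro Bochner_Integration.integral_cong) (auto simp: indicator_def)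
  finally show ?case by (simp add: n)
qed

text \<open>Cell averages become plain integrals of pullbacks, so composing \<open>f\<close> with a
  cell map acts on them by prefixing a letter to the word.\<close>

lemma cell_mean_eq:
  assumes "w \<in> words N n" "f \<in> borel_measurable M"
  shows "cell_mean k N c K n f w = (\<integral>x. f (Psi_word k c w x) \<partial>M)"
  using integral_Psi_word[OF assms] by (simp add: cell_mean_def set_lebesgue_integral_def)

end

section \<open>Geometry of the cells\<close>

lemma mem_cbox_pair: "x \<in> cbox a (b :: real \<times> real) \<longleftrightarrow>
    fst a \<le> fst x \<and> fst x \<le> fst b \<and> snd a \<le> snd x \<and> snd x \<le> snd b"
  by (cases a, cases b, cases x) (auto simp: cbox_Pair_eq)

lemma mem_box_pair: "x \<in> box a (b :: real \<times> real) \<longleftrightarrow>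
    fst a < fst x \<and> fst x < fst b \<and> snd a < snd x \<and> snd x < snd b"
  by (cases a, cases b, cases x) (auto simp: box_prod box_real)

lemma emeasure_lborel_box_pair:
  assumes "fst a \<le> fst b" "snd a \<le> snd b"
  shows "emeasure lborel (box a (b :: real \<times> real)) = ennreal ((fst b - fst a) * (snd b - snd a))"
  using assms by (subst emeasure_lborel_box) (auto simp: Basis_prod_def prod.union_disjoint inner_prod_def)

section \<open>Rigidity of tilings by translates of one square\<close>

text \<open>The asymmetric half of the uniqueness argument, with \<open>p\<close> a minimal
  unmatched corner of \<open>A\<close>; it is applied a second time with \<open>A\<close> and
  \<open>B\<close> exchanged.\<close>

lemma square_tiling_subset:
  fixes A B :: "(real \<times> real) set"
  assumes h: "0 < h" and fin: "finite A" "finite B"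
    and union: "(\<Union>a\<in>A. cbox a (a + (h, h))) = (\<Union>b\<in>B. cbox b (b + (h, h)))"
    and disj: "\<And>a a'. a \<in> A \<Longrightarrow> a' \<in> A \<Longrightarrow> a \<noteq> a' \<Longrightarrow> box a (a + (h, h)) \<inter> box a' (a' + (h, h)) = {}"
    and p: "p \<in> A" "p \<notin> B" and min: "\<And>b. b \<in> B \<Longrightarrow> b \<notin> A \<Longrightarrow> fst p + snd p \<le> fst b + snd b"
  shows False
proof -
  \<comment> \<open>The number \<open>e\<close> will be less than \<open>h\<close> and than every
    positive coordinate offset from \<open>p\<close> to a corner in \<open>B\<close>. A square of
    \<open>B\<close> containing \<open>p + (e, e)\<close> then starts weakly below and to the left
    of \<open>p\<close>.\<close>
  define S where "S = insert h {t \<in> (\<lambda>b. fst b - fst p) ` B \<union> (\<lambda>b. snd b - snd p) ` B. 0 < t}"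
  have S: "finite S" "S \<noteq> {}" "\<And>t. t \<in> S \<Longrightarrow> 0 < t" using fin h by (auto simp: S_def)
  define e where "e = Min S / 2"
  have e0: "0 < e" unfolding e_def using S by auto
  have e1: "e < t" if "t \<in> S" for t
    using Min_le[OF S(1) that] S(3)[OF that] e0 unfolding e_def by linarith
  have "e < h" using e1 by (simp add: S_def)
  then have "p + (e, e) \<in> cbox p (p + (h, h))" using e0 by (auto simp: mem_cbox_pair)
  then obtain b where b: "b \<in> B" "p + (e, e) \<in> cbox b (b + (h, h))" using p union by blast
  have b1: "fst b \<le> fst p"
  proof (rule ccontr)
    assume "\<not> ?thesis"
    then have "fst b - fst p \<in> S" using b by (auto simp: S_def)
    then show False using e1 b by (force simp: mem_cbox_pair)
  qed
  have b2: "snd b \<le> snd p"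
  proof (rule ccontr)
    assume "\<not> ?thesis"
    then have "snd b - snd p \<in> S" using b by (auto simp: S_def)
    then show False using e1 b by (force simp: mem_cbox_pair)
  qed
  have "b \<notin> A"
  proof
    assume "b \<in> A"
    moreover have "p + (e / 2, e / 2) \<in> box p (p + (h, h)) \<inter> box b (b + (h, h))"
      using b1 b2 b(2) e0 \<open>e < h\<close> by (auto simp: mem_box_pair mem_cbox_pair)
    ultimately show False using disj[of p b] p b(1) by blast
  qed
  \<comment> \<open>Minimality bounds the coordinate sum of \<open>b\<close> from below by that of
    \<open>p\<close>, while both coordinates of \<open>b\<close> are at most those of
    \<open>p\<close>.\<close>
  then have "b = p" using min[of b] b(1) b1 b2 by (simp add: prod_eq_iff)
  then show False using b(1) p by simp
qed

text \<open>A translate \<open>p\<close> minimising \<open>x + y\<close> among those used by only one of the two tilings gives a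
  contradiction: the square of the other tiling covering the points just above the corner \<open>p\<close>
  would have to start at \<open>p\<close> as well.\<close>

lemma square_tiling_unique:
  fixes A B :: "(real \<times> real) set"
  assumes h: "0 < h" and fin: "finite A" "finite B"
    and union: "(\<Union>a\<in>A. cbox a (a + (h, h))) = (\<Union>b\<in>B. cbox b (b + (h, h)))"
    and A: "\<And>a a'. a \<in> A \<Longrightarrow> a' \<in> A \<Longrightarrow> a \<noteq> a' \<Longrightarrow> box a (a + (h, h)) \<inter> box a' (a' + (h, h)) = {}"
    and B: "\<And>a a'. a \<in> B \<Longrightarrow> a' \<in> B \<Longrightarrow> a \<noteq> a' \<Longrightarrow> box a (a + (h, h)) \<inter> box a' (a' + (h, h)) = {}"
  shows "A = B"
proof (rule ccontr)
  assume "A \<noteq> B"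
  then have ne: "(A - B) \<union> (B - A) \<noteq> {}" by blast
  define p where "p = arg_min_on (\<lambda>x. fst x + snd x) ((A - B) \<union> (B - A))"
  have p: "p \<in> (A - B) \<union> (B - A)" "\<And>b. b \<in> (A - B) \<union> (B - A) \<Longrightarrow> fst p + snd p \<le> fst b + snd b"
    unfolding p_def
    using arg_min_if_finite(1)[OF _ ne, of "\<lambda>x. fst x + snd x"] arg_min_least[OF _ ne, of _ "\<lambda>x. fst x + snd x"] fin
    by (simp_all only: finite_Un finite_Diff)
  from p(1) show False
  proof
    assume "p \<in> A - B"
    then show False using square_tiling_subset[OF h fin union A, of p] p(2) by blast
  next
    assume "p \<in> B - A"
    then show False using square_tiling_subset[OF h fin(2,1) union[symmetric] B, of p] p(2) by blast
  qed
qed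

lemma interior_unit_square: "interior unit_square = box (0, 0) (1, 1)"
  by (simp add: unit_square_def)

lemma affine_unit_square:
  assumes "0 < h"
  shows "(\<lambda>x. h *\<^sub>R x + d) ` unit_square = cbox d (d + (h, h))"
    and "(\<lambda>x. h *\<^sub>R x + d) ` box (0, 0) (1, 1) = box d (d + (h, h))"
proof -
  have *: "x = h *\<^sub>R ((1 / h) *\<^sub>R (x - d)) + d" for x :: "real \<times> real"
    using assms by simp
  show "(\<lambda>x. h *\<^sub>R x + d) ` unit_square = cbox d (d + (h, h))"
  proof (intro equalityI subsetI)
    fix x assume "x \<in> cbox d (d + (h, h))"
    then have "(1 / h) *\<^sub>R (x - d) \<in> unit_square"
      using assms by (auto simp: unit_square_def mem_cbox_pair field_simps)
    then show "x \<in> (\<lambda>x. h *\<^sub>R x + d) ` unit_square" using * by (intro image_eqI)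
  qed (use assms in \<open>auto simp: unit_square_def mem_cbox_pair mult_left_le\<close>)
  show "(\<lambda>x. h *\<^sub>R x + d) ` box (0, 0) (1, 1) = box d (d + (h, h))"
  proof (intro equalityI subsetI)
    fix x assume "x \<in> box d (d + (h, h))"
    then have "(1 / h) *\<^sub>R (x - d) \<in> box (0, 0) (1, 1)"
      using assms by (auto simp: mem_box_pair field_simps)
    then show "x \<in> (\<lambda>x. h *\<^sub>R x + d) ` box (0, 0) (1, 1)" using * by (intro image_eqI)
  qed (use assms in \<open>auto simp: mem_box_pair\<close>)
qed

text \<open>An isometry fixing the origin is orthogonal, hence linear; subtracting
  \<open>\<Gamma> 0\<close> reduces to that case. The affine form is what lets \<Gamma> be moved
  past the cell maps.\<close>

lemma square_isometry_affine:
  assumes "\<Gamma> \<in> square_isometries"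
  shows "\<exists>L. linear L \<and> inj L \<and> (\<forall>x. \<Gamma> x = \<Gamma> 0 + L x)"
proof -
  have d: "\<And>x y. dist (\<Gamma> x) (\<Gamma> y) = dist x y" using assms by (auto simp: square_isometries_def)
  define L where "L x = \<Gamma> x - \<Gamma> 0" for x
  have "orthogonal_transformation L"
    unfolding orthogonal_transformation_isometry L_def using d by (simp add: dist_norm)
  then have "linear L" "inj L"
    by (auto intro: orthogonal_transformation_linear orthogonal_transformation_inj)
  then show ?thesis by (intro exI[of _ L]) (simp add: L_def)
qed

lemma square_isometry_interior:
  assumes "\<Gamma> \<in> square_isometries"
  shows "\<Gamma> ` box (0, 0) (1, 1) = box (0, 0) (1, 1)"
proof -
  from square_isometry_affine[OF assms] obtain L
    where "linear L \<and> inj L \<and> (\<forall>x. \<Gamma> x = \<Gamma> 0 + L x)" ..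
  then have L: "linear L" "inj L" "\<Gamma> x = \<Gamma> 0 + L x" for x by blast+
  have eq: "\<Gamma> ` S = (+) (\<Gamma> 0) ` (L ` S)" for S unfolding image_image by (intro image_cong refl) (rule L(3))
  have "interior (\<Gamma> ` unit_square) = \<Gamma> ` interior unit_square"
    unfolding eq interior_translation interior_injective_linear_image[OF L(1,2)] ..
  then show ?thesis using assms by (simp add: square_isometries_def interior_unit_square)
qed

section \<open>Disjoint open cells, bounded degree, and the action of the symmetries on
  cells\<close>

context unconstrained_carpet
begin

lemma Psi_unit_square: "Psi k c i ` unit_square = cbox (c i) (c i + (1 / k, 1 / k))"
  using affine_unit_square(1)[of "1 / k" "c i"] by (simp add: Psi_def[abs_def] inverse_eq_divide)

lemma Psi_open_square: "Psi k c i ` box (0, 0) (1, 1) = box (c i) (c i + (1 / k, 1 / k))"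
  using affine_unit_square(2)[of "1 / k" "c i"] by (simp add: Psi_def[abs_def] inverse_eq_divide)

text \<open>A segment, a point and the empty set have empty interior in the plane, whereas the
  intersection of the open squares is open.\<close>

lemma Psi_open_squares_disjoint:
  assumes "i \<in> {1..N}" "j \<in> {1..N}" "i \<noteq> j"
  shows "Psi k c i ` box (0, 0) (1, 1) \<inter> Psi k c j ` box (0, 0) (1, 1) = {}"
proof -
  let ?U = "Psi k c i ` box (0, 0) (1, 1) \<inter> Psi k c j ` box (0, 0) (1, 1)"
  let ?V = "Psi k c i ` unit_square \<inter> Psi k c j ` unit_square"
  have "interior ?V = {}"
    using non_overlapping[OF assms]
  proof (elim disjE exE)
    fix x y assume "?V = closed_segment x y"
    then show ?thesis by (simp only:) (simp add: interior_closed_segment_ge2)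
  next
    fix x assume "?V = {x}"
    then show ?thesis by (simp only: interior_singleton)
  next
    assume "?V = {}"
    then show ?thesis by (simp only: interior_empty)
  qed
  moreover have "?U \<subseteq> ?V"
    unfolding unit_square_def using box_subset_cbox by blast
  moreover have "open ?U" unfolding Psi_open_square by (intro open_Int open_box)
  ultimately show ?thesis using interior_maximal by blast
qed

lemma Psi_maps_open_square:
  assumes "i \<in> {1..N}"
  shows "Psi k c i ` box (0, 0) (1, 1) \<subseteq> box (0, 0) (1, 1)"
proof -
  have "Psi k c i ` box (0, 0) (1, 1) \<subseteq> Psi k c i ` unit_square"
    unfolding unit_square_def using box_subset_cbox by blast
  also have "\<dots> \<subseteq> unit_square" using assms boundary_included(2) by blast
  finally have "Psi k c i ` box (0, 0) (1, 1) \<subseteq> interior unit_square"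
    by (rule interior_maximal) (simp add: Psi_open_square open_box)
  then show ?thesis by (simp add: interior_unit_square)
qed

lemma Psi_word_open_square:
  "w \<in> words N n \<Longrightarrow> Psi_word k c w ` box (0, 0) (1, 1) \<subseteq> box (0, 0) (1, 1)"
proof (induction w arbitrary: n)
  case (Cons i w)
  then have "i \<in> {1..N}" "w \<in> words N (length w)" by (auto simp: words_def)
  then have "Psi k c i ` (Psi_word k c w ` box (0, 0) (1, 1)) \<subseteq> box (0, 0) (1, 1)"
    using Cons.IH Psi_maps_open_square by (meson image_mono order_trans)
  then show ?case by (simp add: image_image)
qed simp

text \<open>Words with the same first letter are handled by injectivity of \<open>Psi\<close> and
  induction; otherwise the two open cells lie in disjoint open cells of level one.\<close>

lemma Psi_word_open_squares_disjoint:
  assumes "v \<in> words N n" "w \<in> words N n" "v \<noteq> w"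
  shows "Psi_word k c v ` box (0, 0) (1, 1) \<inter> Psi_word k c w ` box (0, 0) (1, 1) = {}"
  using assms
proof (induction n arbitrary: v w)
  case (Suc n)
  from Suc.prems(1) obtain i v' where v: "v = i # v'" and i: "i \<in> {1..N}" "v' \<in> words N n"
    by (auto simp: words_Suc)
  from Suc.prems(2) obtain j w' where w: "w = j # w'" and j: "j \<in> {1..N}" "w' \<in> words N n"
    by (auto simp: words_Suc)
  note vw = v w
  have eq: "Psi_word k c v ` S = Psi k c i ` (Psi_word k c v' ` S)"
      "Psi_word k c w ` S = Psi k c j ` (Psi_word k c w' ` S)" for S
    by (simp_all add: vw image_image)
  show ?case
  proof (cases "i = j")
    case True
    then have "Psi_word k c v' ` box (0, 0) (1, 1) \<inter> Psi_word k c w' ` box (0, 0) (1, 1) = {}"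
      using Suc vw i j by auto
    then show ?thesis
      unfolding eq True using image_Int[OF inj_Psi, of j] by (metis image_empty)
  next
    case False
    then show ?thesis
      unfolding eq using Psi_open_squares_disjoint[OF i(1) j(1)] Psi_word_open_square[OF i(2)]
        Psi_word_open_square[OF j(2)] by (meson disjoint_iff image_mono subsetD)
  qed
qed simp

lemma Psi_word_affine: "Psi_word k c w x = (1 / k ^ length w) *\<^sub>R x + Psi_word k c w 0"
  by (induction w) (simp_all add: Psi_def scaleR_add_right divide_inverse mult.commute)

lemma neighbours_subset: "neighbours k N c K n \<subseteq> words N n \<times> words N n"
  by (auto simp: neighbours_def)

lemma finite_neighbours [simp]: "finite (neighbours k N c K n)"
  by (rule finite_subset[OF neighbours_subset]) simp

lemma neighbours_sym: "(v, w) \<in> neighbours k N c K n \<Longrightarrow> (w, v) \<in> neighbours k N c K n"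
  by (auto simp: neighbours_def)

text \<open>At a common point \<open>Psi_word k c v x = Psi_word k c w y\<close> the corners differ
  by \<open>(y - x) / k ^ n\<close> with \<open>x\<close> and \<open>y\<close> in the unit square.
  The bound feeds both the degree estimate and the energy of the coordinate function.\<close>

lemma neighbours_offset:
  assumes "(v, w) \<in> neighbours k N c K n"
  shows "\<bar>fst (Psi_word k c v 0) - fst (Psi_word k c w 0)\<bar> \<le> 1 / k ^ n"
    and "\<bar>snd (Psi_word k c v 0) - snd (Psi_word k c w 0)\<bar> \<le> 1 / k ^ n"
proof -
  from assms obtain x y where xy: "x \<in> K" "y \<in> K" "Psi_word k c v x = Psi_word k c w y"
    and l: "length v = n" "length w = n"
    unfolding neighbours_def words_def by blast
  have eq: "Psi_word k c v 0 - Psi_word k c w 0 = (1 / k ^ n) *\<^sub>R (y - x)"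
    using xy(3) Psi_word_affine[of v x] Psi_word_affine[of w y] l by (simp add: algebra_simps)
  have fs: "fst (Psi_word k c v 0) - fst (Psi_word k c w 0) = (1 / k ^ n) * (fst y - fst x)"
      "snd (Psi_word k c v 0) - snd (Psi_word k c w 0) = (1 / k ^ n) * (snd y - snd x)"
    using arg_cong[OF eq, of fst] arg_cong[OF eq, of snd] by auto
  have "\<bar>fst y - fst x\<bar> \<le> 1" "\<bar>snd y - snd x\<bar> \<le> 1"
    using subsetD[OF K_subset xy(1)] subsetD[OF K_subset xy(2)]
    unfolding unit_square_def mem_cbox_pair by auto
  then show "\<bar>fst (Psi_word k c v 0) - fst (Psi_word k c w 0)\<bar> \<le> 1 / k ^ n"
      "\<bar>snd (Psi_word k c v 0) - snd (Psi_word k c w 0)\<bar> \<le> 1 / k ^ n"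
    unfolding fs abs_mult by (simp_all add: divide_simps)
qed

text \<open>The cells meeting a given cell of side \<open>h\<close> have disjoint interiors and lie in a square of side \<open>3 h\<close>.\<close>

lemma card_neighbours_le: "card {w. (v, w) \<in> neighbours k N c K n} \<le> 9"
proof -
  let ?S = "{w. (v, w) \<in> neighbours k N c K n}"
  let ?a = "\<lambda>w. Psi_word k c w 0"
  define h where "h = 1 / real k ^ n"
  have h: "0 < h" by (simp add: h_def)
  have S: "?S \<subseteq> words N n" using neighbours_subset by auto
  have fin: "finite ?S" by (rule finite_subset[OF S]) simp
  have img: "Psi_word k c w ` box (0, 0) (1, 1) = box (?a w) (?a w + (h, h))" if "w \<in> words N n" for w
  proof -
    have "length w = n" using that by (simp add: words_def)
    then have "Psi_word k c w x = h *\<^sub>R x + ?a w" for x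
      by (simp only: h_def Psi_word_affine[of w x] of_nat_power)
    then have "Psi_word k c w ` box (0, 0) (1, 1) = (\<lambda>x. h *\<^sub>R x + ?a w) ` box (0, 0) (1, 1)"
      by (intro image_cong refl)
    also have "\<dots> = box (?a w) (?a w + (h, h))" by (rule affine_unit_square(2)[OF h])
    finally show ?thesis .
  qed
  have disj: "disjoint_family_on (\<lambda>w. box (?a w) (?a w + (h, h))) ?S"
    unfolding disjoint_family_on_def
    using S Psi_word_open_squares_disjoint img by (metis (no_types, lifting) subsetD)
  have "ennreal (real (card ?S) * h\<^sup>2) = (\<Sum>w\<in>?S. emeasure lborel (box (?a w) (?a w + (h, h))))"
    using h by (simp add: emeasure_lborel_box_pair power2_eq_square ennreal_mult ennreal_of_nat_eq_real_of_nat)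
  also have "\<dots> = emeasure lborel (\<Union>w\<in>?S. box (?a w) (?a w + (h, h)))"
    using disj fin by (intro sum_emeasure) auto
  also have "\<dots> \<le> emeasure lborel (box (?a v - (h, h)) (?a v + (2 * h, 2 * h)))"
  proof (intro emeasure_mono UN_least subsetI)
    fix w x assume w: "w \<in> ?S" and x: "x \<in> box (?a w) (?a w + (h, h))"
    from w have "(v, w) \<in> neighbours k N c K n" by simp
    from neighbours_offset[OF this] x show "x \<in> box (?a v - (h, h)) (?a v + (2 * h, 2 * h))"
      by (auto simp: mem_box_pair h_def)
  qed simp
  also have "\<dots> = ennreal (9 * h\<^sup>2)"
    using h by (subst emeasure_lborel_box_pair) (auto simp: power2_eq_square)
  finally have "real (card ?S) * h\<^sup>2 \<le> 9 * h\<^sup>2"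
    using h by (subst (asm) ennreal_le_iff) auto
  then show ?thesis using h by simp
qed

text \<open>Double counting: a word is the first entry of at most 9 ordered pairs and, by symmetry
  of the relation, the second entry of at most 9.\<close>

lemma sum_neighbours_le:
  fixes a :: "nat list \<Rightarrow> real"
  assumes "\<And>w. w \<in> words N n \<Longrightarrow> 0 \<le> a w"
  shows "(\<Sum>(v, w)\<in>neighbours k N c K n. a v + a w) \<le> 18 * (\<Sum>w\<in>words N n. a w)"
proof -
  let ?E = "neighbours k N c K n"
  have E: "?E = Sigma (words N n) (\<lambda>v. {w. (v, w) \<in> ?E})" by (auto simp: neighbours_def)
  have fin: "finite {w. (v, w) \<in> ?E}" for v
    by (rule finite_subset[of _ "words N n"]) (auto simp: neighbours_def)
  have "(\<Sum>(v, w)\<in>?E. a v) = (\<Sum>v\<in>words N n. \<Sum>w\<in>{w. (v, w) \<in> ?E}. a v)"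
    by (subst E, rule sum.Sigma[symmetric]) (auto simp: fin)
  also have "\<dots> \<le> (\<Sum>v\<in>words N n. 9 * a v)"
    using card_neighbours_le assms by (intro sum_mono) (simp add: mult_right_mono)
  finally have 1: "(\<Sum>(v, w)\<in>?E. a v) \<le> 9 * (\<Sum>v\<in>words N n. a v)" by (simp add: sum_distrib_left)
  have "(\<Sum>(v, w)\<in>?E. a w) = (\<Sum>(v, w)\<in>?E. a v)"
    by (rule sum.reindex_bij_witness[of _ prod.swap prod.swap]) (auto intro: neighbours_sym)
  then show ?thesis using 1 by (simp add: case_prod_unfold sum.distrib)
qed

text \<open>The symmetry assumption only concerns the union of the squares. Since \<Gamma> turns the
  given tiling into a second one of the same union by squares of side \<open>1 / k\<close>,
  uniqueness of such tilings upgrades invariance of the union to a permutation of the cells.\<close>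

lemma cells_permuted:
  assumes \<Gamma>: "\<Gamma> \<in> square_isometries"
  shows "\<exists>\<sigma>. bij_betw \<sigma> {1..N} {1..N} \<and> (\<forall>i\<in>{1..N}. \<Gamma> \<circ> Psi k c i = Psi k c (\<sigma> i) \<circ> \<Gamma>)"
proof -
  from square_isometry_affine[OF \<Gamma>] obtain L
    where "linear L \<and> inj L \<and> (\<forall>x. \<Gamma> x = \<Gamma> 0 + L x)" ..
  then have L: "linear L" "inj L" "\<Gamma> x = \<Gamma> 0 + L x" for x by blast+
  have inj: "inj \<Gamma>"
  proof (rule injI)
    fix x y assume "\<Gamma> x = \<Gamma> y"
    moreover have "dist (\<Gamma> x) (\<Gamma> y) = dist x y" using \<Gamma> unfolding square_isometries_def by blast
    ultimately show "x = y" by simp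
  qed
  \<comment> \<open>Chosen so that \<Gamma> after \<open>Psi k c i\<close> is the map
    \<open>x / k + e i\<close> after \<Gamma>; the \<open>e i\<close> are then the corners of the
    second tiling.\<close>
  define e where "e i = \<Gamma> (c i) - (1 / real k) *\<^sub>R \<Gamma> 0" for i
  have comm: "\<Gamma> (Psi k c i x) = (1 / real k) *\<^sub>R \<Gamma> x + e i" for i x
  proof -
    have "\<Gamma> (Psi k c i x) = \<Gamma> 0 + L (Psi k c i x)" by (rule L(3))
    also have "L (Psi k c i x) = (1 / real k) *\<^sub>R L x + L (c i)"
      using L(1) by (simp add: Psi_def linear_add linear_scale inverse_eq_divide)
    also have "\<Gamma> 0 + \<dots> = (1 / real k) *\<^sub>R (\<Gamma> 0 + L x) + ((\<Gamma> 0 + L (c i)) - (1 / real k) *\<^sub>R \<Gamma> 0)"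
      by (simp add: scaleR_add_right)
    also have "\<dots> = (1 / real k) *\<^sub>R \<Gamma> x + e i"
      unfolding e_def L(3)[of x, symmetric] L(3)[of "c i", symmetric] ..
    finally show ?thesis .
  qed
  have sq: "\<Gamma> ` Psi k c i ` S = (\<lambda>x. (1 / real k) *\<^sub>R x + e i) ` \<Gamma> ` S" for i S
    by (simp add: image_image comm)
  have esq: "\<Gamma> ` Psi k c i ` unit_square = cbox (e i) (e i + (1 / k, 1 / k))" for i
    unfolding sq using \<Gamma> affine_unit_square(1)[of "1 / k" "e i"] by (simp add: square_isometries_def)
  have eop: "\<Gamma> ` Psi k c i ` box (0, 0) (1, 1) = box (e i) (e i + (1 / k, 1 / k))" for i
    unfolding sq square_isometry_interior[OF \<Gamma>] using affine_unit_square(2)[of "1 / k" "e i"] by simp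
  have disjc: "box (c i) (c i + (1 / k, 1 / k)) \<inter> box (c j) (c j + (1 / k, 1 / k)) = {}"
    if "i \<in> {1..N}" "j \<in> {1..N}" "i \<noteq> j" for i j
    using Psi_open_squares_disjoint[OF that] by (simp add: Psi_open_square)
  have disje: "box (e i) (e i + (1 / k, 1 / k)) \<inter> box (e j) (e j + (1 / k, 1 / k)) = {}"
    if "i \<in> {1..N}" "j \<in> {1..N}" "i \<noteq> j" for i j
    using Psi_open_squares_disjoint[OF that] unfolding eop[symmetric]
    by (simp add: image_Int[OF inj, symmetric])
  have "e ` {1..N} = c ` {1..N}"
  proof (rule square_tiling_unique[of "1 / real k"])
    have "(\<Union>i\<in>{1..N}. cbox (e i) (e i + (1 / k, 1 / k))) = \<Gamma> ` (\<Union>i\<in>{1..N}. Psi k c i ` unit_square)"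
      unfolding esq[symmetric] by blast
    also have "\<dots> = (\<Union>i\<in>{1..N}. cbox (c i) (c i + (1 / k, 1 / k)))"
      unfolding symmetry[OF \<Gamma>] by (simp only: Psi_unit_square)
    finally show "(\<Union>a\<in>e ` {1..N}. cbox a (a + (1 / k, 1 / k))) = (\<Union>b\<in>c ` {1..N}. cbox b (b + (1 / k, 1 / k)))"
      by simp
    show "box a (a + (1 / k, 1 / k)) \<inter> box a' (a' + (1 / k, 1 / k)) = {}"
      if "a \<in> e ` {1..N}" "a' \<in> e ` {1..N}" "a \<noteq> a'" for a a'
      using that disje by blast
    show "box a (a + (1 / k, 1 / k)) \<inter> box a' (a' + (1 / k, 1 / k)) = {}"
      if "a \<in> c ` {1..N}" "a' \<in> c ` {1..N}" "a \<noteq> a'" for a a'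
      using that disjc by blast
  qed auto
  then have "\<forall>i\<in>{1..N}. \<exists>j. j \<in> {1..N} \<and> e i = c j" by blast
  from bchoice[OF this] obtain \<sigma> where "\<forall>i\<in>{1..N}. \<sigma> i \<in> {1..N} \<and> e i = c (\<sigma> i)" ..
  then have \<sigma>: "\<sigma> i \<in> {1..N}" "e i = c (\<sigma> i)" if "i \<in> {1..N}" for i using that by blast+
  \<comment> \<open>Two indices with the same image would have open squares that coincide and yet
    are disjoint, hence empty.\<close>
  have "inj_on \<sigma> {1..N}"
  proof (rule inj_onI, rule ccontr)
    fix i j assume ij: "i \<in> {1..N}" "j \<in> {1..N}" "\<sigma> i = \<sigma> j" "i \<noteq> j"
    then have "e i = e j" using \<sigma>(2) by metis
    then have "box (e i) (e i + (1 / k, 1 / k)) = {}" using disje[OF ij(1,2,4)] by simp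
    moreover have "e i + (1 / (2 * k), 1 / (2 * k)) \<in> box (e i) (e i + (1 / k, 1 / k))"
      by (simp add: mem_box_pair divide_simps)
    ultimately show False by blast
  qed
  then have "bij_betw \<sigma> {1..N} {1..N}"
    using \<sigma>(1) by (simp add: bij_betw_def endo_inj_surj image_subset_iff)
  moreover have "\<Gamma> \<circ> Psi k c i = Psi k c (\<sigma> i) \<circ> \<Gamma>" if "i \<in> {1..N}" for i
    using comm \<sigma>(2)[OF that] by (auto simp: Psi_def inverse_eq_divide)
  ultimately show ?thesis by blast
qed

end

section \<open>The Poincare inequality and the bound on the energy scaling\<close>

lemma power2_sum_le: "(x + y)\<^sup>2 \<le> 2 * x\<^sup>2 + 2 * y\<^sup>2" for x y :: real
  using zero_le_power2[of "x - y"] by (simp add: power2_eq_square algebra_simps)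

lemma graph_energy_nonneg: "0 \<le> graph_energy k N c K n f"
  unfolding graph_energy_def by (intro divide_nonneg_pos sum_nonneg) (auto simp: case_prod_unfold)

lemma graph_energy_scale: "graph_energy k N c K n (\<lambda>w. t * f w) = t\<^sup>2 * graph_energy k N c K n f"
  by (simp add: graph_energy_def sum_distrib_left case_prod_unfold power_mult_distrib flip: right_diff_distrib)

definition word_variance :: "nat \<Rightarrow> nat \<Rightarrow> (nat list \<Rightarrow> real) \<Rightarrow> real" where
  "word_variance N n f = (\<Sum>w\<in>words N n. (f w - word_mean N n f)\<^sup>2)"

lemma word_mean_add: "word_mean N n (\<lambda>w. f w + g w) = word_mean N n f + word_mean N n g"
  by (simp add: word_mean_def sum.distrib add_divide_distrib)

lemma word_mean_scale: "word_mean N n (\<lambda>w. t * f w) = t * word_mean N n f"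
  by (simp add: word_mean_def sum_distrib_left)

lemma word_variance_scale: "word_variance N n (\<lambda>w. t * f w) = t\<^sup>2 * word_variance N n f"
  by (simp add: word_variance_def word_mean_scale sum_distrib_left power_mult_distrib flip: right_diff_distrib)

lemma word_variance_add_le:
  "word_variance N n (\<lambda>w. f w + g w) \<le> 2 * word_variance N n f + 2 * word_variance N n g"
proof -
  have "word_variance N n (\<lambda>w. f w + g w) =
      (\<Sum>w\<in>words N n. ((f w - word_mean N n f) + (g w - word_mean N n g))\<^sup>2)"
    unfolding word_variance_def word_mean_add by (intro sum.cong) (auto simp: algebra_simps)
  also have "\<dots> \<le> (\<Sum>w\<in>words N n. 2 * (f w - word_mean N n f)\<^sup>2 + 2 * (g w - word_mean N n g)\<^sup>2)"
    by (intro sum_mono power2_sum_le)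
  finally show ?thesis by (simp add: word_variance_def sum.distrib sum_distrib_left)
qed

locale energy_scaling = unconstrained_carpet +
  fixes r :: real
  assumes scaling: "is_energy_scaling k N c K r"
begin

lemma r_pos [simp]: "0 < r"
  using scaling by (simp add: is_energy_scaling_def)

text \<open>Functions of zero energy need a separate argument since \<^const>\<open>poincare_const\<close> only
  concerns unit energy: adding multiples of such a function to a fixed function of unit energy
  shows that its variance vanishes.\<close>

lemma poincare:
  obtains b where "0 < b"
    "\<And>n f. 1 \<le> n \<Longrightarrow> word_variance N n f \<le> b * (real N / r) ^ n * graph_energy k N c K n f"
proof -
  obtain a b where a: "0 < a" and b: "0 < b" and ab: "\<And>n. 1 \<le> n \<Longrightarrow>
        ereal (a * inverse r ^ n) \<le> ereal (inverse (real N) ^ n) * poincare_const k N c K n \<and>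
        ereal (inverse (real N) ^ n) * poincare_const k N c K n \<le> ereal (b * inverse r ^ n)"
    using scaling unfolding is_energy_scaling_def by blast
  have "word_variance N n f \<le> b * (real N / r) ^ n * graph_energy k N c K n f" if n: "1 \<le> n" for n f
  proof -
    let ?V = "word_variance N n" and ?D = "graph_energy k N c K n"
    define B where "B = b * (real N / r) ^ n"
    have B: "0 < B" using b by (simp add: B_def)
    have unit: "?V g \<le> B" if g: "?D g = 1" for g
    proof -
      have "ereal (?V g) \<le> poincare_const k N c K n"
        unfolding poincare_const_def word_variance_def by (rule SUP_upper) (simp add: g)
      then have "ereal (inverse (real N) ^ n) * ereal (?V g) \<le> ereal (inverse (real N) ^ n) * poincare_const k N c K n"
        by (intro ereal_mult_left_mono) auto
      also have "\<dots> \<le> ereal (b * inverse r ^ n)" using ab[OF n] by blast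
      finally have "inverse (real N) ^ n * ?V g \<le> b * inverse r ^ n" by simp
      then show ?thesis
        by (simp add: B_def field_simps power_divide power_inverse)
    qed
    \<comment> \<open>Otherwise the supremum runs over the empty set and equals
      \<open>- \<infinity>\<close>, against the real lower bound in the scaling assumption.\<close>
    obtain g where g: "?D g = 1"
    proof (rule ccontr)
      assume "\<not> thesis"
      then have "{f. ?D f = 1} = {}" using that by blast
      then have "poincare_const k N c K n = - \<infinity>" by (simp add: poincare_const_def bot_ereal_def)
      moreover have "ereal p * - \<infinity> = - \<infinity>" if "0 < p" for p using that by simp
      ultimately have eq: "ereal (inverse (real N) ^ n) * poincare_const k N c K n = - \<infinity>"
        by (metis N_pos inverse_positive_iff_positive of_nat_0_less_iff zero_less_power)
      show False using conjunct1[OF ab[OF n]] unfolding eq by simp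
    qed
    show ?thesis
    proof (cases "?D f = 0")
      case False
      then have D: "0 < ?D f" using graph_energy_nonneg[of k N c K n f] by simp
      have "?D (\<lambda>w. (1 / sqrt (?D f)) * f w) = 1"
        unfolding graph_energy_scale using D by (simp add: power_divide)
      from unit[OF this] show ?thesis
        unfolding word_variance_scale using D by (simp add: B_def power_divide field_simps)
    next
      case True
      have zero: "f v = f w" if "(v, w) \<in> neighbours k N c K n" for v w
      proof -
        have "(\<Sum>(v, w)\<in>neighbours k N c K n. (f v - f w)\<^sup>2) = 0" using True by (simp add: graph_energy_def)
        then have "\<forall>p\<in>neighbours k N c K n. (case p of (v, w) \<Rightarrow> (f v - f w)\<^sup>2) = 0"
          by (subst (asm) sum_nonneg_eq_0_iff) auto
        then show ?thesis using that by fastforce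
      qed
      have Dt: "?D (\<lambda>w. g w + t * f w) = 1" for t
      proof -
        have "?D (\<lambda>w. g w + t * f w) = ?D g"
          unfolding graph_energy_def by (intro arg_cong[where f = "\<lambda>x. x / 2"] sum.cong) (auto dest: zero)
        then show ?thesis using g by simp
      qed
      have *: "t\<^sup>2 * ?V f \<le> 4 * B" for t
      proof -
        have "t\<^sup>2 * ?V f = ?V (\<lambda>w. (g w + t * f w) + (- 1) * g w)"
          by (simp flip: word_variance_scale)
        also have "\<dots> \<le> 2 * ?V (\<lambda>w. g w + t * f w) + 2 * ?V (\<lambda>w. (- 1) * g w)"
          by (rule word_variance_add_le)
        also have "\<dots> \<le> 4 * B"
          using unit[OF Dt[of t]] unit[OF g] unfolding word_variance_scale by simp
        finally show ?thesis .
      qed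
      have "?V f \<le> 0"
      proof (rule ccontr)
        assume "\<not> ?thesis"
        then have V: "0 < ?V f" by simp
        have "(sqrt ((4 * B + 1) / ?V f))\<^sup>2 = (4 * B + 1) / ?V f" using V B by simp
        then show False using *[of "sqrt ((4 * B + 1) / ?V f)"] V by simp
      qed
      then show ?thesis using True by simp
    qed
  qed
  then show ?thesis using that b by blast
qed

text \<open>The coordinate function \<open>x\<close> has variance of order \<open>N ^ n\<close> and energy of order
  \<open>N ^ n / k ^ (2 * n)\<close>, which forces \<open>r \<le> N / k\<^sup>2\<close> and hence the following.\<close>

lemma r_less_1 [simp]: "r < 1"
proof (rule ccontr)
  assume "\<not> r < 1"
  then have r: "1 \<le> r" by simp
  obtain b where b: "0 < b"
    "\<And>n f. 1 \<le> n \<Longrightarrow> word_variance N n f \<le> b * (real N / r) ^ n * graph_energy k N c K n f"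
    using poincare by blast
  \<comment> \<open>The discretised coordinate function: the abscissa of the lower left corner of
    the cell.\<close>
  define f where "f w = fst (Psi_word k c w 0)" for w
  have k3: "1 / real k \<le> 1 / 3" using k_ge by (simp add: divide_simps)
  have sub: "Psi k c i ` unit_square \<subseteq> unit_square" if "i \<in> {1..N}" for i
    using that boundary_included(2) by blast
  have c01: "0 \<le> fst (c i) \<and> fst (c i) + 1 / real k \<le> 1" if i: "i \<in> {1..N}" for i
  proof -
    have "c i \<in> Psi k c i ` unit_square" "c i + (1 / k, 1 / k) \<in> Psi k c i ` unit_square"
      unfolding Psi_unit_square by (auto simp: mem_cbox_pair)
    then have "c i \<in> unit_square" "c i + (1 / k, 1 / k) \<in> unit_square" using sub[OF i] by auto
    then show ?thesis by (auto simp: unit_square_def mem_cbox_pair)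
  qed
  have "(0, 0) \<in> (\<Union>i\<in>{1..N}. Psi k c i ` unit_square)" "(1, 0) \<in> (\<Union>i\<in>{1..N}. Psi k c i ` unit_square)"
    by (rule subsetD[OF boundary_included(1)], simp)+
  then obtain i j where i: "i \<in> {1..N}" "(0, 0) \<in> Psi k c i ` unit_square"
    and j: "j \<in> {1..N}" "(1, 0) \<in> Psi k c j ` unit_square" by blast
  have ci: "fst (c i) \<le> 0" using i unfolding Psi_unit_square by (auto simp: mem_cbox_pair)
  have "1 \<le> fst (c j) + 1 / real k" using j unfolding Psi_unit_square by (auto simp: mem_cbox_pair)
  then have cj: "2 / 3 \<le> fst (c j)" using k3 by linarith
  have ij: "i \<noteq> j" using ci cj by auto
  have fw: "0 \<le> f w \<and> f w \<le> 1" if "w \<in> words N n" for w n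
    using that
  proof (induction w arbitrary: n)
    case (Cons i w)
    then have i: "i \<in> {1..N}" and w: "0 \<le> f w \<and> f w \<le> 1" by (auto simp: words_def)
    have "f (i # w) = f w / k + fst (c i)" by (simp add: f_def Psi_def divide_inverse)
    moreover have "0 \<le> f w / k" "f w / k \<le> 1 / k" using w by (auto intro: divide_right_mono)
    ultimately show ?case using c01[OF i] by linarith
  qed (simp add: f_def)
  have V: "real N ^ n / 18 \<le> word_variance N (Suc n) f" for n
  proof -
    let ?m = "word_mean N (Suc n) f"
    \<comment> \<open>The indices \<open>i\<close> and \<open>j\<close> name cells at the left and
      right edges of the square. Prefixing them to a common word separates the values of
      \<open>f\<close> by at least \<open>1 / 3\<close>, so the squared deviations from any mean sum
      to at least half of \<open>1 / 9\<close>.\<close>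
    have gap: "1 / 18 \<le> (f (i # w) - ?m)\<^sup>2 + (f (j # w) - ?m)\<^sup>2" if w: "w \<in> words N n" for w
    proof -
      have "f (i # w) = f w / k + fst (c i)" "f (j # w) = f w / k + fst (c j)"
        by (simp_all add: f_def Psi_def divide_inverse)
      moreover have "0 \<le> f w / k" "f w / k \<le> 1 / 3"
        using fw[OF w] k3 divide_right_mono[of "f w" 1 "real k"] by auto
      ultimately have "1 / 3 \<le> f (j # w) - f (i # w)" using ci cj by linarith
      then have "(1 / 3)\<^sup>2 \<le> (f (j # w) - f (i # w))\<^sup>2" by (intro power_mono) auto
      also have "\<dots> \<le> 2 * (f (i # w) - ?m)\<^sup>2 + 2 * (f (j # w) - ?m)\<^sup>2"
        using power2_sum_le[of "f (j # w) - ?m" "?m - f (i # w)"] by (simp add: power2_commute)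
      finally show ?thesis by (simp add: power2_eq_square)
    qed
    have "real N ^ n / 18 = (\<Sum>w\<in>words N n. 1 / 18)" by (simp add: card_words)
    also have "\<dots> \<le> (\<Sum>w\<in>words N n. (f (i # w) - ?m)\<^sup>2 + (f (j # w) - ?m)\<^sup>2)"
      by (intro sum_mono gap)
    also have "\<dots> = (\<Sum>l\<in>{i, j}. \<Sum>w\<in>words N n. (f (l # w) - ?m)\<^sup>2)"
      using ij by (simp add: sum.distrib)
    also have "\<dots> \<le> (\<Sum>l\<in>{1..N}. \<Sum>w\<in>words N n. (f (l # w) - ?m)\<^sup>2)"
      using i j by (intro sum_mono2) (auto intro: sum_nonneg)
    finally show ?thesis by (simp only: word_variance_def sum_words_Suc)
  qed
  have D: "graph_energy k N c K n f \<le> 9 * real N ^ n / (real k ^ n)\<^sup>2" for n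
  proof -
    have "(\<Sum>(v, w)\<in>neighbours k N c K n. (f v - f w)\<^sup>2) \<le>
        (\<Sum>(v, w)\<in>neighbours k N c K n. 1 / (real k ^ n)\<^sup>2 + 1 / (real k ^ n)\<^sup>2)"
    proof (intro sum_mono, safe)
      fix v w assume "(v, w) \<in> neighbours k N c K n"
      then have "(f v - f w)\<^sup>2 \<le> (1 / real k ^ n)\<^sup>2"
        using neighbours_offset(1)[of v w n] by (intro power2_le_iff_abs_le[THEN iffD2]) (auto simp: f_def)
      moreover have "0 \<le> (1 / real k ^ n)\<^sup>2" by simp
      ultimately show "(f v - f w)\<^sup>2 \<le> 1 / (real k ^ n)\<^sup>2 + 1 / (real k ^ n)\<^sup>2"
        unfolding power_divide power_one by linarith
    qed
    also have "\<dots> \<le> 18 * (\<Sum>w\<in>words N n. 1 / (real k ^ n)\<^sup>2)"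
      by (rule sum_neighbours_le) simp
    finally show ?thesis by (simp add: graph_energy_def card_words)
  qed
  define q where "q = real N / (real k)\<^sup>2"
  have q: "0 \<le> q" "q < 1"
  proof -
    have "N < k\<^sup>2" using N_le k_ge by (metis N_pos One_nat_def Suc_pred le_imp_less_Suc le_zero_eq not_gr_zero zero_diff)
    then have "real N < (real k)\<^sup>2" by (metis of_nat_less_iff of_nat_power)
    then show "0 \<le> q" "q < 1" by (auto simp: q_def)
  qed
  \<comment> \<open>For \<open>r \<ge> 1\<close> the factor \<open>(N / r) ^ n\<close> is at most
    \<open>N ^ n\<close>. Comparing variance with energy and dividing by a power of \<open>N\<close>
    then leaves a positive constant below a null sequence, as \<open>q < 1\<close>.\<close>
  have main: "1 / (18 * real N) \<le> 9 * b * q ^ Suc n" for n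
  proof -
    have "real N ^ n / 18 \<le> b * (real N / r) ^ Suc n * graph_energy k N c K (Suc n) f"
      using V[of n] by (rule order_trans) (rule b(2), simp)
    also have "\<dots> \<le> b * (real N) ^ Suc n * (9 * real N ^ Suc n / (real k ^ Suc n)\<^sup>2)"
      using b r by (intro mult_mono power_mono D mult_left_mono graph_energy_nonneg) (auto simp: divide_le_eq)
    also have "\<dots> = 9 * b * real N ^ Suc n * q ^ Suc n"
      by (simp add: q_def power_divide power_mult_distrib power_mult[symmetric] mult.commute)
    finally have "real N ^ n / 18 / real N ^ Suc n \<le> 9 * b * q ^ Suc n"
      by (subst pos_divide_le_eq) (auto simp: mult.commute mult.left_commute)
    moreover have "real N ^ n / 18 / real N ^ Suc n = 1 / (18 * real N)"
      using N_pos by simp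
    ultimately show ?thesis by metis
  qed
  have "(\<lambda>n. 9 * b * q ^ Suc n) \<longlonglongrightarrow> 9 * b * 0"
    using q by (intro tendsto_mult_left LIMSEQ_Suc LIMSEQ_realpow_zero) auto
  then have "1 / (18 * real N) \<le> 9 * b * 0"
    by (rule LIMSEQ_le_const) (use main in auto)
  then show False by (simp add: divide_le_0_iff)
qed

end

section \<open>Energies of cells and oscillation\<close>

lemma (in dirichlet_form) form_add_right:
  "f \<in> F \<Longrightarrow> g \<in> F \<Longrightarrow> h \<in> F \<Longrightarrow> E h (\<lambda>x. f x + g x) = E h f + E h g"
  using form_sym[of h "\<lambda>x. f x + g x"] form_sym[of h f] form_sym[of h g] form_add[of f g h] add[of f g]
  by simp

lemma (in dirichlet_form) form_scale_right: "f \<in> F \<Longrightarrow> h \<in> F \<Longrightarrow> E h (\<lambda>x. a * f x) = a * E h f"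
  using form_sym[of h "\<lambda>x. a * f x"] form_sym[of h f] form_scale[of f h a] scale[of f a] by simp

lemma (in dirichlet_form) form_quadratic:
  assumes "f \<in> F" "g \<in> F"
  shows "E (\<lambda>x. f x + t * g x) (\<lambda>x. f x + t * g x) = E f f + 2 * t * E f g + t\<^sup>2 * E g g"
  using assms
  by (simp add: add scale form_add form_scale form_add_right form_scale_right form_sym[of g f]
      power2_eq_square algebra_simps)

lemma (in dirichlet_form) diff: "f \<in> F \<Longrightarrow> g \<in> F \<Longrightarrow> (\<lambda>x. f x - g x) \<in> F"
  using add[of f "\<lambda>x. (- 1) * g x"] scale[of g "- 1"] by simp

lemma (in dirichlet_form) form_quadratic_nonneg:
  assumes "f \<in> F" "g \<in> F"
  shows "0 \<le> E f f + 2 * t * E f g + t\<^sup>2 * E g g"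
  unfolding form_quadratic[OF assms, symmetric] by (intro form_nonneg add scale assms)

text \<open>Nonnegativity at \<open>f + g\<close> and at \<open>f - g\<close>. This crude substitute
  for Cauchy-Schwarz provides the level-independent bound needed for compactness.\<close>

lemma (in dirichlet_form) form_abs_le:
  assumes "f \<in> F" "g \<in> F"
  shows "\<bar>E f g\<bar> \<le> E f f + E g g"
  using form_quadratic_nonneg[OF assms, of 1] form_quadratic_nonneg[OF assms, of "- 1"]
    form_nonneg[OF assms(1)] form_nonneg[OF assms(2)]
  by simp

lemma (in dirichlet_form) form_diff_le:
  assumes "f \<in> F" "g \<in> F"
  shows "E (\<lambda>x. f x - g x) (\<lambda>x. f x - g x) \<le> 2 * E f f + 2 * E g g"
  using form_quadratic[OF assms, of "- 1"] form_quadratic_nonneg[OF assms, of 1] by simp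

lemma (in dirichlet_form) form_zero_right:
  assumes f: "f \<in> F" and g: "g \<in> F" "E g g = 0"
  shows "E f g = 0"
proof (rule ccontr)
  assume ne: "E f g \<noteq> 0"
  \<comment> \<open>With this \<open>t\<close> the quadratic polynomial takes the value
    \<open>-1\<close>.\<close>
  define t where "t = - (E f f + 1) / (2 * E f g)"
  have "0 \<le> E f f + 2 * t * E f g + t\<^sup>2 * E g g"
    by (rule form_quadratic_nonneg[OF f g(1)])
  moreover have "2 * t * E f g = - (E f f + 1)" using ne by (simp add: t_def)
  ultimately show False using g by simp
qed

lemma cell_energy_nonneg: "0 \<le> cell_energy k N c K n f"
  by (simp add: cell_energy_def graph_energy_nonneg)

lemma limit_domain_iff:
  assumes "0 < r"
  shows "f \<in> limit_domain k N c K r \<longleftrightarrow>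
    f \<in> L2 (carpet_measure k N K) \<and> (\<exists>B. \<forall>n\<ge>1. cell_energy k N c K n f \<le> B * r ^ n)"
proof -
  have le: "inverse r ^ n * cell_energy k N c K n f \<le> B \<longleftrightarrow> cell_energy k N c K n f \<le> B * r ^ n" for n B
    using assms by (simp add: field_simps power_inverse)
  have "(SUP n\<in>{1..}. scaled_energy k N c K r n f) < \<infinity> \<longleftrightarrow>
    (\<exists>B. \<forall>n\<ge>1. inverse r ^ n * cell_energy k N c K n f \<le> B)"
  proof
    assume a: "(SUP n\<in>{1..}. scaled_energy k N c K r n f) < \<infinity>"
    have up: "ereal (inverse r ^ n * cell_energy k N c K n f) \<le> (SUP n\<in>{1..}. scaled_energy k N c K r n f)"
      if "1 \<le> n" for n
      using that unfolding scaled_energy_def by (intro SUP_upper) simp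
    have "\<bar>SUP n\<in>{1..}. scaled_energy k N c K r n f\<bar> \<noteq> \<infinity>"
      using a up[of 1] by (cases "SUP n\<in>{1..}. scaled_energy k N c K r n f") auto
    then obtain B where "(SUP n\<in>{1..}. scaled_energy k N c K r n f) = ereal B" by (auto simp: ereal_infinity_cases)
    then show "\<exists>B. \<forall>n\<ge>1. inverse r ^ n * cell_energy k N c K n f \<le> B" using up by auto
  next
    assume "\<exists>B. \<forall>n\<ge>1. inverse r ^ n * cell_energy k N c K n f \<le> B"
    then obtain B where "\<And>n. 1 \<le> n \<Longrightarrow> inverse r ^ n * cell_energy k N c K n f \<le> B" by blast
    then have "(SUP n\<in>{1..}. scaled_energy k N c K r n f) \<le> ereal B"
      by (intro SUP_least) (auto simp: scaled_energy_def)
    then show "(SUP n\<in>{1..}. scaled_energy k N c K r n f) < \<infinity>"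
      by (rule le_less_trans) simp
  qed
  then show ?thesis unfolding limit_domain_def by (simp only: mem_Collect_eq le)
qed

text \<open>The energy bounds are recast over the reals: \<open>lower\<close> expresses a bound by a
  liminf as an eventual inequality with arbitrary slack. The inequality \<open>poincare\<close> sits
  at level one because the oscillation estimate lengthens words by one letter at a time.\<close>

locale carpet_energy = nondegenerate_carpet k N c K
  for k N c K +
  fixes r :: real
    and Eb :: "(real \<times> real \<Rightarrow> real) \<Rightarrow> (real \<times> real \<Rightarrow> real) \<Rightarrow> real"
    and C0 C1 C2 :: real
  assumes r_pos [simp]: "0 < r" and r_less_1: "r < 1"
    and poincare: "\<And>f. word_variance N 1 f \<le> C0 * graph_energy k N c K 1 f"
    and dirichlet: "dirichlet_form (carpet_measure k N K) Eb (limit_domain k N c K r)"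
    and regular: "regular_form (carpet_measure k N K) Eb (limit_domain k N c K r)"
    and D4: "D4_symmetric Eb (limit_domain k N c K r)"
    and C_pos: "0 < C0" "0 < C1" "0 < C2"
    and upper: "\<And>f n. f \<in> limit_domain k N c K r \<Longrightarrow> 1 \<le> n \<Longrightarrow>
          cell_energy k N c K n f \<le> C1 * r ^ n * Eb f f"
    and lower: "\<And>f \<epsilon>. f \<in> limit_domain k N c K r \<Longrightarrow> 0 < \<epsilon> \<Longrightarrow>
          eventually (\<lambda>n. Eb f f \<le> C2 * (cell_energy k N c K n f / r ^ n) + \<epsilon>) sequentially"
begin

abbreviation "F \<equiv> limit_domain k N c K r"
abbreviation "D \<equiv> cell_energy k N c K"
abbreviation "avg f \<equiv> (\<integral>x. f x \<partial>M)"

lemma r_nonneg [simp]: "0 \<le> r" and r_nonzero [simp]: "r \<noteq> 0"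
  using r_pos by linarith+

sublocale Eb: dirichlet_form M Eb F
  by (rule dirichlet)

lemma F_iff: "f \<in> F \<longleftrightarrow> f \<in> L2 M \<and> (\<exists>B. \<forall>n\<ge>1. D n f \<le> B * r ^ n)"
  by (rule limit_domain_iff) simp

lemma F_measurable: "f \<in> F \<Longrightarrow> f \<in> borel_measurable M"
  using Eb.domain by (auto simp: L2_def)

lemma F_integrable: "f \<in> F \<Longrightarrow> integrable M f"
  using Eb.domain L2_integrable by auto

lemma measurable_Psi: "i \<in> {1..N} \<Longrightarrow> f \<in> borel_measurable M \<Longrightarrow> f \<circ> Psi k c i \<in> borel_measurable M"
  using measurable_comp Psi_measurable by blast

section \<open>Superadditivity of the discrete energies and the upper comparison\<close>

lemma cell_mean_eq_avg:
  "w \<in> words N n \<Longrightarrow> f \<in> borel_measurable M \<Longrightarrow> cell_mean k N c K n f w = avg (f \<circ> Psi_word k c w)"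
  by (simp add: cell_mean_eq)

lemma cell_mean_Psi:
  assumes "i \<in> {1..N}" "w \<in> words N n" "f \<in> borel_measurable M"
  shows "cell_mean k N c K n (f \<circ> Psi k c i) w = cell_mean k N c K (Suc n) f (i # w)"
  using assms by (simp add: cell_mean_eq measurable_Psi)

text \<open>Prefixing \<open>i\<close> embeds the edges at level \<open>n\<close> into those at
  level \<open>Suc n\<close>, with disjoint images for different \<open>i\<close>. The edges between
  different level-one cells contribute nonnegatively and are dropped.\<close>

lemma sum_cell_energy_Psi:
  assumes f: "f \<in> borel_measurable M"
  shows "(\<Sum>i\<in>{1..N}. D n (f \<circ> Psi k c i)) \<le> D (Suc n) f"
proof -
  let ?E = "neighbours k N c K" and ?m = "cell_mean k N c K"
  let ?S = "(\<lambda>(i, v, w). (i # v, i # w)) ` ({1..N} \<times> ?E n)"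
  have "(\<Sum>i\<in>{1..N}. \<Sum>(v, w)\<in>?E n. (?m n (f \<circ> Psi k c i) v - ?m n (f \<circ> Psi k c i) w)\<^sup>2)
      = (\<Sum>i\<in>{1..N}. \<Sum>(v, w)\<in>?E n. (?m (Suc n) f (i # v) - ?m (Suc n) f (i # w))\<^sup>2)"
    by (intro sum.cong) (auto simp: neighbours_def cell_mean_Psi[OF _ _ f])
  also have "\<dots> = (\<Sum>(v, w)\<in>?S. (?m (Suc n) f v - ?m (Suc n) f w)\<^sup>2)"
    by (subst sum.reindex) (auto simp: sum.cartesian_product case_prod_unfold inj_on_def)
  also have "\<dots> \<le> (\<Sum>(v, w)\<in>?E (Suc n). (?m (Suc n) f v - ?m (Suc n) f w)\<^sup>2)"
  proof (rule sum_mono2)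
    show "?S \<subseteq> ?E (Suc n)"
    proof safe
      fix i v w assume i: "i \<in> {1..N}" and vw: "(v, w) \<in> ?E n"
      then obtain x y where xy: "x \<in> K" "y \<in> K" "Psi_word k c v x = Psi_word k c w y"
        unfolding neighbours_def by blast
      then have "Psi_word k c (i # v) x \<in> Psi_word k c (i # v) ` K \<inter> Psi_word k c (i # w) ` K"
        by (metis IntI Psi_word_Cons imageI)
      then show "(i # v, i # w) \<in> ?E (Suc n)"
        using i vw Cons_in_words unfolding neighbours_def by blast
    qed
  qed (auto simp: case_prod_unfold)
  finally show ?thesis
    by (simp add: cell_energy_def graph_energy_def divide_right_mono flip: sum_divide_distrib)
qed

lemma sum_cell_energy_Psi_word:
  "f \<in> borel_measurable M \<Longrightarrow> (\<Sum>w\<in>words N m. D n (f \<circ> Psi_word k c w)) \<le> D (m + n) f"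
proof (induction m arbitrary: f)
  case (Suc m)
  have "(\<Sum>w\<in>words N (Suc m). D n (f \<circ> Psi_word k c w)) =
      (\<Sum>i\<in>{1..N}. \<Sum>w\<in>words N m. D n ((f \<circ> Psi k c i) \<circ> Psi_word k c w))"
    by (simp add: sum_words_Suc comp_Psi_word_Cons)
  also have "\<dots> \<le> (\<Sum>i\<in>{1..N}. D (m + n) (f \<circ> Psi k c i))"
    by (intro sum_mono Suc.IH measurable_Psi Suc.prems)
  also have "\<dots> \<le> D (Suc (m + n)) f" by (rule sum_cell_energy_Psi[OF Suc.prems])
  finally show ?case by (simp add: o_def)
qed simp

lemma F_Psi:
  assumes i: "i \<in> {1..N}" and f: "f \<in> F"
  shows "f \<circ> Psi k c i \<in> F"
proof -
  obtain B where B: "\<And>n. 1 \<le> n \<Longrightarrow> D n f \<le> B * r ^ n" using f F_iff by blast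
  have "D n (f \<circ> Psi k c i) \<le> (B * r) * r ^ n" if "1 \<le> n" for n
  proof -
    have "D n (f \<circ> Psi k c i) \<le> (\<Sum>i\<in>{1..N}. D n (f \<circ> Psi k c i))"
      by (rule member_le_sum[OF i]) (simp_all add: cell_energy_nonneg)
    also have "\<dots> \<le> D (Suc n) f" by (rule sum_cell_energy_Psi[OF F_measurable[OF f]])
    also have "\<dots> \<le> (B * r) * r ^ n" using B[of "Suc n"] by (simp add: mult.assoc)
    finally show ?thesis .
  qed
  then show ?thesis using f L2_Psi[OF i] unfolding F_iff by blast
qed

lemma F_Psi_word: "w \<in> words N n \<Longrightarrow> f \<in> F \<Longrightarrow> f \<circ> Psi_word k c w \<in> F"
proof (induction w arbitrary: f n)
  case (Cons i w)
  then have i: "i \<in> {1..N}" and w: "w \<in> words N (length w)" by (auto simp: words_def)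
  show ?case unfolding comp_Psi_word_Cons by (rule Cons.IH[OF w F_Psi[OF i Cons.prems(2)]])
qed simp

text \<open>At a fine level \<open>n\<close> the finitely many \<open>lower\<close> bounds hold
  simultaneously; superadditivity collects the discrete energies of the pullbacks into that of
  \<open>f\<close> at level \<open>m + n\<close>, where \<open>upper\<close> applies. The factor
  \<open>r ^ m\<close> is what remains of \<open>r ^ (m + n) / r ^ n\<close>.\<close>

lemma sum_Eb_Psi_word_le:
  assumes f: "f \<in> F"
  shows "(\<Sum>w\<in>words N m. Eb (f \<circ> Psi_word k c w) (f \<circ> Psi_word k c w)) \<le> C1 * C2 * r ^ m * Eb f f"
proof (rule field_le_epsilon)
  fix e :: real assume e: "0 < e"
  \<comment> \<open>The slack is shared equally among the \<open>N ^ m\<close> words, so that it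
    totals \<open>e\<close>.\<close>
  define \<epsilon> where "\<epsilon> = e / real N ^ m"
  have \<epsilon>: "0 < \<epsilon>" using e by (simp add: \<epsilon>_def)
  have "eventually (\<lambda>n. \<forall>w\<in>words N m. Eb (f \<circ> Psi_word k c w) (f \<circ> Psi_word k c w)
      \<le> C2 * (D n (f \<circ> Psi_word k c w) / r ^ n) + \<epsilon>) sequentially"
    by (intro eventually_ball_finite ballI lower \<epsilon>) (auto intro: F_Psi_word f)
  \<comment> \<open>The bound \<open>upper\<close> is available only at positive levels, and
    \<open>m\<close> may be \<open>0\<close>.\<close>
  then have "eventually (\<lambda>n. 1 \<le> n \<and> (\<forall>w\<in>words N m. Eb (f \<circ> Psi_word k c w) (f \<circ> Psi_word k c w)
      \<le> C2 * (D n (f \<circ> Psi_word k c w) / r ^ n) + \<epsilon>)) sequentially"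
    by (intro eventually_conj eventually_ge_at_top)
  then obtain n where n: "1 \<le> n" "\<And>w. w \<in> words N m \<Longrightarrow> Eb (f \<circ> Psi_word k c w) (f \<circ> Psi_word k c w)
      \<le> C2 * (D n (f \<circ> Psi_word k c w) / r ^ n) + \<epsilon>"
    using eventually_happens trivial_limit_sequentially by blast
  have "(\<Sum>w\<in>words N m. Eb (f \<circ> Psi_word k c w) (f \<circ> Psi_word k c w)) \<le>
      (\<Sum>w\<in>words N m. C2 * (D n (f \<circ> Psi_word k c w) / r ^ n) + \<epsilon>)"
    by (intro sum_mono n)
  also have "\<dots> = C2 / r ^ n * (\<Sum>w\<in>words N m. D n (f \<circ> Psi_word k c w)) + e"
    by (simp add: sum.distrib sum_distrib_left card_words \<epsilon>_def)
  also have "\<dots> \<le> C2 / r ^ n * (C1 * r ^ (m + n) * Eb f f) + e"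
    using sum_cell_energy_Psi_word[OF F_measurable[OF f], of n m] upper[OF f, of "m + n"] n(1) C_pos
    by (intro add_right_mono mult_left_mono) auto
  also have "\<dots> = C1 * C2 * r ^ m * Eb f f + e" by (simp add: power_add)
  finally show "(\<Sum>w\<in>words N m. Eb (f \<circ> Psi_word k c w) (f \<circ> Psi_word k c w)) \<le> C1 * C2 * r ^ m * Eb f f + e" .
qed

lemma Eb_Psi_word_le:
  assumes f: "f \<in> F" and w: "w \<in> words N m"
  shows "Eb (f \<circ> Psi_word k c w) (f \<circ> Psi_word k c w) \<le> C1 * C2 * r ^ m * Eb f f"
proof -
  have "Eb (f \<circ> Psi_word k c w) (f \<circ> Psi_word k c w)
      \<le> (\<Sum>w\<in>words N m. Eb (f \<circ> Psi_word k c w) (f \<circ> Psi_word k c w))"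
    by (rule member_le_sum[OF w]) (auto intro!: Eb.form_nonneg F_Psi_word[OF _ f])
  then show ?thesis using sum_Eb_Psi_word_le[OF f, of m] by simp
qed

lemma bounded_L2: "f \<in> borel_measurable M \<Longrightarrow> (\<And>x. x \<in> K \<Longrightarrow> \<bar>f x\<bar> \<le> B) \<Longrightarrow> f \<in> L2 M"
  unfolding L2_def
  by (auto intro!: integrable_const_bound[where B = "B\<^sup>2"] abs_le_square_iff[THEN iffD1] AE_I2) (metis abs_ge_zero abs_of_nonneg order_trans power2_abs power_mono)

lemma continuous_L2:
  assumes "continuous_on K f"
  shows "f \<in> L2 M"
proof -
  have "bounded (f ` K)" using K_compact assms by (intro compact_imp_bounded compact_continuous_image)
  then obtain B where "\<forall>x\<in>K. \<bar>f x\<bar> \<le> B" by (auto simp: bounded_iff)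
  then show ?thesis using bounded_L2 continuous_measurable_M[OF assms] by blast
qed

lemma D_const: "D n (\<lambda>x. a) = 0"
proof -
  have "cell_mean k N c K n (\<lambda>x. a) w = a" if "w \<in> words N n" for w
    using that by (simp add: cell_mean_eq)
  then show ?thesis
    unfolding cell_energy_def graph_energy_def by (auto simp: neighbours_def intro!: sum.neutral)
qed

lemma const_F: "(\<lambda>x. a) \<in> F"
  unfolding F_iff using continuous_L2[of "\<lambda>x. a"] by (auto simp: D_const intro!: exI[of _ 0])

lemma Eb_const: "Eb (\<lambda>x. a) (\<lambda>x. a) = 0"
proof (rule antisym)
  show "Eb (\<lambda>x. a) (\<lambda>x. a) \<le> 0"
  proof (rule field_le_epsilon)
    fix e :: real assume "0 < e"
    from lower[OF const_F this, of a] show "Eb (\<lambda>x. a) (\<lambda>x. a) \<le> 0 + e"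
      by (simp add: D_const eventually_const)
  qed
qed (rule Eb.form_nonneg[OF const_F])

text \<open>Overlaps are negligible by counting mass, without a study of boundaries: the cells cover
  \<open>K\<close>, so the sum is at least 1 there, and it integrates to \<open>N * (1 / N)\<close>,
  the total mass.\<close>

lemma sum_indicator_cells: "AE x in M. (\<Sum>i\<in>{1..N}. indicator (Psi k c i ` K) x) = (1 :: real)"
proof -
  have int: "integrable M (\<lambda>x. indicator (Psi k c i ` K) x :: real)" if "i \<in> {1..N}" for i
    using that by (intro integrable_real_indicator) (auto simp: less_top[symmetric])
  have cell: "(\<integral>x. indicator (Psi k c i ` K) x \<partial>M) = 1 / real N" if i: "i \<in> {1..N}" for i
    using measure_Psi[OF i, of K] Psi_image_K_sets[OF i] by (simp add: sets_M_iff Int_absorb2)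
  have "(\<integral>x. (\<Sum>i\<in>{1..N}. indicator (Psi k c i ` K) x) \<partial>M) =
      (\<Sum>i\<in>{1..N}. (\<integral>x. indicator (Psi k c i ` K) x \<partial>M) :: real)"
    by (intro Bochner_Integration.integral_sum int)
  also have "\<dots> = (\<Sum>i\<in>{1..N}. 1 / real N)"
    by (intro sum.cong refl cell)
  also have "\<dots> = 1" by simp
  finally have eq: "(\<integral>x. (\<Sum>i\<in>{1..N}. indicator (Psi k c i ` K) x) - 1 \<partial>M) = (0 :: real)"
    using int by (subst Bochner_Integration.integral_diff) auto
  have nonneg: "(0 :: real) \<le> (\<Sum>i\<in>{1..N}. indicator (Psi k c i ` K) x) - 1" if "x \<in> K" for x
  proof -
    from that K_self_similar obtain j where j: "j \<in> {1..N}" "x \<in> Psi k c j ` K" by blast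
    have "(1 :: real) = indicator (Psi k c j ` K) x" using j by simp
    also have "\<dots> \<le> (\<Sum>i\<in>{1..N}. indicator (Psi k c i ` K) x)"
      by (rule member_le_sum[OF j(1)]) auto
    finally show ?thesis by simp
  qed
  have "AE x in M. (\<Sum>i\<in>{1..N}. indicator (Psi k c i ` K) x) - 1 = (0 :: real)"
  proof (rule integral_nonneg_eq_0_iff_AE[THEN iffD1])
    show "integrable M (\<lambda>x. (\<Sum>i\<in>{1..N}. indicator (Psi k c i ` K) x) - 1 :: real)"
      by (intro Bochner_Integration.integrable_diff Bochner_Integration.integrable_sum int) auto
  qed (use eq nonneg in \<open>auto intro!: AE_I2\<close>)
  then show ?thesis by simp
qed

section \<open>From averages over cells to oscillation\<close>

lemma avg_eq:
  assumes f: "integrable M f"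
  shows "avg f = (\<Sum>i\<in>{1..N}. avg (f \<circ> Psi k c i)) / real N"
proof -
  have fm: "f \<in> borel_measurable M" using f by auto
  have int: "integrable M (\<lambda>x. indicator (Psi k c i ` K) x * f x)" if "i \<in> {1..N}" for i
    using integrable_mult_indicator[OF Psi_image_K_sets[OF that] f] by simp
  have "avg f = (\<integral>x. (\<Sum>i\<in>{1..N}. indicator (Psi k c i ` K) x) * f x \<partial>M)"
  proof (rule integral_cong_AE)
    show "(\<lambda>x. (\<Sum>i\<in>{1..N}. indicator (Psi k c i ` K) x) * f x) \<in> borel_measurable M"
      by (intro borel_measurable_times borel_measurable_sum borel_measurable_indicator Psi_image_K_sets fm)
    show "AE x in M. f x = (\<Sum>i\<in>{1..N}. indicator (Psi k c i ` K) x) * f x"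
      using sum_indicator_cells by eventually_elim simp
  qed (rule fm)
  also have "\<dots> = (\<Sum>i\<in>{1..N}. (\<integral>x. indicator (Psi k c i ` K) x * f x \<partial>M))"
    unfolding sum_distrib_right using int by (rule Bochner_Integration.integral_sum)
  also have "\<dots> = (\<Sum>i\<in>{1..N}. avg (f \<circ> Psi k c i) / real N)"
    by (intro sum.cong) (simp_all add: integral_Psi fm)
  finally show ?thesis by (simp add: sum_divide_distrib)
qed

text \<open>The average of \<open>h\<close> is the mean of its level-one cell averages, so the
  left-hand side is a single term of the variance, to which \<open>poincare\<close> and
  \<open>upper\<close> apply.\<close>

lemma avg_Psi_diff_le:
  assumes i: "i \<in> {1..N}" and h: "h \<in> F"
  shows "(avg (h \<circ> Psi k c i) - avg h)\<^sup>2 \<le> C0 * C1 * r * Eb h h"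
proof -
  have cm: "cell_mean k N c K 1 h [j] = avg (h \<circ> Psi k c j)" if "j \<in> {1..N}" for j
    using that F_measurable[OF h] by (subst cell_mean_eq) (auto simp: words_def o_def)
  have "word_mean N 1 (cell_mean k N c K 1 h) = avg h"
  proof -
    have "word_mean N 1 (cell_mean k N c K 1 h) = (\<Sum>j\<in>{1..N}. cell_mean k N c K 1 h [j]) / real N"
      by (simp add: word_mean_def sum_words_Suc)
    also have "\<dots> = (\<Sum>j\<in>{1..N}. avg (h \<circ> Psi k c j)) / real N"
      by (intro arg_cong[where f = "\<lambda>x. x / real N"] sum.cong refl cm)
    also have "\<dots> = avg h" by (rule avg_eq[OF F_integrable[OF h], symmetric])
    finally show ?thesis .
  qed
  then have "(avg (h \<circ> Psi k c i) - avg h)\<^sup>2 = (cell_mean k N c K 1 h [i] - word_mean N 1 (cell_mean k N c K 1 h))\<^sup>2"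
    using cm[OF i] by simp
  also have "\<dots> \<le> word_variance N 1 (cell_mean k N c K 1 h)"
    unfolding word_variance_def using i Cons_in_words[of i "[]" N 0] by (intro member_le_sum) auto
  also have "\<dots> \<le> C0 * D 1 h" using poincare by (simp add: cell_energy_def)
  also have "\<dots> \<le> C0 * (C1 * r * Eb h h)"
    using upper[OF h, of 1] C_pos by (intro mult_left_mono) auto
  finally show ?thesis by (simp add: mult.assoc)
qed

text \<open>Telescoping over the prefixes of \<open>w\<close>, hence induction on the last letter:
  the step from level \<open>l\<close> applies the one-letter estimate to a pullback whose energy is
  of order \<open>r ^ l\<close>.\<close>

lemma avg_Psi_word_diff_le:
  assumes h: "h \<in> F" and w: "w \<in> words N m"
  shows "\<bar>avg (h \<circ> Psi_word k c w) - avg h\<bar>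
    \<le> sqrt (C0 * C1 * r * (C1 * C2) * Eb h h) * (\<Sum>j<m. sqrt r ^ j)"
  using w
proof (induction w arbitrary: m rule: rev_induct)
  case (snoc i v)
  then obtain l where m: "m = Suc l" and v: "v \<in> words N l" and i: "i \<in> {1..N}"
    by (cases m) (auto simp: words_def)
  let ?g = "h \<circ> Psi_word k c v" and ?A = "C0 * C1 * r * (C1 * C2) * Eb h h"
  have eq: "h \<circ> Psi_word k c (v @ [i]) = ?g \<circ> Psi k c i" by (auto simp: Psi_word_append)
  have "(avg (?g \<circ> Psi k c i) - avg ?g)\<^sup>2 \<le> C0 * C1 * r * Eb ?g ?g"
    by (rule avg_Psi_diff_le[OF i F_Psi_word[OF v h]])
  also have "\<dots> \<le> C0 * C1 * r * (C1 * C2 * r ^ l * Eb h h)"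
    using C_pos by (intro mult_left_mono Eb_Psi_word_le[OF h v]) auto
  also have "\<dots> = ?A * r ^ l" by (simp add: mult_ac)
  finally have "\<bar>avg (?g \<circ> Psi k c i) - avg ?g\<bar> \<le> sqrt (?A * r ^ l)"
    by (rule real_le_rsqrt[of "\<bar>_\<bar>", simplified])
  also have "\<dots> = sqrt ?A * sqrt r ^ l" by (simp add: real_sqrt_mult real_sqrt_power)
  finally show ?case
    using snoc.IH[OF v] unfolding eq m by (simp add: distrib_left)
qed (use C_pos Eb.form_nonneg[OF h] in \<open>auto intro!: mult_nonneg_nonneg sum_nonneg\<close>)

text \<open>Squaring the telescoped bound turns the geometric series of ratio \<open>sqrt r\<close>,
  convergent because \<open>r < 1\<close>, into the factor \<open>1 / (1 - sqrt r)\<close>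
  squared.\<close>

definition C3 :: real where
  "C3 = C0 * C1 * r * (C1 * C2) / (1 - sqrt r)\<^sup>2"

lemma C3_nonneg: "0 \<le> C3"
  unfolding C3_def using C_pos by simp

lemma avg_Psi_word_diff_le':
  assumes h: "h \<in> F" and w: "w \<in> words N m"
  shows "\<bar>avg (h \<circ> Psi_word k c w) - avg h\<bar> \<le> sqrt (C3 * Eb h h)"
proof -
  have q: "0 \<le> sqrt r" "sqrt r < 1" using r_less_1 by auto
  have "(\<Sum>j<m. sqrt r ^ j) = (1 - sqrt r ^ m) / (1 - sqrt r)"
    using q by (subst sum_gp_strict) auto
  also have "\<dots> \<le> 1 / (1 - sqrt r)" using q by (intro divide_right_mono) auto
  finally have "sqrt (C0 * C1 * r * (C1 * C2) * Eb h h) * (\<Sum>j<m. sqrt r ^ j)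
      \<le> sqrt (C0 * C1 * r * (C1 * C2) * Eb h h) * (1 / (1 - sqrt r))"
    using C_pos Eb.form_nonneg[OF h] by (intro mult_left_mono) auto
  also have "\<dots> = sqrt (C3 * Eb h h)"
    using q by (simp add: C3_def real_sqrt_mult real_sqrt_divide)
  finally show ?thesis using avg_Psi_word_diff_le[OF h w] by simp
qed

lemma cell_small:
  assumes "0 < \<delta>"
  obtains n where "\<And>w x y. w \<in> words N n \<Longrightarrow> x \<in> K \<Longrightarrow> y \<in> K \<Longrightarrow> dist (Psi_word k c w x) (Psi_word k c w y) < \<delta>"
proof -
  obtain B where B: "0 < B" "\<And>x y. x \<in> K \<Longrightarrow> y \<in> K \<Longrightarrow> dist x y \<le> B"
  proof
    show "0 < diameter K + 1" using diameter_ge_0[of K] compact_imp_bounded[OF K_compact] by simp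
    show "dist x y \<le> diameter K + 1" if "x \<in> K" "y \<in> K" for x y
      using diameter_bounded_bound[OF compact_imp_bounded[OF K_compact] that] by simp
  qed
  obtain n where n: "B / \<delta> < real k ^ n"
    using real_arch_pow[of "real k" "B / \<delta>"] k_ge by auto
  have "dist (Psi_word k c w x) (Psi_word k c w y) < \<delta>" if "w \<in> words N n" "x \<in> K" "y \<in> K" for w x y
  proof -
    have "dist (Psi_word k c w x) (Psi_word k c w y) = dist x y / real k ^ n"
      using that by (simp add: dist_Psi_word words_def)
    also have "\<dots> \<le> B / real k ^ n" using B(2)[OF that(2,3)] by (intro divide_right_mono) auto
    also have "\<dots> < \<delta>" using n assms by (simp add: field_simps)
    finally show ?thesis .
  qed
  then show ?thesis using that by blast
qed

text \<open>Since \<open>r < 1\<close>, the averages over the cells shrinking to \<open>x\<close> converge geometrically.\<close>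

lemma oscillation:
  assumes h: "h \<in> F" "continuous_on K h" and x: "x \<in> K"
  shows "(h x - avg h)\<^sup>2 \<le> C3 * Eb h h"
proof -
  have "\<bar>h x - avg h\<bar> \<le> sqrt (C3 * Eb h h)"
  proof (rule field_le_epsilon)
    fix e :: real assume e: "0 < e"
    have "uniformly_continuous_on K h" using h(2) K_compact by (rule compact_uniformly_continuous)
    then obtain \<delta> where \<delta>: "0 < \<delta>" "\<And>x y. x \<in> K \<Longrightarrow> y \<in> K \<Longrightarrow> dist x y < \<delta> \<Longrightarrow> dist (h x) (h y) < e"
      using e unfolding uniformly_continuous_on_def by (metis dist_commute)
    obtain n where n: "\<And>w x y. w \<in> words N n \<Longrightarrow> x \<in> K \<Longrightarrow> y \<in> K \<Longrightarrow> dist (Psi_word k c w x) (Psi_word k c w y) < \<delta>"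
      using cell_small[OF \<delta>(1)] by blast
    obtain w y where w: "w \<in> words N n" and y: "y \<in> K" "x = Psi_word k c w y"
      using x K_eq_cells[of n] by blast
    have int: "integrable M (h \<circ> Psi_word k c w)" by (rule F_integrable[OF F_Psi_word[OF w h(1)]])
    have "\<bar>avg (h \<circ> Psi_word k c w) - h x\<bar> = \<bar>\<integral>z. (h \<circ> Psi_word k c w) z - h x \<partial>M\<bar>"
      using int by (subst Bochner_Integration.integral_diff) auto
    also have "\<dots> \<le> (\<integral>z. \<bar>(h \<circ> Psi_word k c w) z - h x\<bar> \<partial>M)" by (rule integral_abs_bound)
    also have "\<dots> \<le> (\<integral>z. e \<partial>M)"
    proof (rule integral_mono)
      fix z assume "z \<in> space M"
      then have z: "z \<in> K" by simp
      have "dist (h (Psi_word k c w z)) (h x) < e"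
        unfolding y(2) by (intro \<delta>(2) n w z y Psi_word_K[OF w])
      then show "\<bar>(h \<circ> Psi_word k c w) z - h x\<bar> \<le> e" by (simp add: dist_real_def)
    next
      show "integrable M (\<lambda>z. \<bar>(h \<circ> Psi_word k c w) z - h x\<bar>)"
        by (intro integrable_abs Bochner_Integration.integrable_diff int) simp
    qed simp
    finally have "\<bar>avg (h \<circ> Psi_word k c w) - h x\<bar> \<le> e" by simp
    then show "\<bar>h x - avg h\<bar> \<le> sqrt (C3 * Eb h h) + e"
      using avg_Psi_word_diff_le'[OF h(1) w] by linarith
  qed
  then have "\<bar>h x - avg h\<bar>\<^sup>2 \<le> (sqrt (C3 * Eb h h))\<^sup>2" by (intro power_mono) auto
  then show ?thesis using C3_nonneg Eb.form_nonneg[OF h(1)] by simp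
qed

text \<open>Touching cells share a point, and each cell mean differs from the value of
  \<open>f\<close> there by at most the oscillation inside its own cell. Membership in
  \<open>F\<close> is demanded of the pullbacks only, since the bound later serves to prove that
  \<open>f\<close> itself lies in \<open>F\<close>.\<close>

lemma D_le_sum_Eb:
  assumes cont: "continuous_on K f" and F: "\<And>w. w \<in> words N n \<Longrightarrow> f \<circ> Psi_word k c w \<in> F"
  shows "D n f \<le> 18 * C3 * (\<Sum>w\<in>words N n. Eb (f \<circ> Psi_word k c w) (f \<circ> Psi_word k c w))"
proof -
  let ?e = "\<lambda>w. C3 * Eb (f \<circ> Psi_word k c w) (f \<circ> Psi_word k c w)"
  let ?m = "cell_mean k N c K n f"
  have fm: "f \<in> borel_measurable M" by (rule continuous_measurable_M[OF cont])
  have osc: "(f (Psi_word k c w x) - ?m w)\<^sup>2 \<le> ?e w" if w: "w \<in> words N n" and x: "x \<in> K" for w x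
  proof -
    have "continuous_on K (f \<circ> Psi_word k c w)"
      by (intro continuous_on_compose continuous_Psi_word continuous_on_subset[OF cont])
        (use Psi_word_K[OF w] in auto)
    from oscillation[OF F[OF w] this x] show ?thesis using cell_mean_eq_avg[OF w fm] by simp
  qed
  have "(\<Sum>(v, w)\<in>neighbours k N c K n. (?m v - ?m w)\<^sup>2) \<le>
      (\<Sum>(v, w)\<in>neighbours k N c K n. 2 * ?e v + 2 * ?e w)"
  proof (intro sum_mono, safe)
    fix v w assume "(v, w) \<in> neighbours k N c K n"
    then obtain x y where vw: "v \<in> words N n" "w \<in> words N n" and xy: "x \<in> K" "y \<in> K"
      "Psi_word k c v x = Psi_word k c w y"
      unfolding neighbours_def by blast
    show "(?m v - ?m w)\<^sup>2 \<le> 2 * ?e v + 2 * ?e w"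
      using power2_sum_le[of "?m v - f (Psi_word k c v x)" "f (Psi_word k c w y) - ?m w"]
        osc[OF vw(1) xy(1)] osc[OF vw(2) xy(2)] xy(3) by (simp add: power2_commute)
  qed
  \<comment> \<open>The 2 inside the sum cancels against the \<open>1/2\<close> for ordered pairs in
    \<open>graph_energy\<close>, which leaves the constant 18.\<close>
  also have "\<dots> \<le> 18 * (\<Sum>w\<in>words N n. 2 * ?e w)"
    using C3_nonneg Eb.form_nonneg F by (intro sum_neighbours_le) simp
  finally show ?thesis
    by (simp add: cell_energy_def graph_energy_def sum_distrib_left mult_ac)
qed

end

section \<open>Comparison of the rescaled forms with the limit form\<close>

text \<open>Tychonoff's theorem for the product of the intervals \<open>{- B i..B i}\<close>. The
  index type is arbitrary, so convergence is along a filter and not along a subsequence.\<close>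

lemma bounded_functions_cluster:
  fixes A :: "nat \<Rightarrow> 'i \<Rightarrow> real"
  assumes "\<And>n i. \<bar>A n i\<bar> \<le> B i"
  shows "\<exists>G l. G \<noteq> bot \<and> G \<le> sequentially \<and> (\<forall>i. ((\<lambda>n. A n i) \<longlongrightarrow> l i) G)"
proof -
  define S where "S = (\<Pi>\<^sub>E i\<in>UNIV. {- B i..B i})"
  have "compactin (product_topology (\<lambda>i::'i. euclidean) UNIV) S"
    unfolding S_def by (subst compactin_PiE) simp
  then have "compact S"
    by (simp add: euclidean_product_topology)
  moreover have "filtermap A sequentially \<noteq> bot" by (simp add: filtermap_bot_iff)
  moreover have "eventually (\<lambda>x. x \<in> S) (filtermap A sequentially)"
    using assms by (auto simp: S_def eventually_filtermap abs_le_iff minus_le_iff intro!: always_eventually)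
  ultimately obtain l where l: "inf (nhds l) (filtermap A sequentially) \<noteq> bot"
    unfolding compact_filter by blast
  \<comment> \<open>This filter describes indices that are large and at which \<open>A n\<close> is
    close to \<open>l\<close>; it is proper because \<open>l\<close> is a cluster point.\<close>
  define G where "G = inf (filtercomap A (nhds l)) sequentially"
  have "G \<noteq> bot"
  proof
    assume "G = bot"
    then have "eventually (\<lambda>_. False) G" by simp
    then obtain P Q where P: "eventually P (filtercomap A (nhds l))" and Q: "eventually Q sequentially"
      and PQ: "\<And>n. P n \<Longrightarrow> Q n \<Longrightarrow> False"
      unfolding G_def eventually_inf by blast
    from P obtain R where R: "eventually R (nhds l)" "\<And>n. R (A n) \<Longrightarrow> P n"
      unfolding eventually_filtercomap by blast
    have "eventually (\<lambda>y. \<not> R y) (filtermap A sequentially)"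
      unfolding eventually_filtermap using Q by eventually_elim (use PQ R(2) in blast)
    then have "eventually (\<lambda>_. False) (inf (nhds l) (filtermap A sequentially))"
      unfolding eventually_inf using R(1) by blast
    then show False using l by (simp add: eventually_False)
  qed
  moreover have "G \<le> sequentially" by (simp add: G_def)
  moreover have "((\<lambda>n. A n i) \<longlongrightarrow> l i) G" for i
  proof -
    have "(A \<longlongrightarrow> l) G"
      unfolding G_def filterlim_def
      by (rule order_trans[OF filtermap_mono[OF inf_le1]]) (rule filtermap_filtercomap)
    moreover have "continuous_on UNIV (\<lambda>f::'i \<Rightarrow> real. f i)" by simp
    ultimately show ?thesis
      using continuous_on_tendsto_compose[of UNIV "\<lambda>f::'i \<Rightarrow> real. f i" A l G] by simp
  qed
  ultimately show ?thesis by blast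
qed

lemma L2_diff:
  assumes "f \<in> L2 M" "g \<in> L2 M"
  shows "(\<lambda>x. f x - g x) \<in> L2 M"
proof -
  have "integrable M (\<lambda>x. 2 * (f x)\<^sup>2 + 2 * (g x)\<^sup>2)" using assms by (simp add: L2_def)
  then have "integrable M (\<lambda>x. (f x - g x)\<^sup>2)"
  proof (rule Bochner_Integration.integrable_bound)
    have "(f x - g x)\<^sup>2 \<le> 2 * (f x)\<^sup>2 + 2 * (g x)\<^sup>2" for x
      using power2_sum_le[of "f x" "- g x"] by simp
    then show "AE x in M. norm ((f x - g x)\<^sup>2) \<le> norm (2 * (f x)\<^sup>2 + 2 * (g x)\<^sup>2)" by auto
  qed (use assms in \<open>auto simp: L2_def\<close>)
  then show ?thesis using assms by (auto simp: L2_def)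
qed

lemma (in dirichlet_form) form_cong_AE:
  assumes "f \<in> F" "f' \<in> F" "g \<in> F" "g' \<in> F"
    and "AE x in M. f x = f' x" "AE x in M. g x = g' x"
  shows "E f g = E f' g'"
  using form_AE[of f f' g] form_AE[of g g' f'] form_sym[of f' g] form_sym[of f' g'] assms by simp

lemma (in dirichlet_form) form_norm2_diff_le:
  assumes f: "f \<in> F" and g: "g \<in> F"
  shows "form_norm2 M E (\<lambda>x. f x - g x) \<le> 2 * form_norm2 M E f + 2 * form_norm2 M E g"
proof -
  have L: "f \<in> L2 M" "g \<in> L2 M" "(\<lambda>x. f x - g x) \<in> L2 M" using f g diff[OF f g] domain by auto
  have "(\<integral>x. (f x - g x)\<^sup>2 \<partial>M) \<le> (\<integral>x. 2 * (f x)\<^sup>2 + 2 * (g x)\<^sup>2 \<partial>M)"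
  proof (rule integral_mono)
    show "(f x - g x)\<^sup>2 \<le> 2 * (f x)\<^sup>2 + 2 * (g x)\<^sup>2" for x
      using power2_sum_le[of "f x" "- g x"] by simp
  qed (use L in \<open>auto simp: L2_def\<close>)
  also have "\<dots> = 2 * (\<integral>x. (f x)\<^sup>2 \<partial>M) + 2 * (\<integral>x. (g x)\<^sup>2 \<partial>M)"
    using L by (simp add: L2_def)
  finally show ?thesis
    using form_diff_le[OF f g] by (simp add: form_norm2_def)
qed

section \<open>Continuous representatives and the lower comparison\<close>

context carpet_energy
begin

text \<open>Oscillation controls the distance to the average, and nonnegativity of the variance
  bounds the squared average by the integral of the square.\<close>

lemma sup_norm_le:
  assumes h: "h \<in> F" "continuous_on K h" and x: "x \<in> K"
  shows "(h x)\<^sup>2 \<le> (2 * C3 + 2) * form_norm2 M Eb h"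
proof -
  have L: "integrable M (\<lambda>x. (h x)\<^sup>2)" using h Eb.domain by (auto simp: L2_def)
  have "0 \<le> (\<integral>x. (h x - avg h)\<^sup>2 \<partial>M)" by simp
  also have "\<dots> = (\<integral>x. (h x)\<^sup>2 - 2 * avg h * h x + (avg h)\<^sup>2 \<partial>M)"
    by (intro Bochner_Integration.integral_cong) (auto simp: power2_diff)
  also have "\<dots> = (\<integral>x. (h x)\<^sup>2 \<partial>M) - (avg h)\<^sup>2"
    using L F_integrable[OF h(1)] by (simp add: power2_eq_square)
  finally have "(avg h)\<^sup>2 \<le> (\<integral>x. (h x)\<^sup>2 \<partial>M)" by simp
  then have "(h x)\<^sup>2 \<le> 2 * (C3 * Eb h h) + 2 * (\<integral>x. (h x)\<^sup>2 \<partial>M)"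
    using power2_sum_le[of "h x - avg h" "avg h"] oscillation[OF h x] by simp
  also have "\<dots> \<le> (2 * C3 + 2) * form_norm2 M Eb h"
    using C3_nonneg Eb.form_nonneg[OF h(1)]
    by (simp add: form_norm2_def algebra_simps mult_nonneg_nonneg)
  finally show ?thesis .
qed

text \<open>Regularity provides continuous approximants in the form norm, and the sup-norm bound
  makes them uniformly Cauchy. Their uniform limit agrees with \<open>f\<close> almost everywhere
  because both are limits in \<open>L2\<close>.\<close>

lemma continuous_version:
  assumes f: "f \<in> F"
  obtains g where "g \<in> F" "continuous_on K g" "AE x in M. f x = g x"
proof -
  let ?nrm = "form_norm2 M Eb"
  have "\<forall>n. \<exists>g. g \<in> F \<and> continuous_on K g \<and> ?nrm (\<lambda>x. f x - g x) < inverse (real (Suc n))"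
  proof
    fix n
    have "0 < inverse (real (Suc n))" by simp
    then show "\<exists>g. g \<in> F \<and> continuous_on K g \<and> ?nrm (\<lambda>x. f x - g x) < inverse (real (Suc n))"
      using regular f unfolding regular_form_def compactly_supported_continuous_def space_M by blast
  qed
  from choice[OF this] obtain g where g: "g n \<in> F" "continuous_on K (g n)"
    "?nrm (\<lambda>x. f x - g n x) < inverse (real (Suc n))" for n by blast
  have dF: "(\<lambda>x. f x - g n x) \<in> F" for n by (rule Eb.diff[OF f g(1)])
  have close: "(g m x - g n x)\<^sup>2 \<le> (2 * C3 + 2) * (2 * inverse (real (Suc m)) + 2 * inverse (real (Suc n)))"
    if x: "x \<in> K" for m n x
  proof -
    have eq: "(\<lambda>x. g m x - g n x) = (\<lambda>x. (f x - g n x) - (f x - g m x))" by auto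
    have "(g m x - g n x)\<^sup>2 \<le> (2 * C3 + 2) * ?nrm (\<lambda>x. g m x - g n x)"
      by (rule sup_norm_le[OF Eb.diff[OF g(1) g(1)] _ x]) (intro continuous_intros g)
    also have "?nrm (\<lambda>x. g m x - g n x) \<le> 2 * ?nrm (\<lambda>x. f x - g n x) + 2 * ?nrm (\<lambda>x. f x - g m x)"
      unfolding eq by (rule Eb.form_norm2_diff_le[OF dF dF])
    also have "\<dots> \<le> 2 * inverse (real (Suc m)) + 2 * inverse (real (Suc n))"
      using g(3)[of m] g(3)[of n] by linarith
    finally show ?thesis using C3_nonneg by (simp add: mult_left_mono)
  qed
  have "uniformly_Cauchy_on K g"
  proof (rule uniformly_Cauchy_onI)
    fix e :: real assume e: "0 < e"
    have "(\<lambda>n. (2 * C3 + 2) * (4 * inverse (real (Suc n)))) \<longlonglongrightarrow> (2 * C3 + 2) * (4 * 0)"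
      by (intro tendsto_mult tendsto_const LIMSEQ_inverse_real_of_nat)
    then have "eventually (\<lambda>n. (2 * C3 + 2) * (4 * inverse (real (Suc n))) < e\<^sup>2) sequentially"
      using e by (intro order_tendstoD) auto
    then obtain n0 where n0: "(2 * C3 + 2) * (4 * inverse (real (Suc n0))) < e\<^sup>2"
      by (auto simp: eventually_sequentially)
    have "dist (g m x) (g n x) < e" if "x \<in> K" "n0 \<le> m" "n0 \<le> n" for x m n
    proof -
      have "inverse (real (Suc m)) \<le> inverse (real (Suc n0))" "inverse (real (Suc n)) \<le> inverse (real (Suc n0))"
        using that by auto
      then have "2 * inverse (real (Suc m)) + 2 * inverse (real (Suc n)) \<le> 4 * inverse (real (Suc n0))"
        by linarith
      then have "(2 * C3 + 2) * (2 * inverse (real (Suc m)) + 2 * inverse (real (Suc n)))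
          \<le> (2 * C3 + 2) * (4 * inverse (real (Suc n0)))"
        using C3_nonneg by (intro mult_left_mono) auto
      then have "(g m x - g n x)\<^sup>2 < e\<^sup>2" using close[OF that(1), of m n] n0 by linarith
      then have "\<bar>g m x - g n x\<bar>\<^sup>2 < e\<^sup>2" by simp
      then have "\<bar>g m x - g n x\<bar> < e" by (rule power2_less_imp_less) (use e in simp)
      then show ?thesis by (simp add: dist_real_def)
    qed
    then show "\<exists>M. \<forall>x\<in>K. \<forall>m\<ge>M. \<forall>n\<ge>M. dist (g m x) (g n x) < e" by blast
  qed
  then obtain h where h: "uniform_limit K g h sequentially"
    using Cauchy_uniformly_convergent unfolding uniformly_convergent_on_def by blast
  have cont: "continuous_on K h"
    by (rule uniform_limit_theorem[OF _ h]) (auto simp: g)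
  have hL: "h \<in> L2 M" by (rule continuous_L2[OF cont])
  have fhL: "(\<lambda>x. f x - h x) \<in> L2 M" using f Eb.domain by (intro L2_diff hL) auto
  have "(\<integral>x. (f x - h x)\<^sup>2 \<partial>M) \<le> 0"
  proof (rule field_le_epsilon)
    fix e :: real assume e: "0 < e"
    have "eventually (\<lambda>n. \<forall>x\<in>K. dist (g n x) (h x) < sqrt (e / 4)) sequentially"
      using uniform_limitD[OF h, of "sqrt (e / 4)"] e by simp
    moreover have "eventually (\<lambda>n. inverse (real (Suc n)) < e / 4) sequentially"
      using e by (intro order_tendstoD[OF LIMSEQ_inverse_real_of_nat]) auto
    ultimately have "eventually (\<lambda>n. (\<forall>x\<in>K. dist (g n x) (h x) < sqrt (e / 4)) \<and> inverse (real (Suc n)) < e / 4) sequentially"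
      by (rule eventually_conj)
    then obtain n where n: "\<And>x. x \<in> K \<Longrightarrow> dist (g n x) (h x) < sqrt (e / 4)" "inverse (real (Suc n)) < e / 4"
      by (auto simp: eventually_sequentially)
    have int: "integrable M (\<lambda>x. (f x - g n x)\<^sup>2)" using dF[of n] Eb.domain by (auto simp: L2_def)
    have "(\<integral>x. (f x - h x)\<^sup>2 \<partial>M) \<le> (\<integral>x. 2 * (f x - g n x)\<^sup>2 + 2 * (e / 4) \<partial>M)"
    proof (rule integral_mono)
      fix x assume "x \<in> space M"
      then have "\<bar>g n x - h x\<bar> \<le> sqrt (e / 4)" using n(1)[of x] by (simp add: dist_real_def)
      then have "\<bar>g n x - h x\<bar>\<^sup>2 \<le> (sqrt (e / 4))\<^sup>2" by (intro power_mono) auto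
      then have "(g n x - h x)\<^sup>2 \<le> e / 4" using e by simp
      then show "(f x - h x)\<^sup>2 \<le> 2 * (f x - g n x)\<^sup>2 + 2 * (e / 4)"
        using power2_sum_le[of "f x - g n x" "g n x - h x"] by simp
    qed (use int fhL in \<open>auto simp: L2_def\<close>)
    also have "\<dots> = 2 * (\<integral>x. (f x - g n x)\<^sup>2 \<partial>M) + e / 2"
      using int by simp
    also have "\<dots> \<le> 2 * ?nrm (\<lambda>x. f x - g n x) + e / 2"
      using Eb.form_nonneg[OF dF] by (simp add: form_norm2_def)
    also have "\<dots> \<le> 0 + e" using g(3)[of n] n(2) by linarith
    finally show "(\<integral>x. (f x - h x)\<^sup>2 \<partial>M) \<le> 0 + e" .
  qed
  then have "(\<integral>x. (f x - h x)\<^sup>2 \<partial>M) = 0" by (intro antisym) auto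
  then have "AE x in M. (f x - h x)\<^sup>2 = 0"
    using fhL by (subst (asm) integral_nonneg_eq_0_iff_AE) (auto simp: L2_def)
  then have ae: "AE x in M. f x = h x" by simp
  show ?thesis
    by (rule that[OF Eb.domain_AE[OF f _ ae] cont ae]) (use hL in \<open>simp add: L2_def\<close>)
qed

lemma sum_Eb_Psi_word_add_le:
  assumes "\<And>w. w \<in> words N n \<Longrightarrow> f \<circ> Psi_word k c w \<in> F"
  shows "(\<Sum>v\<in>words N (n + m). Eb (f \<circ> Psi_word k c v) (f \<circ> Psi_word k c v))
    \<le> C1 * C2 * r ^ m * (\<Sum>w\<in>words N n. Eb (f \<circ> Psi_word k c w) (f \<circ> Psi_word k c w))"
proof -
  have "(\<Sum>v\<in>words N (n + m). Eb (f \<circ> Psi_word k c v) (f \<circ> Psi_word k c v)) =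
      (\<Sum>w\<in>words N n. \<Sum>u\<in>words N m. Eb ((f \<circ> Psi_word k c w) \<circ> Psi_word k c u) ((f \<circ> Psi_word k c w) \<circ> Psi_word k c u))"
    by (simp only: sum_words_add comp_Psi_word_append)
  also have "\<dots> \<le> (\<Sum>w\<in>words N n. C1 * C2 * r ^ m * Eb (f \<circ> Psi_word k c w) (f \<circ> Psi_word k c w))"
    by (intro sum_mono sum_Eb_Psi_word_le assms)
  finally show ?thesis by (simp only: sum_distrib_left)
qed

text \<open>Oscillation control at the fine level \<open>n + m\<close>, followed by the upper
  comparison inside each cell of level \<open>n\<close>.\<close>

lemma D_add_le:
  assumes cont: "continuous_on K f" and F: "\<And>w. w \<in> words N n \<Longrightarrow> f \<circ> Psi_word k c w \<in> F"
  shows "D (n + m) f \<le> 18 * C3 * (C1 * C2 * r ^ m * (\<Sum>w\<in>words N n. Eb (f \<circ> Psi_word k c w) (f \<circ> Psi_word k c w)))"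
proof -
  have "f \<circ> Psi_word k c v \<in> F" if v: "v \<in> words N (n + m)" for v
  proof -
    have "v = take n v @ drop n v" "take n v \<in> words N n" "drop n v \<in> words N m"
      using v by (auto simp: words_def dest: in_set_takeD in_set_dropD)
    then show ?thesis using F_Psi_word[OF _ F] by (metis comp_Psi_word_append)
  qed
  then have "D (n + m) f \<le> 18 * C3 * (\<Sum>v\<in>words N (n + m). Eb (f \<circ> Psi_word k c v) (f \<circ> Psi_word k c v))"
    by (intro D_le_sum_Eb cont)
  also have "\<dots> \<le> 18 * C3 * (C1 * C2 * r ^ m * (\<Sum>w\<in>words N n. Eb (f \<circ> Psi_word k c w) (f \<circ> Psi_word k c w)))"
    using C3_nonneg by (intro mult_left_mono sum_Eb_Psi_word_add_le F) auto
  finally show ?thesis .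
qed

text \<open>The nontrivial inclusion in the self-similarity of the domain. Edges across level-one
  cells, invisible to the pullbacks, are controlled through the continuity of
  \<open>f\<close>.\<close>

lemma F_if_cells:
  assumes cont: "continuous_on K f" and F: "\<And>i. i \<in> {1..N} \<Longrightarrow> f \<circ> Psi k c i \<in> F"
  shows "f \<in> F"
proof -
  have F1: "f \<circ> Psi_word k c w \<in> F" if w: "w \<in> words N 1" for w
  proof -
    obtain i where "w = [i]" "i \<in> {1..N}" using w by (auto simp: words_Suc)
    then show ?thesis using F[of i] by (simp only: comp_Psi_word_Cons comp_Psi_word_Nil)
  qed
  \<comment> \<open>Division by \<open>r\<close> compensates for the level shift
    \<open>n = 1 + m\<close>.\<close>
  let ?B = "18 * C3 * (C1 * C2 * (\<Sum>w\<in>words N 1. Eb (f \<circ> Psi_word k c w) (f \<circ> Psi_word k c w))) / r"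
  have "D n f \<le> ?B * r ^ n" if n: "1 \<le> n" for n
  proof -
    obtain m where m: "n = 1 + m" using n le_Suc_ex by blast
    have "D n f \<le> 18 * C3 * (C1 * C2 * r ^ m * (\<Sum>w\<in>words N 1. Eb (f \<circ> Psi_word k c w) (f \<circ> Psi_word k c w)))"
      unfolding m by (rule D_add_le[OF cont F1])
    also have "\<dots> = ?B * r ^ n" by (simp add: m mult_ac)
    finally show ?thesis .
  qed
  then show ?thesis using continuous_L2[OF cont] unfolding F_iff by blast
qed

text \<open>The product combines the constants of \<open>lower\<close>, of
  \<open>D_le_sum_Eb\<close> and of the upper comparison; the summand 1 makes positivity immediate
  from \<open>C3_nonneg\<close>.\<close>

definition C4 :: real where
  "C4 = C2 * (18 * C3 * (C1 * C2)) + 1"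

lemma C4_pos: "0 < C4"
  unfolding C4_def using C_pos C3_nonneg by (intro add_nonneg_pos mult_nonneg_nonneg) auto

text \<open>For a continuous representative, \<open>lower\<close> is used at level
  \<open>n + n0\<close> with \<open>n0\<close> as large as the slack requires, and
  \<open>D_add_le\<close> moves the energy back to level \<open>n\<close>. The powers
  \<open>r ^ n0\<close> cancel, so the constant does not depend on \<open>n\<close>.\<close>

lemma Eb_le_sum_Psi_word:
  assumes f: "f \<in> F"
  shows "Eb f f \<le> C4 * ((\<Sum>w\<in>words N n. Eb (f \<circ> Psi_word k c w) (f \<circ> Psi_word k c w)) / r ^ n)"
proof -
  obtain g where g: "g \<in> F" "continuous_on K g" and ae: "AE x in M. f x = g x"
    using continuous_version[OF f] .
  let ?S = "\<lambda>g. \<Sum>w\<in>words N n. Eb (g \<circ> Psi_word k c w) (g \<circ> Psi_word k c w)"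
  have S0: "0 \<le> ?S g" by (intro sum_nonneg Eb.form_nonneg F_Psi_word[OF _ g(1)])
  have "Eb g g \<le> C4 * (?S g / r ^ n)"
  proof (rule field_le_epsilon)
    fix e :: real assume "0 < e"
    from lower[OF g(1) this] obtain n0 where n0: "\<And>l. n0 \<le> l \<Longrightarrow> Eb g g \<le> C2 * (D l g / r ^ l) + e"
      unfolding eventually_sequentially by blast
    have "Eb g g \<le> C2 * (D (n + n0) g / r ^ (n + n0)) + e" by (rule n0) simp
    also have "\<dots> \<le> C2 * (18 * C3 * (C1 * C2 * r ^ n0 * ?S g) / r ^ (n + n0)) + e"
      using C_pos
      by (intro add_right_mono mult_left_mono divide_right_mono D_add_le g(2) F_Psi_word[OF _ g(1)]) auto
    also have "\<dots> = C2 * (18 * C3 * (C1 * C2)) * (?S g / r ^ n) + e"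
      by (simp add: power_add field_simps)
    also have "\<dots> \<le> C4 * (?S g / r ^ n) + e"
      unfolding C4_def using S0
      by (intro add_right_mono mult_right_mono divide_nonneg_pos) auto
    finally show "Eb g g \<le> C4 * (?S g / r ^ n) + e" .
  qed
  moreover have "Eb f f = Eb g g" by (rule Eb.form_cong_AE[OF f g(1) f g(1) ae ae])
  moreover have "?S f = ?S g"
  proof (intro sum.cong refl)
    fix w assume w: "w \<in> words N n"
    have "AE x in M. (f \<circ> Psi_word k c w) x = (g \<circ> Psi_word k c w) x"
      using AE_Psi_word[OF w ae] by simp
    then show "Eb (f \<circ> Psi_word k c w) (f \<circ> Psi_word k c w) = Eb (g \<circ> Psi_word k c w) (g \<circ> Psi_word k c w)"
      by (intro Eb.form_cong_AE F_Psi_word[OF w] f g)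
  qed
  ultimately show ?thesis by simp
qed

end

section \<open>The self-similar form\<close>

definition (in carpet_energy) rescaled ::
  "nat \<Rightarrow> (real \<times> real \<Rightarrow> real) \<Rightarrow> (real \<times> real \<Rightarrow> real) \<Rightarrow> real" where
  "rescaled n f g = (\<Sum>w\<in>words N n. Eb (f \<circ> Psi_word k c w) (g \<circ> Psi_word k c w)) / r ^ n"

definition (in carpet_energy) cesaro ::
  "nat \<Rightarrow> (real \<times> real \<Rightarrow> real) \<Rightarrow> (real \<times> real \<Rightarrow> real) \<Rightarrow> real" where
  "cesaro n f g = (\<Sum>j<Suc n. rescaled j f g) / real (Suc n)"

context carpet_energy
begin

lemma rescaled_0 [simp]: "rescaled 0 f g = Eb f g"
  by (simp add: rescaled_def)

lemma rescaled_Suc: "rescaled (Suc n) f g = (\<Sum>i\<in>{1..N}. rescaled n (f \<circ> Psi k c i) (g \<circ> Psi k c i)) / r"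
  unfolding rescaled_def sum_words_Suc comp_Psi_word_Cons
  by (simp add: sum_divide_distrib field_simps)

lemma rescaled_add:
  assumes "f \<in> F" "g \<in> F" "h \<in> F"
  shows "rescaled n (\<lambda>x. f x + g x) h = rescaled n f h + rescaled n g h"
proof -
  have "Eb ((\<lambda>x. f x + g x) \<circ> Psi_word k c w) (h \<circ> Psi_word k c w) =
      Eb (f \<circ> Psi_word k c w) (h \<circ> Psi_word k c w) + Eb (g \<circ> Psi_word k c w) (h \<circ> Psi_word k c w)"
    if w: "w \<in> words N n" for w
    using Eb.form_add[of "f \<circ> Psi_word k c w" "g \<circ> Psi_word k c w" "h \<circ> Psi_word k c w"]
      assms[THEN F_Psi_word[OF w]] by (simp add: o_def)
  then show ?thesis by (simp add: rescaled_def sum.distrib add_divide_distrib)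
qed

lemma rescaled_scale:
  assumes "f \<in> F" "h \<in> F"
  shows "rescaled n (\<lambda>x. a * f x) h = a * rescaled n f h"
proof -
  have "Eb ((\<lambda>x. a * f x) \<circ> Psi_word k c w) (h \<circ> Psi_word k c w) =
      a * Eb (f \<circ> Psi_word k c w) (h \<circ> Psi_word k c w)"
    if w: "w \<in> words N n" for w
    using Eb.form_scale[of "f \<circ> Psi_word k c w" "h \<circ> Psi_word k c w" a]
      assms[THEN F_Psi_word[OF w]] by (simp add: o_def)
  then show ?thesis by (simp add: rescaled_def sum_distrib_left)
qed

lemma rescaled_sym: "f \<in> F \<Longrightarrow> g \<in> F \<Longrightarrow> rescaled n f g = rescaled n g f"
  unfolding rescaled_def
  by (intro arg_cong[where f = "\<lambda>x. x / r ^ n"] sum.cong refl Eb.form_sym F_Psi_word)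

lemma rescaled_AE:
  assumes "f \<in> F" "g \<in> F" "h \<in> F" "AE x in M. f x = g x"
  shows "rescaled n f h = rescaled n g h"
proof -
  have "Eb (f \<circ> Psi_word k c w) (h \<circ> Psi_word k c w) = Eb (g \<circ> Psi_word k c w) (h \<circ> Psi_word k c w)"
    if w: "w \<in> words N n" for w
    using AE_Psi_word[OF w assms(4)] by (intro Eb.form_AE F_Psi_word[OF w] assms) simp
  then show ?thesis by (simp add: rescaled_def)
qed

lemma rescaled_markov:
  assumes "f \<in> F"
  shows "rescaled n (\<lambda>x. min (max (f x) 0) 1) (\<lambda>x. min (max (f x) 0) 1) \<le> rescaled n f f"
  unfolding rescaled_def
proof (intro divide_right_mono sum_mono)
  fix w assume w: "w \<in> words N n"
  show "Eb ((\<lambda>x. min (max (f x) 0) 1) \<circ> Psi_word k c w) ((\<lambda>x. min (max (f x) 0) 1) \<circ> Psi_word k c w)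
      \<le> Eb (f \<circ> Psi_word k c w) (f \<circ> Psi_word k c w)"
    using Eb.markov[OF F_Psi_word[OF w assms]] by (simp add: o_def)
qed simp

text \<open>Moving \<Gamma> past the first cell map permutes the first letters; the sum over them is
  reindexed and the induction hypothesis handles the remaining letters.\<close>

lemma rescaled_D4:
  assumes "f \<in> F" "\<Gamma> \<in> square_isometries"
  shows "rescaled n (f \<circ> \<Gamma>) (f \<circ> \<Gamma>) = rescaled n f f"
  using assms(1)
proof (induction n arbitrary: f)
  case 0
  then show ?case using D4 assms(2) unfolding D4_symmetric_def rescaled_0 by blast
next
  case (Suc n)
  from cells_permuted[OF assms(2)] obtain \<sigma>
    where "bij_betw \<sigma> {1..N} {1..N} \<and> (\<forall>i\<in>{1..N}. \<Gamma> \<circ> Psi k c i = Psi k c (\<sigma> i) \<circ> \<Gamma>)" ..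
  then have bij: "bij_betw \<sigma> {1..N} {1..N}"
    and comm: "\<And>i. i \<in> {1..N} \<Longrightarrow> \<Gamma> \<circ> Psi k c i = Psi k c (\<sigma> i) \<circ> \<Gamma>" by blast+
  have eq: "f \<circ> \<Gamma> \<circ> Psi k c i = f \<circ> Psi k c (\<sigma> i) \<circ> \<Gamma>" if "i \<in> {1..N}" for i
    by (simp only: comp_assoc comm[OF that])
  have "(\<Sum>i\<in>{1..N}. rescaled n (f \<circ> \<Gamma> \<circ> Psi k c i) (f \<circ> \<Gamma> \<circ> Psi k c i))
      = (\<Sum>i\<in>{1..N}. rescaled n (f \<circ> Psi k c (\<sigma> i)) (f \<circ> Psi k c (\<sigma> i)))"
  proof (rule sum.cong[OF refl])
    fix i assume i: "i \<in> {1..N}"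
    have "\<sigma> i \<in> {1..N}" by (rule bij_betwE[OF bij, rule_format, OF i])
    then show "rescaled n (f \<circ> \<Gamma> \<circ> Psi k c i) (f \<circ> \<Gamma> \<circ> Psi k c i)
        = rescaled n (f \<circ> Psi k c (\<sigma> i)) (f \<circ> Psi k c (\<sigma> i))"
      unfolding eq[OF i] by (intro Suc.IH F_Psi Suc.prems)
  qed
  also have "\<dots> = (\<Sum>i\<in>{1..N}. rescaled n (f \<circ> Psi k c i) (f \<circ> Psi k c i))"
    by (rule sum.reindex_bij_betw[OF bij])
  finally show ?case unfolding rescaled_Suc by (rule arg_cong)
qed

lemma rescaled_le: "f \<in> F \<Longrightarrow> rescaled n f f \<le> C1 * C2 * Eb f f"
  unfolding rescaled_def using sum_Eb_Psi_word_le[of f n]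
  by (simp add: pos_divide_le_eq mult_ac)

lemma rescaled_ge: "f \<in> F \<Longrightarrow> Eb f f / C4 \<le> rescaled n f f"
  using Eb_le_sum_Psi_word[of f n] C4_pos unfolding rescaled_def by (simp add: pos_divide_le_eq mult_ac)

lemma rescaled_abs_le:
  assumes "f \<in> F" "g \<in> F"
  shows "\<bar>rescaled n f g\<bar> \<le> C1 * C2 * (Eb f f + Eb g g)"
proof -
  have "\<bar>rescaled n f g\<bar> \<le> (\<Sum>w\<in>words N n. \<bar>Eb (f \<circ> Psi_word k c w) (g \<circ> Psi_word k c w)\<bar>) / r ^ n"
    unfolding rescaled_def by (auto simp: abs_divide intro!: divide_right_mono)
  also have "\<dots> \<le> (\<Sum>w\<in>words N n. Eb (f \<circ> Psi_word k c w) (f \<circ> Psi_word k c w) + Eb (g \<circ> Psi_word k c w) (g \<circ> Psi_word k c w)) / r ^ n"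
    by (intro divide_right_mono sum_mono Eb.form_abs_le F_Psi_word assms) auto
  also have "\<dots> = rescaled n f f + rescaled n g g"
    by (simp add: rescaled_def sum.distrib add_divide_distrib)
  finally show ?thesis
    using rescaled_le[OF assms(1), of n] rescaled_le[OF assms(2), of n] by (simp add: distrib_left)
qed

lemma cesaro_mono_const:
  assumes "\<And>j. a \<le> rescaled j f g"
  shows "a \<le> cesaro n f g"
proof -
  have "real (Suc n) * a = (\<Sum>j<Suc n. a)" by simp
  also have "\<dots> \<le> (\<Sum>j<Suc n. rescaled j f g)" by (intro sum_mono assms)
  finally show ?thesis unfolding cesaro_def by (simp add: pos_le_divide_eq mult.commute)
qed

lemma cesaro_le_const:
  assumes "\<And>j. rescaled j f g \<le> a"
  shows "cesaro n f g \<le> a"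
proof -
  have "(\<Sum>j<Suc n. rescaled j f g) \<le> (\<Sum>j<Suc n. a)" by (intro sum_mono assms)
  also have "\<dots> = real (Suc n) * a" by simp
  finally show ?thesis unfolding cesaro_def by (simp add: pos_divide_le_eq mult.commute)
qed

text \<open>Averaging makes the sequence of rescaled forms asymptotically invariant under
  \<^term>\<open>\<lambda>E f g. (\<Sum>i\<in>{1..N}. E (f \<circ> Psi k c i) (g \<circ> Psi k c i)) / r\<close>.\<close>

lemma cesaro_self_similar:
  "(\<Sum>i\<in>{1..N}. cesaro n (f \<circ> Psi k c i) (g \<circ> Psi k c i)) / r =
    cesaro n f g + (rescaled (Suc n) f g - rescaled 0 f g) / real (Suc n)"
proof -
  have "(\<Sum>i\<in>{1..N}. cesaro n (f \<circ> Psi k c i) (g \<circ> Psi k c i)) / r =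
      (\<Sum>i\<in>{1..N}. \<Sum>j<Suc n. rescaled j (f \<circ> Psi k c i) (g \<circ> Psi k c i)) / r / real (Suc n)"
    unfolding cesaro_def sum_divide_distrib[symmetric] by (simp only: divide_divide_eq_left mult.commute)
  also have "\<dots> = (\<Sum>j<Suc n. rescaled (Suc j) f g) / real (Suc n)"
    unfolding rescaled_Suc by (subst sum.swap) (simp only: sum_divide_distrib)
  \<comment> \<open>Shifting the index by one changes only the two end terms.\<close>
  also have "(\<Sum>j<Suc n. rescaled (Suc j) f g) = (\<Sum>j<Suc n. rescaled j f g) + (rescaled (Suc n) f g - rescaled 0 f g)"
    by (simp add: sum.lessThan_Suc_shift[of "\<lambda>j. rescaled j f g" "n"] del: sum.lessThan_Suc rescaled_0)
       (simp del: rescaled_0)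
  finally show ?thesis by (simp only: cesaro_def add_divide_distrib)
qed

lemma ex_cesaro_limit:
  "\<exists>E G. G \<noteq> bot \<and> G \<le> sequentially \<and> (\<forall>f\<in>F. \<forall>g\<in>F. ((\<lambda>n. cesaro n f g) \<longlongrightarrow> E f g) G)"
proof -
  \<comment> \<open>Extended by \<open>0\<close> off the domain, where nothing is known about the
    forms; the outer absolute value in the bound below keeps it nonnegative there.\<close>
  define A where "A n p = (if fst p \<in> F \<and> snd p \<in> F then cesaro n (fst p) (snd p) else 0)" for n p
  have "\<exists>G l. G \<noteq> bot \<and> G \<le> sequentially \<and> (\<forall>p. ((\<lambda>n. A n p) \<longlongrightarrow> l p) G)"
  proof (rule bounded_functions_cluster)
    fix n p
    show "\<bar>A n p\<bar> \<le> \<bar>C1 * C2 * (Eb (fst p) (fst p) + Eb (snd p) (snd p))\<bar>"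
    proof (cases "fst p \<in> F \<and> snd p \<in> F")
      case True
      let ?B = "C1 * C2 * (Eb (fst p) (fst p) + Eb (snd p) (snd p))"
      have B: "\<bar>rescaled j (fst p) (snd p)\<bar> \<le> ?B" for j
        using True by (intro rescaled_abs_le) auto
      have "cesaro n (fst p) (snd p) \<le> ?B"
        using B by (intro cesaro_le_const) (rule abs_le_D1)
      moreover have "- ?B \<le> cesaro n (fst p) (snd p)"
        using abs_le_D2[OF B] by (intro cesaro_mono_const) (simp only: minus_le_iff)
      ultimately have "\<bar>cesaro n (fst p) (snd p)\<bar> \<le> ?B" by linarith
      then show ?thesis using True by (auto simp: A_def)
    qed (auto simp: A_def)
  qed
  then obtain G l where G: "G \<noteq> bot" "G \<le> sequentially" and l: "\<And>p. ((\<lambda>n. A n p) \<longlongrightarrow> l p) G" by blast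
  have "((\<lambda>n. cesaro n f g) \<longlongrightarrow> l (f, g)) G" if "f \<in> F" "g \<in> F" for f g
    using l[of "(f, g)"] that by (simp add: A_def)
  then show ?thesis using G by (intro exI[of _ "\<lambda>f g. l (f, g)"] exI[of _ G]) blast
qed

end

section \<open>Properties of a cluster point of the Cesaro means\<close>

locale cesaro_limit = carpet_energy +
  fixes E :: "(real \<times> real \<Rightarrow> real) \<Rightarrow> (real \<times> real \<Rightarrow> real) \<Rightarrow> real"
    and G :: "nat filter"
  assumes G_nontrivial: "G \<noteq> bot" and G_le: "G \<le> sequentially"
    and cesaro_tendsto: "\<And>f g. f \<in> F \<Longrightarrow> g \<in> F \<Longrightarrow> ((\<lambda>n. cesaro n f g) \<longlongrightarrow> E f g) G"
begin

lemma E_eqI: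
  assumes "f \<in> F" "g \<in> F" "((\<lambda>n. cesaro n f g) \<longlongrightarrow> a) G"
  shows "E f g = a"
  using tendsto_unique[OF G_nontrivial cesaro_tendsto[OF assms(1,2)] assms(3)] .

lemma E_le: "f \<in> F \<Longrightarrow> E f f \<le> C1 * C2 * Eb f f"
  by (rule tendsto_upperbound[OF cesaro_tendsto _ G_nontrivial])
     (auto intro!: always_eventually cesaro_le_const rescaled_le)

lemma E_ge: "f \<in> F \<Longrightarrow> Eb f f / C4 \<le> E f f"
  by (rule tendsto_lowerbound[OF cesaro_tendsto _ G_nontrivial])
     (auto intro!: always_eventually cesaro_mono_const rescaled_ge)

lemma Eb_le: "f \<in> F \<Longrightarrow> Eb f f \<le> C4 * E f f"
  using E_ge[of f] C4_pos by (simp add: pos_divide_le_eq mult.commute)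

lemma E_nonneg: "f \<in> F \<Longrightarrow> 0 \<le> E f f"
  using E_ge[of f] Eb.form_nonneg[of f] C4_pos by (meson divide_nonneg_pos order_trans)

lemma form_norm2_E_le: "f \<in> F \<Longrightarrow> form_norm2 M E f \<le> (C1 * C2 + 1) * form_norm2 M Eb f"
proof -
  assume f: "f \<in> F"
  have "0 \<le> C1 * C2 * (\<integral>x. (f x)\<^sup>2 \<partial>M)" using C_pos by simp
  then show ?thesis
    using E_le[OF f] Eb.form_nonneg[OF f] unfolding form_norm2_def by (simp add: algebra_simps)
qed

lemma form_norm2_Eb_le: "f \<in> F \<Longrightarrow> form_norm2 M Eb f \<le> (C4 + 1) * form_norm2 M E f"
proof -
  assume f: "f \<in> F"
  have "0 \<le> C4 * (\<integral>x. (f x)\<^sup>2 \<partial>M)" using C4_pos by simp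
  then show ?thesis
    using Eb_le[OF f] E_nonneg[OF f] unfolding form_norm2_def by (simp add: algebra_simps)
qed

lemma form_norm2_E_nonneg: "f \<in> F \<Longrightarrow> 0 \<le> form_norm2 M E f"
  unfolding form_norm2_def by (intro add_nonneg_nonneg E_nonneg integral_nonneg_AE) auto

sublocale E: dirichlet_form M E F
proof
  show "F \<subseteq> L2 M" by (rule Eb.domain)
  show "(\<lambda>x. 0) \<in> F" by (rule Eb.zero)
  fix f g h :: "real \<times> real \<Rightarrow> real" and a \<epsilon> :: real
  show "g \<in> F" if "f \<in> F" "g \<in> borel_measurable M" "AE x in M. f x = g x"
    using that by (rule Eb.domain_AE)
  show "E f h = E g h" if "f \<in> F" "g \<in> F" "h \<in> F" "AE x in M. f x = g x"
    using cesaro_tendsto[of g h] that rescaled_AE[OF that] by (intro E_eqI) (simp_all add: cesaro_def)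
  show "(\<lambda>x. f x + g x) \<in> F" if "f \<in> F" "g \<in> F" using that by (rule Eb.add)
  show "(\<lambda>x. a * f x) \<in> F" if "f \<in> F" using that by (rule Eb.scale)
  show "E (\<lambda>x. f x + g x) h = E f h + E g h" if "f \<in> F" "g \<in> F" "h \<in> F"
  proof (rule E_eqI)
    have "cesaro n (\<lambda>x. f x + g x) h = cesaro n f h + cesaro n g h" for n
      using that by (simp add: cesaro_def rescaled_add sum.distrib add_divide_distrib del: sum.lessThan_Suc)
    then show "((\<lambda>n. cesaro n (\<lambda>x. f x + g x) h) \<longlongrightarrow> E f h + E g h) G"
      using that by (simp add: tendsto_add cesaro_tendsto)
  qed (use that Eb.add in auto)
  show "E (\<lambda>x. a * f x) h = a * E f h" if "f \<in> F" "h \<in> F"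
  proof (rule E_eqI)
    have "cesaro n (\<lambda>x. a * f x) h = a * cesaro n f h" for n
      using that by (simp add: cesaro_def rescaled_scale sum_distrib_left[symmetric] del: sum.lessThan_Suc)
    then show "((\<lambda>n. cesaro n (\<lambda>x. a * f x) h) \<longlongrightarrow> a * E f h) G"
      using that by (simp add: tendsto_mult_left cesaro_tendsto)
  qed (use that Eb.scale in auto)
  show "E f g = E g f" if "f \<in> F" "g \<in> F"
    using cesaro_tendsto[of g f] that rescaled_sym[of f g] by (intro E_eqI) (simp_all add: cesaro_def)
  show "0 \<le> E f f" if "f \<in> F" using that by (rule E_nonneg)
  show "\<exists>g\<in>F. (\<integral>x. (f x - g x)\<^sup>2 \<partial>M) < \<epsilon>" if "f \<in> L2 M" "0 < \<epsilon>"
    using that by (rule Eb.dense)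
  show "(\<lambda>x. min (max (f x) 0) 1) \<in> F" if "f \<in> F" using that by (rule Eb.markov_domain)
  show "E (\<lambda>x. min (max (f x) 0) 1) (\<lambda>x. min (max (f x) 0) 1) \<le> E f f" if f: "f \<in> F"
  proof (rule tendsto_le[OF G_nontrivial])
    show "((\<lambda>n. cesaro n f f) \<longlongrightarrow> E f f) G" by (rule cesaro_tendsto[OF f f])
    show "((\<lambda>n. cesaro n (\<lambda>x. min (max (f x) 0) 1) (\<lambda>x. min (max (f x) 0) 1)) \<longlongrightarrow>
        E (\<lambda>x. min (max (f x) 0) 1) (\<lambda>x. min (max (f x) 0) 1)) G"
      by (intro cesaro_tendsto Eb.markov_domain f)
    show "\<forall>\<^sub>F n in G. cesaro n (\<lambda>x. min (max (f x) 0) 1) (\<lambda>x. min (max (f x) 0) 1) \<le> cesaro n f f"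
      unfolding cesaro_def by (intro always_eventually allI divide_right_mono sum_mono rescaled_markov f) simp
  qed
next
  fix u :: "nat \<Rightarrow> real \<times> real \<Rightarrow> real"
  assume u: "\<And>n. u n \<in> F"
    and Cauchy: "\<forall>\<epsilon>>0. \<exists>n0. \<forall>m\<ge>n0. \<forall>n\<ge>n0. form_norm2 M E (\<lambda>x. u m x - u n x) < \<epsilon>"
  \<comment> \<open>Closedness is imported from \<open>Eb\<close>: the two form norms are
    equivalent, so they have the same Cauchy sequences and the same limits.\<close>
  have "\<forall>\<epsilon>>0. \<exists>n0. \<forall>m\<ge>n0. \<forall>n\<ge>n0. form_norm2 M Eb (\<lambda>x. u m x - u n x) < \<epsilon>"
  proof (intro allI impI)
    fix \<epsilon> :: real assume "0 < \<epsilon>"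
    then have "0 < \<epsilon> / (C4 + 1)" using C4_pos by simp
    then obtain n0 where n0: "\<And>m n. n0 \<le> m \<Longrightarrow> n0 \<le> n \<Longrightarrow> form_norm2 M E (\<lambda>x. u m x - u n x) < \<epsilon> / (C4 + 1)"
      using Cauchy by meson
    have "form_norm2 M Eb (\<lambda>x. u m x - u n x) < \<epsilon>" if "n0 \<le> m" "n0 \<le> n" for m n
    proof -
      have "form_norm2 M Eb (\<lambda>x. u m x - u n x) \<le> (C4 + 1) * form_norm2 M E (\<lambda>x. u m x - u n x)"
        by (intro form_norm2_Eb_le Eb.diff u)
      also have "\<dots> < (C4 + 1) * (\<epsilon> / (C4 + 1))"
        using n0[OF that] C4_pos by (intro mult_strict_left_mono) auto
      finally show ?thesis using C4_pos by simp
    qed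
    then show "\<exists>n0. \<forall>m\<ge>n0. \<forall>n\<ge>n0. form_norm2 M Eb (\<lambda>x. u m x - u n x) < \<epsilon>" by blast
  qed
  from Eb.closed[OF u this] obtain f where f: "f \<in> F"
    and lim: "(\<lambda>n. form_norm2 M Eb (\<lambda>x. u n x - f x)) \<longlonglongrightarrow> 0" by blast
  have "(\<lambda>n. form_norm2 M E (\<lambda>x. u n x - f x)) \<longlonglongrightarrow> 0"
  proof (rule tendsto_sandwich[where f = "\<lambda>_. 0"])
    show "(\<lambda>n. (C1 * C2 + 1) * form_norm2 M Eb (\<lambda>x. u n x - f x)) \<longlonglongrightarrow> 0"
      using tendsto_mult_left[OF lim, of "C1 * C2 + 1"] by simp
    show "\<forall>\<^sub>F n in sequentially. 0 \<le> form_norm2 M E (\<lambda>x. u n x - f x)"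
      by (intro always_eventually allI form_norm2_E_nonneg Eb.diff u f)
    show "\<forall>\<^sub>F n in sequentially. form_norm2 M E (\<lambda>x. u n x - f x) \<le> (C1 * C2 + 1) * form_norm2 M Eb (\<lambda>x. u n x - f x)"
      by (intro always_eventually allI form_norm2_E_le Eb.diff u f)
  qed simp
  then show "\<exists>f\<in>F. (\<lambda>n. form_norm2 M E (\<lambda>x. u n x - f x)) \<longlonglongrightarrow> 0" using f by blast
qed

lemma E_regular: "regular_form M E F"
  unfolding regular_form_def
proof (intro conjI ballI allI impI)
  fix f \<epsilon> assume "f \<in> compactly_supported_continuous (space M)" "0 < (\<epsilon> :: real)"
  then show "\<exists>g\<in>F \<inter> compactly_supported_continuous (space M). \<forall>x\<in>space M. \<bar>f x - g x\<bar> < \<epsilon>"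
    using regular unfolding regular_form_def by blast
next
  fix f and \<epsilon> :: real assume f: "f \<in> F" and \<epsilon>: "0 < \<epsilon>"
  have C: "0 < C1 * C2 + 1" using C_pos by (simp add: add_pos_pos)
  then have "0 < \<epsilon> / (C1 * C2 + 1)" using \<epsilon> by simp
  then obtain g where g: "g \<in> F \<inter> compactly_supported_continuous (space M)"
    "form_norm2 M Eb (\<lambda>x. f x - g x) < \<epsilon> / (C1 * C2 + 1)"
    using regular f unfolding regular_form_def by meson
  have "form_norm2 M E (\<lambda>x. f x - g x) \<le> (C1 * C2 + 1) * form_norm2 M Eb (\<lambda>x. f x - g x)"
    using g f by (intro form_norm2_E_le Eb.diff) auto
  also have "\<dots> < (C1 * C2 + 1) * (\<epsilon> / (C1 * C2 + 1))"
    using g(2) C by (rule mult_strict_left_mono)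
  finally show "\<exists>g\<in>F \<inter> compactly_supported_continuous (space M). form_norm2 M E (\<lambda>x. f x - g x) < \<epsilon>"
    using g(1) C by auto
qed

lemma E_D4: "D4_symmetric E F"
  unfolding D4_symmetric_def
proof (intro ballI conjI)
  fix f \<Gamma> assume f: "f \<in> F" and \<Gamma>: "\<Gamma> \<in> square_isometries"
  show F: "f \<circ> \<Gamma> \<in> F" using D4 f \<Gamma> unfolding D4_symmetric_def by blast
  show "E (f \<circ> \<Gamma>) (f \<circ> \<Gamma>) = E f f"
    using cesaro_tendsto[OF f f] rescaled_D4[OF f \<Gamma>] by (intro E_eqI F) (simp_all add: cesaro_def)
qed

text \<open>The defect of a Cesaro mean is a difference of two bounded terms divided by
  \<open>Suc n\<close>, which vanishes along \<open>G\<close> since \<open>G\<close> is finer than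
  \<open>sequentially\<close>. The identity is kept bilinear because strong locality concerns pairs
  of different functions.\<close>

lemma E_Psi:
  assumes f: "f \<in> F" and g: "g \<in> F"
  shows "E f g = (\<Sum>i\<in>{1..N}. E (f \<circ> Psi k c i) (g \<circ> Psi k c i)) / r"
proof -
  let ?B = "C1 * C2 * (Eb f f + Eb g g)"
  have "(\<lambda>n. (rescaled (Suc n) f g - rescaled 0 f g) / real (Suc n)) \<longlonglongrightarrow> 0"
  proof (rule Lim_null_comparison)
    show "\<forall>\<^sub>F n in sequentially. norm ((rescaled (Suc n) f g - rescaled 0 f g) / real (Suc n)) \<le> 2 * ?B * inverse (real (Suc n))"
    proof (intro always_eventually allI)
      fix n
      have "\<bar>rescaled (Suc n) f g - rescaled 0 f g\<bar> \<le> 2 * ?B"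
        using rescaled_abs_le[OF f g, of "Suc n"] rescaled_abs_le[OF f g, of 0] by linarith
      then show "norm ((rescaled (Suc n) f g - rescaled 0 f g) / real (Suc n)) \<le> 2 * ?B * inverse (real (Suc n))"
        by (simp only: real_norm_def abs_divide divide_inverse abs_inverse abs_of_nat mult_right_mono inverse_nonnegative_iff_nonnegative of_nat_0_le_iff abs_mult)
    qed
    show "(\<lambda>n. 2 * ?B * inverse (real (Suc n))) \<longlonglongrightarrow> 0"
      using tendsto_mult_left[OF LIMSEQ_inverse_real_of_nat, of "2 * ?B"] by simp
  qed
  then have "((\<lambda>n. (rescaled (Suc n) f g - rescaled 0 f g) / real (Suc n)) \<longlongrightarrow> 0) G"
    by (rule tendsto_mono[OF G_le])
  then have "((\<lambda>n. cesaro n f g + (rescaled (Suc n) f g - rescaled 0 f g) / real (Suc n)) \<longlongrightarrow> E f g + 0) G"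
    by (intro tendsto_add cesaro_tendsto f g)
  moreover have "((\<lambda>n. (\<Sum>i\<in>{1..N}. cesaro n (f \<circ> Psi k c i) (g \<circ> Psi k c i)) / r) \<longlongrightarrow>
      (\<Sum>i\<in>{1..N}. E (f \<circ> Psi k c i) (g \<circ> Psi k c i)) / r) G"
    by (intro tendsto_divide tendsto_sum tendsto_const cesaro_tendsto F_Psi f g) simp_all
  ultimately show ?thesis
    unfolding cesaro_self_similar using tendsto_unique[OF G_nontrivial] by fastforce
qed

lemma E_Psi_word:
  assumes "f \<in> F" "g \<in> F"
  shows "E f g = (\<Sum>w\<in>words N n. E (f \<circ> Psi_word k c w) (g \<circ> Psi_word k c w)) / r ^ n"
  using assms
proof (induction n arbitrary: f g)
  case (Suc n)
  have "E f g = (\<Sum>i\<in>{1..N}. E (f \<circ> Psi k c i) (g \<circ> Psi k c i)) / r"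
    by (rule E_Psi[OF Suc.prems])
  also have "\<dots> = (\<Sum>i\<in>{1..N}. (\<Sum>w\<in>words N n. E (f \<circ> Psi k c i \<circ> Psi_word k c w) (g \<circ> Psi k c i \<circ> Psi_word k c w)) / r ^ n) / r"
    by (intro arg_cong[where f = "\<lambda>x. x / r"] sum.cong refl Suc.IH F_Psi Suc.prems)
  also have "\<dots> = (\<Sum>w\<in>words N (Suc n). E (f \<circ> Psi_word k c w) (g \<circ> Psi_word k c w)) / r ^ Suc n"
    unfolding sum_words_Suc comp_Psi_word_Cons by (simp add: sum_divide_distrib field_simps)
  finally show ?case .
qed simp

lemma E_self_similar: "self_similar_form k N c K E F"
  unfolding self_similar_form_def
proof (intro conjI exI[of _ r] ballI)
  show "{f \<in> F. continuous_on K f} = {f. continuous_on K f \<and> (\<forall>i\<in>{1..N}. f \<circ> Psi k c i \<in> F)}"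
    using F_Psi F_if_cells by blast
  show "f \<circ> Psi k c i \<in> F" if "f \<in> F" "i \<in> {1..N}" for f i using that by (intro F_Psi)
  show "E f f = (\<Sum>i\<in>{1..N}. inverse r * E (f \<circ> Psi k c i) (f \<circ> Psi k c i))" if "f \<in> F" for f
    using E_Psi[OF that that] by (simp add: sum_distrib_left[symmetric] divide_inverse mult.commute)
qed simp

text \<open>Constants have zero energy for \<open>Eb\<close>, hence for the comparable
  \<open>E\<close>, and a nonnegative form annihilates elements of zero energy.\<close>

lemma E_const_right:
  assumes "f \<in> F"
  shows "E f (\<lambda>x. a) = 0"
proof (rule E.form_zero_right[OF assms const_F])
  show "E (\<lambda>x. a) (\<lambda>x. a) = 0"
    using E_le[OF const_F, of a] E_nonneg[OF const_F, of a] by (simp add: Eb_const)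
qed

text \<open>At a sufficiently fine level every cell either misses the support of \<open>f\<close> or lies in the open
  set on which \<open>g\<close> is constant.\<close>

lemma E_strongly_local: "strongly_local M E F"
  unfolding strongly_local_def
proof (intro ballI impI, elim conjE exE)
  fix f g U a
  assume f: "f \<in> F" and g: "g \<in> F" and comp: "compact (ae_support M f)"
    and U: "open U" "ae_support M f \<subseteq> U" "AE x in M. x \<in> U \<longrightarrow> g x = a"
  obtain \<delta> where \<delta>: "0 < \<delta>" "(\<Union>x\<in>ae_support M f. ball x \<delta>) \<subseteq> U"
    using compact_subset_open_imp_ball_epsilon_subset[OF comp U(1,2)] by blast
  obtain n where n: "\<And>w x y. w \<in> words N n \<Longrightarrow> x \<in> K \<Longrightarrow> y \<in> K \<Longrightarrow> dist (Psi_word k c w x) (Psi_word k c w y) < \<delta>"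
    using cell_small[OF \<delta>(1)] by blast
  have "E (f \<circ> Psi_word k c w) (g \<circ> Psi_word k c w) = 0" if w: "w \<in> words N n" for w
  proof (cases "Psi_word k c w ` K \<inter> ae_support M f = {}")
    case True
    have "\<exists>V. open V \<and> x \<in> V \<and> (AE y in M. y \<in> V \<longrightarrow> f y = 0)" if x: "x \<in> Psi_word k c w ` K" for x
    proof -
      have "x \<in> space M" using x Psi_word_K[OF w] by auto
      moreover have "x \<notin> ae_support M f" using x True by blast
      ultimately show ?thesis unfolding ae_support_def by blast
    qed
    then have "\<forall>x\<in>Psi_word k c w ` K. \<exists>V. open V \<and> x \<in> V \<and> (AE y in M. y \<in> V \<longrightarrow> f y = 0)" ..
    from bchoice[OF this] obtain V
      where "\<forall>x\<in>Psi_word k c w ` K. open (V x) \<and> x \<in> V x \<and> (AE y in M. y \<in> V x \<longrightarrow> f y = 0)" ..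
    then have V: "open (V x)" "x \<in> V x" "AE y in M. y \<in> V x \<longrightarrow> f y = 0"
      if "x \<in> Psi_word k c w ` K" for x using that by blast+
    \<comment> \<open>Compactness of the cell avoids an uncountable union of exceptional null sets:
      finitely many of the neighbourhoods cover it.\<close>
    have cpt: "compact (Psi_word k c w ` K)" by (intro compact_continuous_image continuous_Psi_word K_compact)
    have cover: "Psi_word k c w ` K \<subseteq> (\<Union>x\<in>Psi_word k c w ` K. V x)" using V(2) by blast
    obtain T where T: "T \<subseteq> Psi_word k c w ` K" "finite T" "Psi_word k c w ` K \<subseteq> (\<Union>x\<in>T. V x)"
      by (rule compactE_image[OF cpt _ cover]) (rule V(1))
    have "AE y in M. \<forall>x\<in>T. y \<in> V x \<longrightarrow> f y = 0"
    proof (rule AE_finite_allI[OF T(2)])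
      fix x assume "x \<in> T"
      then have "x \<in> Psi_word k c w ` K" using T(1) by (rule subsetD[rotated])
      then show "AE y in M. y \<in> V x \<longrightarrow> f y = 0" by (rule V(3))
    qed
    then have "AE y in M. y \<in> Psi_word k c w ` K \<longrightarrow> f y = 0"
      by eventually_elim (use T(3) in blast)
    from AE_Psi_word[OF w this] AE_space have "AE x in M. (f \<circ> Psi_word k c w) x = 0"
      by eventually_elim auto
    then have "E (f \<circ> Psi_word k c w) (g \<circ> Psi_word k c w) = E (\<lambda>x. 0) (g \<circ> Psi_word k c w)"
      by (intro E.form_AE F_Psi_word[OF w] f g Eb.zero)
    also have "\<dots> = E (g \<circ> Psi_word k c w) (\<lambda>x. 0)"
      by (intro E.form_sym F_Psi_word[OF w] g Eb.zero)
    finally show ?thesis using E_const_right[OF F_Psi_word[OF w g]] by simp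
  next
    case False
    then obtain z where z: "z \<in> K" "Psi_word k c w z \<in> ae_support M f" by blast
    have sub: "Psi_word k c w ` K \<subseteq> U"
    proof
      fix y assume "y \<in> Psi_word k c w ` K"
      then have "y \<in> ball (Psi_word k c w z) \<delta>" using n[OF w z(1)] by auto
      then show "y \<in> U" using z(2) \<delta>(2) by blast
    qed
    from AE_Psi_word[OF w U(3)] AE_space have "AE x in M. (g \<circ> Psi_word k c w) x = a"
      by eventually_elim (use sub in auto)
    then have "E (f \<circ> Psi_word k c w) (g \<circ> Psi_word k c w) = E (f \<circ> Psi_word k c w) (\<lambda>x. a)"
      by (intro E.form_cong_AE F_Psi_word[OF w] f g const_F) auto
    then show ?thesis using E_const_right[OF F_Psi_word[OF w f]] by simp
  qed
  then show "E f g = 0" using E_Psi_word[OF f g, of n] by simp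
qed

text \<open>Tested on the constant 1, invariance splits zero energy into two nonnegative parts, so
  the indicator of \<open>A\<close> has zero energy. By the oscillation bound its continuous version
  is constant on \<open>K\<close>, and an almost everywhere constant indicator leaves only the two
  trivial cases.\<close>

lemma E_irreducible: "irreducible_form M E F"
  unfolding irreducible_form_def
proof (intro allI impI)
  fix A assume inv_A: "invariant_set M E F A"
  have A: "A \<in> sets M"
    using inv_A[unfolded invariant_set_def] by (rule conjunct1)
  note inv = bspec[OF conjunct2[OF inv_A[unfolded invariant_set_def]], OF const_F[of 1]]
  define h :: "real \<times> real \<Rightarrow> real" where "h = (\<lambda>x. indicator A x * 1)"
  have h: "h \<in> F" unfolding h_def by (rule conjunct1[OF inv])
  have "E (\<lambda>x. 1) (\<lambda>x. 1) = E h h + E (\<lambda>x. indicator (- A) x * 1) (\<lambda>x. indicator (- A) x * 1)"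
    unfolding h_def by (rule conjunct2[OF conjunct2[OF inv]])
  moreover have "0 \<le> E (\<lambda>x. indicator (- A) x * 1) (\<lambda>x. indicator (- A) x * 1)"
    by (rule E_nonneg[OF conjunct1[OF conjunct2[OF inv]]])
  ultimately have "E h h = 0"
    using E_const_right[OF const_F, of 1 1] E_nonneg[OF h] by linarith
  then have "Eb h h = 0" using Eb_le[OF h] Eb.form_nonneg[OF h] by simp
  obtain g where g: "g \<in> F" "continuous_on K g" and ae: "AE x in M. h x = g x"
    using continuous_version[OF h] .
  have "Eb g g = 0" using \<open>Eb h h = 0\<close> Eb.form_cong_AE[OF h g(1) h g(1) ae ae] by simp
  then have g_const: "g x = avg g" if "x \<in> K" for x using oscillation[OF g that] by simp
  have const: "AE x in M. h x = avg g" using ae AE_space by eventually_elim (use g_const in simp)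
  show "emeasure M A = 0 \<or> emeasure M (space M - A) = 0"
  proof (cases "avg g = 0")
    case True
    from const have "AE x in M. x \<notin> A"
      by eventually_elim (use True in \<open>auto simp: h_def indicator_def split: if_splits\<close>)
    then have "A \<in> null_sets M" using A by (simp add: AE_iff_null_sets)
    then show ?thesis by auto
  next
    case False
    have "x \<in> A" if "h x \<noteq> 0" for x using that unfolding h_def by (cases "x \<in> A") auto
    with False have "x \<notin> space M - A" if "h x = avg g" for x using that by auto
    with const have "AE x in M. x \<notin> space M - A" by (rule eventually_mono)
    then have "space M - A \<in> null_sets M" by (rule AE_iff_null_sets[THEN iffD2, OF sets.compl_sets[OF A]])
    then show ?thesis by auto
  qed
qed

end

section \<open>Passage from extended-real bounds to real ones, and assembly\<close>

lemma upper_energy_bound: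
  assumes "0 < r" "0 < C" "1 \<le> n"
    and "ereal C * (SUP n\<in>{1..}. scaled_energy k N c K r n f) \<le> ereal e"
  shows "cell_energy k N c K n f \<le> 1 / C * r ^ n * e"
proof -
  have "scaled_energy k N c K r n f \<le> (SUP n\<in>{1..}. scaled_energy k N c K r n f)"
    using assms(3) by (intro SUP_upper) simp
  then have "ereal C * scaled_energy k N c K r n f \<le> ereal C * (SUP n\<in>{1..}. scaled_energy k N c K r n f)"
    using assms(2) by (intro ereal_mult_left_mono) auto
  also have "\<dots> \<le> ereal e" by fact
  finally have "C * (inverse r ^ n * cell_energy k N c K n f) \<le> e"
    by (simp add: scaled_energy_def)
  then show ?thesis using assms(1,2) by (simp add: field_simps power_inverse)
qed

text \<open>Any slack makes \<open>(e - \<epsilon>) / C\<close> strictly smaller than the liminf,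
  and a strict inequality below a liminf holds eventually.\<close>

lemma lower_energy_bound:
  assumes "0 < C" "0 < \<epsilon>"
    and "ereal e \<le> ereal C * liminf (\<lambda>n. scaled_energy k N c K r n f)"
  shows "eventually (\<lambda>n. e \<le> C * (cell_energy k N c K n f / r ^ n) + \<epsilon>) sequentially"
proof -
  let ?L = "liminf (\<lambda>n. scaled_energy k N c K r n f)"
  have "ereal ((e - \<epsilon>) / C) < ?L"
  proof (rule ccontr)
    assume "\<not> ?thesis"
    then have "ereal C * ?L \<le> ereal C * ereal ((e - \<epsilon>) / C)"
      using assms(1) by (intro ereal_mult_left_mono) auto
    also have "\<dots> = ereal (e - \<epsilon>)" using assms(1) by simp
    finally have "ereal e \<le> ereal (e - \<epsilon>)" using assms(3) by (rule order_trans[rotated])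
    then show False using assms(2) by simp
  qed
  then have "eventually (\<lambda>n. ereal ((e - \<epsilon>) / C) < scaled_energy k N c K r n f) sequentially"
    by (rule less_LiminfD)
  then show ?thesis
  proof eventually_elim
    case (elim n)
    then have "(e - \<epsilon>) / C < cell_energy k N c K n f / r ^ n"
      by (simp add: scaled_energy_def divide_inverse mult.commute power_inverse)
    then show ?case using assms(1) by (simp add: pos_divide_less_eq mult.commute)
  qed
qed

text \<open>If the Hausdorff measure of \<open>K\<close> were not a finite positive measure, \<^const>\<open>carpet_measure\<close> would be
  the null measure by convention, and every form would vanish. Treating this case separately
  makes it unnecessary to prove that the measure is nondegenerate.\<close>

lemma (in unconstrained_carpet) degenerate_form:
  assumes null: "emeasure (carpet_measure k N K) K = 0"
    and form: "dirichlet_form (carpet_measure k N K) E F"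
  shows "strongly_local (carpet_measure k N K) E F"
    and "irreducible_form (carpet_measure k N K) E F"
    and "self_similar_form k N c K E F"
proof -
  interpret dirichlet_form M E F by (rule form)
  \<comment> \<open>With \<open>K\<close> a null set every statement holds almost everywhere, so the
    domain consists of all measurable functions and each of them is identified with 0.\<close>
  have AE: "AE x in M. P x" for P
    by (rule AE_I'[of K]) (use null in \<open>auto simp: null_sets_def sets_M_iff\<close>)
  have F: "f \<in> F \<longleftrightarrow> f \<in> borel_measurable M" for f
    using domain domain_AE[OF zero _ AE] by (auto simp: L2_def)
  have E0: "E f g = 0" if "f \<in> F" "g \<in> F" for f g
  proof -
    have "E f g = E (\<lambda>x. 0 * g x) g" by (rule form_AE) (use that zero AE in auto)
    also have "\<dots> = 0" using form_scale[OF that(2,2), of 0] by simp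
    finally show ?thesis .
  qed
  show "strongly_local M E F" unfolding strongly_local_def using E0 by blast
  have "emeasure M A = 0" if "A \<in> sets M" for A
    using emeasure_mono[of A K M] that null by (auto simp: sets_M_iff)
  then show "irreducible_form M E F" unfolding irreducible_form_def invariant_set_def by blast
  have Psi: "f \<circ> Psi k c i \<in> F" if "f \<in> F" "i \<in> {1..N}" for f i
    using that measurable_comp[OF Psi_measurable] unfolding F by blast
  show "self_similar_form k N c K E F"
    unfolding self_similar_form_def
  proof (intro conjI exI[of _ 1] ballI)
    show "{f \<in> F. continuous_on K f} = {f. continuous_on K f \<and> (\<forall>i\<in>{1..N}. f \<circ> Psi k c i \<in> F)}"
      using Psi continuous_measurable_M F by blast
    show "E f f = (\<Sum>i\<in>{1..N}. inverse 1 * E (f \<circ> Psi k c i) (f \<circ> Psi k c i))" if "f \<in> F" for f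
      using E0 Psi that by simp
  qed (use Psi in auto)
qed

theorem theorem5p2:
  fixes k N :: nat
    and c :: "nat \<Rightarrow> real \<times> real"
    and K :: "(real \<times> real) set"
    and r :: real
    and Ebar :: "(real \<times> real \<Rightarrow> real) \<Rightarrow> (real \<times> real \<Rightarrow> real) \<Rightarrow> real"
  assumes carpet: "unconstrained_carpet k N c K"
    and scaling: "is_energy_scaling k N c K r"
    and limit_form: "is_limit_form k N c K r Ebar"
  shows "\<exists>E F.
      dirichlet_form (carpet_measure k N K) E F \<and>
      strongly_local (carpet_measure k N K) E F \<and>
      regular_form (carpet_measure k N K) E F \<and>
      irreducible_form (carpet_measure k N K) E F \<and>
      D4_symmetric E F \<and>
      self_similar_form k N c K E F \<and>
      F = limit_domain k N c K r \<and>
      (\<exists>C>0. \<exists>C'>0. \<forall>f\<in>F. C * Ebar f f \<le> E f f \<and> E f f \<le> C' * Ebar f f)"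
proof -
  interpret unconstrained_carpet k N c K by (rule carpet)
  let ?F = "limit_domain k N c K r"
  have dir: "dirichlet_form M Ebar ?F" and reg: "regular_form M Ebar ?F" and D4: "D4_symmetric Ebar ?F"
    using limit_form unfolding is_limit_form_def by blast+
  obtain C1 C2 where C: "0 < C1" "0 < C2"
    and up: "\<And>f. f \<in> ?F \<Longrightarrow> ereal C1 * (SUP n\<in>{1..}. scaled_energy k N c K r n f) \<le> ereal (Ebar f f)"
    and low: "\<And>f. f \<in> ?F \<Longrightarrow> ereal (Ebar f f) \<le> ereal C2 * liminf (\<lambda>n. scaled_energy k N c K r n f)"
    using limit_form unfolding is_limit_form_def by blast
  show ?thesis
  proof (cases "emeasure M K = 0")
    case True
    \<comment> \<open>Here \<open>Ebar\<close> itself serves as the self-similar form, with both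
      constants 1.\<close>
    have "\<exists>C>0. \<exists>C'>0. \<forall>f\<in>?F. C * Ebar f f \<le> Ebar f f \<and> Ebar f f \<le> C' * Ebar f f"
      by (intro exI[of _ 1] conjI) auto
    then show ?thesis using dir reg D4 degenerate_form[OF True dir] by blast
  next
    case False
    interpret energy_scaling k N c K r by unfold_locales (rule scaling)
    obtain b where b: "0 < b"
      "\<And>n f. 1 \<le> n \<Longrightarrow> word_variance N n f \<le> b * (real N / r) ^ n * graph_energy k N c K n f"
      using poincare by blast
    interpret Ebar: dirichlet_form M Ebar ?F by (rule dir)
    \<comment> \<open>The parameter \<open>C0\<close> is the Poincare constant at level one. The
      locale's \<open>C1\<close> is the reciprocal of the constant obtained here, because
      \<open>upper\<close> bounds the discrete energy by the form.\<close>
    interpret carpet_energy k N c K r Ebar "b * (real N / r)" "1 / C1" C2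
    proof unfold_locales
      show "word_variance N 1 f \<le> b * (real N / r) * graph_energy k N c K 1 f" for f
        using b(2)[of 1 f] by simp
      show "cell_energy k N c K n f \<le> 1 / C1 * r ^ n * Ebar f f" if "f \<in> ?F" "1 \<le> n" for f n
        using C that by (intro upper_energy_bound up) auto
      show "eventually (\<lambda>n. Ebar f f \<le> C2 * (cell_energy k N c K n f / r ^ n) + \<epsilon>) sequentially"
        if "f \<in> ?F" "0 < \<epsilon>" for f \<epsilon>
        using C that by (intro lower_energy_bound low) auto
    qed (use False dir reg D4 b C in \<open>auto\<close>)
    obtain E G where "G \<noteq> bot" "G \<le> sequentially"
      "\<forall>f\<in>?F. \<forall>g\<in>?F. ((\<lambda>n. cesaro n f g) \<longlongrightarrow> E f g) G"
      using ex_cesaro_limit by blast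
    then interpret cesaro_limit k N c K r Ebar "b * (real N / r)" "1 / C1" C2 E G
      by unfold_locales auto
    have "\<exists>C>0. \<exists>C'>0. \<forall>f\<in>?F. C * Ebar f f \<le> E f f \<and> E f f \<le> C' * Ebar f f"
    proof (intro exI conjI ballI)
      show "0 < 1 / C4" "0 < 1 / C1 * C2" using C C4_pos by auto
      show "1 / C4 * Ebar f f \<le> E f f" "E f f \<le> 1 / C1 * C2 * Ebar f f" if "f \<in> ?F" for f
        using E_ge[OF that] E_le[OF that] by auto
    qed
    then show ?thesis
      using E.dirichlet_form_axioms E_strongly_local E_regular E_irreducible E_D4 E_self_similar by blast
  qed
qed

end
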